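(* Let $n\ge 1$, $T>0$, and suppose: $\ell:\mathbb{R}^n\to\mathbb{R}$ is $C^2$, strictly convex, $\lim_{|u|\to\infty}\ell(u)/|u|=\infty$, and $\nabla^2\ell(u)$ is positive definite for every $u\in\mathbb{R}^n$; $g:\mathbb{R}^n\to\mathbb{R}$ is globally Lipschitz and differentiable; $d:[0,T]\times[0,T]\to(a,1]$, $(t,s)\mapsto d_t(s)$, with $a>0$, is Lipschitz continuous with $d_t(t)=1$ for each $t$, and for every $t\le s\le T$, $d_t(s)$ and $\frac{\partial}{\partial t}d_t(s)$ are continuous in $t$ and summable in $s$. Then the function $$v(x,t)=\min_{p\in\mathbb{R}^n}\left\{\int_t^T d_t(s)\,\ell\big(\iota(d_t^{-1}(s)p)\big)\,ds+d_t(T)\,g\Big(x+\int_t^T\iota(d_t^{-1}(s)p)\,ds\Big)\right\}$$ is equal to the value function $$\inf_{y\in \mathrm{AC}_{x,t}}\left\{\int_t^T d_t(s)\,\ell(\dot y(s))\,ds+d_t(T)\,g(y(T))\right\},$$ is locally Lipschitz continuous in $\mathbb{R}^n\times[0,T)$, and solves the terminal value problem $$-v_t+\ell^*(-v_x)+w(x,t,\iota(-v_x))=0\ \text{ a.e. in }\mathbb{R}^n\times(0,T),\qquad v=g\ \text{ on }\mathbb{R}^n\times\{t=T\}.$$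
   Context: $\mathrm{AC}_{x,t}$ is the set of absolutely continuous $y:[t,T]\to\mathbb{R}^n$ with $y(t)=x$. $\ell^*(p)=\sup_{u\in\mathbb{R}^n}\{p\cdot u-\ell(u)\}$. $v_x$ is the gradient in $x$, $v_t$ the derivative in $t$. $\iota=(\nabla\ell)^{-1}$ is the inverse function of the bijection $\nabla\ell:\mathbb{R}^n\to\mathbb{R}^n$, and $d_t^{-1}(s)=1/d_t(s)$. For $x,\alpha\in\mathbb{R}^n$, $0\le t\le s\le T$: $$U_{t,\alpha}(s)=\iota(d_t^{-1}(s)\nabla\ell(\alpha)),\qquad Y_{t,x,\alpha}(s)=x+\int_t^s U_{t,\alpha}(r)\,dr,$$ $$w(x,t,\alpha)=\int_t^T\frac{\partial d_t}{\partial t}(s)\,\ell(U_{t,\alpha}(s))\,ds+\frac{\partial d_t}{\partial t}(T)\,g(Y_{t,x,\alpha}(T)).$$ Only the values $d_t(s)$ with $t\le s$ enter. "A.e." means at Lebesgue-almost every point, with $v$ differentiable there. *)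

theory Defs
  imports "HOL-Analysis.Analysis"
begin

definition strictly_convex :: "('a::real_vector \<Rightarrow> real) \<Rightarrow> bool" where
  "strictly_convex f \<longleftrightarrow>
     (\<forall>x y. \<forall>\<theta>\<in>{0<..<1}. x \<noteq> y \<longrightarrow>
        f ((1 - \<theta>) *\<^sub>R x + \<theta> *\<^sub>R y) < (1 - \<theta>) * f x + \<theta> * f y)"

(* Meaningful where f is differentiable; the gradient is then unique. *)
definition grad :: "('a::real_inner \<Rightarrow> real) \<Rightarrow> 'a \<Rightarrow> 'a" where
  "grad f x = (THE D. GDERIV f x :> D)"

definition hessian :: "(real ^ 'n \<Rightarrow> real) \<Rightarrow> real ^ 'n \<Rightarrow> real ^ 'n ^ 'n" where
  "hessian f x = jacobian (grad f) (at x)"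

definition C2 :: "(real ^ 'n \<Rightarrow> real) \<Rightarrow> bool" where
  "C2 f \<longleftrightarrow> (\<forall>x. f differentiable (at x)) \<and> (\<forall>x. grad f differentiable (at x)) \<and>
     continuous_on UNIV (hessian f)"

(* No symmetry requirement: the Hessian of a C2 function is symmetric anyway. *)
definition pos_def :: "real ^ 'n ^ 'n \<Rightarrow> bool" where
  "pos_def A \<longleftrightarrow> (\<forall>h. h \<noteq> 0 \<longrightarrow> 0 < h \<bullet> (A *v h))"

definition locally_lipschitz_on :: "'a::metric_space set \<Rightarrow> ('a \<Rightarrow> 'b::metric_space) \<Rightarrow> bool" where
  "locally_lipschitz_on X f \<longleftrightarrow> (\<forall>x\<in>X. \<exists>r>0. \<exists>L. L-lipschitz_on (cball x r \<inter> X) f)"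

definition abs_cont_on :: "real \<Rightarrow> real \<Rightarrow> (real \<Rightarrow> 'a::real_normed_vector) \<Rightarrow> bool" where
  "abs_cont_on a b f \<longleftrightarrow>
     (\<forall>\<epsilon>>0. \<exists>\<delta>>0. \<forall>(m::nat) l r.
        (\<forall>i<m. a \<le> l i \<and> l i \<le> r i \<and> r i \<le> b) \<and>
        disjoint_family_on (\<lambda>i. {l i<..<r i}) {..<m} \<and>
        (\<Sum>i<m. r i - l i) < \<delta> \<longrightarrow>
        (\<Sum>i<m. norm (f (r i) - f (l i))) < \<epsilon>)"

definition AC :: "real \<Rightarrow> real ^ 'n \<Rightarrow> real \<Rightarrow> (real \<Rightarrow> real ^ 'n) set" where
  "AC T x t = {y. abs_cont_on t T y \<and> y t = x}"

definition conjugate :: "(real ^ 'n \<Rightarrow> real) \<Rightarrow> real ^ 'n \<Rightarrow> real" where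
  "conjugate l p = (SUP u. p \<bullet> u - l u)"

abbreviation iota :: "(real ^ 'n \<Rightarrow> real) \<Rightarrow> real ^ 'n \<Rightarrow> real ^ 'n" where
  "iota l \<equiv> inv (grad l)"

(* The partial derivative of d in its first argument, seen from the triangle t <= s:
   at t = s it is the left derivative. A two-sided derivative there could only be 0, since
   d_t(s) <= 1 = d_s(s), which would exclude even exponential discounting. *)
definition partial_t :: "(real \<Rightarrow> real \<Rightarrow> real) \<Rightarrow> real \<Rightarrow> real \<Rightarrow> real" where
  "partial_t d t s = vector_derivative (\<lambda>\<tau>. d \<tau> s) (at t within {0..s})"

definition U_curve ::
  "(real ^ 'n \<Rightarrow> real) \<Rightarrow> (real \<Rightarrow> real \<Rightarrow> real) \<Rightarrow> real \<Rightarrow> real ^ 'n \<Rightarrow> real \<Rightarrow> real ^ 'n" where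
  "U_curve l d t \<alpha> s = iota l ((1 / d t s) *\<^sub>R grad l \<alpha>)"

definition Y_curve ::
  "(real ^ 'n \<Rightarrow> real) \<Rightarrow> (real \<Rightarrow> real \<Rightarrow> real) \<Rightarrow> real \<Rightarrow> real ^ 'n \<Rightarrow> real ^ 'n \<Rightarrow> real \<Rightarrow> real ^ 'n"
where
  "Y_curve l d t x \<alpha> s = x + (LINT r:{t..s}|lebesgue. U_curve l d t \<alpha> r)"

definition w_fun ::
  "(real ^ 'n \<Rightarrow> real) \<Rightarrow> (real ^ 'n \<Rightarrow> real) \<Rightarrow> (real \<Rightarrow> real \<Rightarrow> real) \<Rightarrow> real
     \<Rightarrow> real ^ 'n \<Rightarrow> real \<Rightarrow> real ^ 'n \<Rightarrow> real" where
  "w_fun l g d T x t \<alpha> =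
     (LINT s:{t..T}|lebesgue. partial_t d t s * l (U_curve l d t \<alpha> s))
     + partial_t d t T * g (Y_curve l d t x \<alpha> T)"

definition p_cost ::
  "(real ^ 'n \<Rightarrow> real) \<Rightarrow> (real ^ 'n \<Rightarrow> real) \<Rightarrow> (real \<Rightarrow> real \<Rightarrow> real) \<Rightarrow> real
     \<Rightarrow> real ^ 'n \<Rightarrow> real \<Rightarrow> real ^ 'n \<Rightarrow> real" where
  "p_cost l g d T x t p =
     (LINT s:{t..T}|lebesgue. d t s * l (iota l ((1 / d t s) *\<^sub>R p)))
     + d t T * g (x + (LINT s:{t..T}|lebesgue. iota l ((1 / d t s) *\<^sub>R p)))"

(* Written as an infimum; that it is a minimum is part of what is to be proved. *)
definition v_fun ::
  "(real ^ 'n \<Rightarrow> real) \<Rightarrow> (real ^ 'n \<Rightarrow> real) \<Rightarrow> (real \<Rightarrow> real \<Rightarrow> real) \<Rightarrow> real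
     \<Rightarrow> real ^ 'n \<Rightarrow> real \<Rightarrow> real" where
  "v_fun l g d T x t = (INF p. p_cost l g d T x t p)"

(* Extended-valued Lebesgue integral, needed because the running cost of an absolutely
   continuous curve may be infinite, where the Bochner integral would return 0. *)
definition ext_integral :: "'a measure \<Rightarrow> ('a \<Rightarrow> real) \<Rightarrow> ereal" where
  "ext_integral M f =
     enn2ereal (\<integral>\<^sup>+ x. ennreal (f x) \<partial>M) - enn2ereal (\<integral>\<^sup>+ x. ennreal (- f x) \<partial>M)"

definition value_fun ::
  "(real ^ 'n \<Rightarrow> real) \<Rightarrow> (real ^ 'n \<Rightarrow> real) \<Rightarrow> (real \<Rightarrow> real \<Rightarrow> real) \<Rightarrow> real
     \<Rightarrow> real ^ 'n \<Rightarrow> real \<Rightarrow> ereal" where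
  "value_fun l g d T x t =
     (INF y\<in>AC T x t.
        ext_integral (lebesgue_on {t..T})
          (\<lambda>s. d t s * l (vector_derivative y (at s within {t..T})))
        + ereal (d t T * g (y T)))"

end

theory Submission
  imports Defs
begin

text \<open>A curve is optimal among those with the same endpoints as soon as \<open>d\<^sub>t \<nabla>l(y') = p\<close> is constant in time,
  by convexity of \<open>l\<close>; Brouwer's theorem shows that every displacement \<open>y(T) - x\<close> is realised by such a curve.
  This gives \<open>v\<close> as the value function, and restricting the optimal velocity for one initial time to another
  gives local Lipschitz continuity. Adding to the optimal velocity at \<open>(x, t)\<close> the constant that corrects the
  displacement yields competitors for all nearby data: they bound \<open>v\<close> from above by a function that touches it
  at \<open>(x, t)\<close> and is differentiable there with \<open>x\<close>-gradient \<open>-p\<close> and \<open>t\<close>-derivative \<open>l\<^sup>*(p) + w(x, t, \<iota>(p))\<close>.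
  So \<open>v\<close> has a supergradient at every interior point, and wherever \<open>v\<close> is differentiable its derivative
  is that supergradient, which is the equation. A Lipschitz function that has a supergradient everywhere is
  differentiable almost everywhere, since on almost every line in each of countably many directions
  the one-dimensional Lebesgue theorem applies and the supergradient makes the directional derivatives linear.\<close>

section \<open>Absolutely continuous curves\<close>

text \<open>The infimum in the value function runs over all absolutely continuous curves, so the
  bound from below needs each of them to gain exactly the integral of its derivative. That
  derivative is integrated in the gauge sense, in which the signed first-order term of the convexity
  inequality cancels; the running cost, which may be infinite, is only compared with it from below.

  Prescribing the displacement prescribes the end point, so terminal costs agree and only running
  costs are compared. This is how a minimisation over curves becomes one over the vector
  \<open>p\<close>.

  The time derivative has three sources. Starting later removes \<open>l (iota l p)\<close> from the
  running cost, and making up for the lost displacement costs \<open>p \<bullet> iota l p\<close>;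
  together they are \<open>conjugate l p\<close>. The third source is the discount function, which
  itself depends on the initial time, and its derivative produces \<open>w\<close>.

  The minimising \<open>p\<close> may fail to be unique. Each one yields a supergradient, and
  differentiability at a point forces them to coincide.\<close>

definition incr :: "(real \<Rightarrow> 'a::real_normed_vector) \<Rightarrow> real set \<Rightarrow> 'a" where
  "incr f K = f (Sup K) - f (Inf K)"

lemma incr_Icc [simp]: "u \<le> w \<Longrightarrow> incr f {u..w} = f w - f u"
  by (simp add: incr_def)

lemma division_of_real_IccE:
  fixes D :: "real set set"
  assumes "D division_of S" "K \<in> D"
  obtains u w where "u \<le> w" "K = {u..w}"
  using division_ofD(3,4)[OF assms] by (metis atLeastatMost_empty_iff box_real(2) not_le)

lemma sum_incr_division:
  assumes "D division_of {a..b}" "a \<le> b"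
  shows "sum (incr f) D = f b - f a"
proof -
  let ?p = "(\<lambda>K. (Inf K, K)) ` D"
  have "?p tagged_division_of {a..b}"
  proof (rule tagged_division_ofI)
    show "finite ?p" using division_of_finite[OF assms(1)] by simp
  next
    fix x K assume "(x, K) \<in> ?p"
    then have K: "K \<in> D" "x = Inf K" by auto
    obtain u w where uw: "u \<le> w" "K = {u..w}" using division_of_real_IccE[OF assms(1) K(1)] .
    then show "x \<in> K" using K(2) by simp
    show "K \<subseteq> {a..b}" using division_ofD(2)[OF assms(1) K(1)] .
    show "\<exists>a b. K = cbox a b" using division_ofD(4)[OF assms(1) K(1)] .
  next
    fix x1 K1 x2 K2 assume "(x1, K1) \<in> ?p" "(x2, K2) \<in> ?p" "(x1, K1) \<noteq> (x2, K2)"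
    then show "interior K1 \<inter> interior K2 = {}"
      using division_ofD(5)[OF assms(1)] by auto
  next
    show "\<Union> {K. \<exists>x. (x, K) \<in> ?p} = {a..b}"
      using division_ofD(6)[OF assms(1)] by (simp add: image_iff)
  qed
  from additive_tagged_division_1[OF assms(2) this, of f]
  show ?thesis
    by (subst (asm) sum.reindex) (auto simp: inj_on_def incr_def)
qed

text \<open>The definition of absolute continuity speaks of indexed families of disjoint open
  intervals, whereas coverings and gauges produce divisions; enumerating the division and passing to
  interiors translates between them.\<close>

lemma abs_cont_on_division:
  assumes "abs_cont_on a b f" "0 < e"
  obtains d where "0 < d"
    "\<And>D. D division_of \<Union>D \<Longrightarrow> \<Union>D \<subseteq> {a..b} \<Longrightarrow> measure lebesgue (\<Union>D) < d
      \<Longrightarrow> (\<Sum>K\<in>D. norm (incr f K)) < e"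
proof -
  obtain d where d: "0 < d"
    "\<forall>(m::nat) l r. (\<forall>i<m. a \<le> l i \<and> l i \<le> r i \<and> r i \<le> b) \<and>
        disjoint_family_on (\<lambda>i. {l i<..<r i}) {..<m} \<and> (\<Sum>i<m. r i - l i) < d \<longrightarrow>
        (\<Sum>i<m. norm (f (r i) - f (l i))) < e"
    using assms unfolding abs_cont_on_def by blast
  have "(\<Sum>K\<in>D. norm (incr f K)) < e"
    if D: "D division_of \<Union>D" "\<Union>D \<subseteq> {a..b}" "measure lebesgue (\<Union>D) < d" for D
  proof -
    have fin: "finite D" using D(1) by auto
    obtain h where h: "bij_betw h {..<card D} D"
      using ex_bij_betw_nat_finite[OF fin] by (auto simp: lessThan_atLeast0)
    let ?l = "\<lambda>i. Inf (h i)" and ?r = "\<lambda>i. Sup (h i)"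
    have hD: "h i \<in> D" if "i < card D" for i
      using h that by (auto simp: bij_betw_def)
    have K: "\<exists>u w. u \<le> w \<and> h i = {u..w}" if "i < card D" for i
      using division_of_real_IccE[OF D(1) hD[OF that]] by metis
    have "measure lebesgue (\<Union>D) = (\<Sum>K\<in>D. measure lebesgue K)"
      using content_division[OF D(1)] by simp
    also have "\<dots> = (\<Sum>i<card D. measure lebesgue (h i))"
      by (rule sum.reindex_bij_betw[OF h, symmetric])
    also have "\<dots> = (\<Sum>i<card D. ?r i - ?l i)"
    proof (rule sum.cong)
      fix i assume "i \<in> {..<card D}"
      then obtain u w where "u \<le> w" "h i = {u..w}" using K[of i] by (meson lessThan_iff)
      then show "measure lebesgue (h i) = ?r i - ?l i" by simp
    qed simp
    finally have "(\<Sum>i<card D. ?r i - ?l i) < d" using D(3) by simp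
    moreover have "disjoint_family_on (\<lambda>i. {?l i<..<?r i}) {..<card D}"
      unfolding disjoint_family_on_def
    proof (intro ballI impI)
      fix i j assume ij: "i \<in> {..<card D}" "j \<in> {..<card D}" "i \<noteq> j"
      then have "h i \<noteq> h j" using h by (auto simp: bij_betw_def inj_on_def)
      then have int: "interior (h i) \<inter> interior (h j) = {}"
        using division_ofD(5)[OF D(1) hD hD] ij by simp
      obtain u w where "u \<le> w" "h i = {u..w}" using K ij by blast
      moreover obtain u' w' where "u' \<le> w'" "h j = {u'..w'}" using K ij by blast
      ultimately show "{?l i<..<?r i} \<inter> {?l j<..<?r j} = {}" using int by simp
    qed
    moreover have "\<forall>i<card D. a \<le> ?l i \<and> ?l i \<le> ?r i \<and> ?r i \<le> b"
    proof (intro allI impI)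
      fix i assume i: "i < card D"
      obtain u w where "u \<le> w" "h i = {u..w}" using K[OF i] by blast
      moreover have "h i \<subseteq> {a..b}" using D(2) hD[OF i] by blast
      ultimately show "a \<le> ?l i \<and> ?l i \<le> ?r i \<and> ?r i \<le> b" by simp
    qed
    ultimately have "(\<Sum>i<card D. norm (f (?r i) - f (?l i))) < e"
      using d(2)[rule_format, of "card D" ?l ?r] by blast
    also have "(\<Sum>i<card D. norm (f (?r i) - f (?l i))) = (\<Sum>i<card D. norm (incr f (h i)))"
      by (simp add: incr_def)
    also have "\<dots> = (\<Sum>K\<in>D. norm (incr f K))"
      by (rule sum.reindex_bij_betw[OF h])
    finally show ?thesis .
  qed
  with d(1) show thesis using that by blast
qed

text \<open>One complementary family \<open>C\<close> completes both divisions to divisions of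
  \<open>{a..b}\<close>, over which the increments telescope to the same total.\<close>

lemma sum_incr_division_cong:
  assumes "D1 division_of S" "D2 division_of S" "S \<subseteq> {a..b}"
  shows "sum (incr f) D1 = sum (incr f) D2"
proof (cases "a \<le> b")
  case True
  have "D1 division_of \<Union>D1" "\<Union>D1 \<subseteq> cbox a b" using assms by auto
  then obtain q where q: "D1 \<subseteq> q" "q division_of cbox a b"
    using partial_division_extend_interval by metis
  define C where "C = q - D1"
  have C: "C division_of \<Union>C" unfolding C_def
    by (rule division_of_subset[OF division_of_union_self[OF q(2)]]) auto
  have finq: "finite q" using q by auto
  have "q = C \<union> D1" using q(1) unfolding C_def by blast
  then have un: "\<Union>C \<union> S = {a..b}" using division_ofD(6)[OF q(2)] division_ofD(6)[OF assms(1)]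
    by simp
  have disj: "interior (\<Union>C) \<inter> interior S = {}"
  proof -
    have fC: "finite C" "finite D1" using finq C_def q finite_subset by auto
    have "interior S \<inter> interior (\<Union>C) = {}"
    proof (rule Int_interior_Union_intervals)
      show "finite C" "open (interior S)" by (use fC in auto)
      show "\<exists>a b. T = cbox a b" if "T \<in> C" for T using that division_ofD(4)[OF C] by blast
      show "interior S \<inter> interior T = {}" if T: "T \<in> C" for T
      proof -
        have "interior T \<inter> interior (\<Union>D1) = {}"
        proof (rule Int_interior_Union_intervals)
          show "\<exists>a b. K = cbox a b" if "K \<in> D1" for K using that division_ofD(4)[OF assms(1)] by blast
          show "interior T \<inter> interior K = {}" if "K \<in> D1" for K
            using division_ofD(5)[OF q(2), of T K] T that q(1) unfolding C_def by blast
        qed (use fC in auto)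
        then show ?thesis using division_ofD(6)[OF assms(1)] by blast
      qed
    qed
    then show ?thesis by blast
  qed
  have *: "sum (incr f) D = f b - f a - sum (incr f) C"
    if D: "D division_of S" for D
  proof -
    have "C \<union> D division_of \<Union>C \<union> S"
      by (rule division_disjoint_union[OF C D disj])
    then have "(C \<union> D) division_of {a..b}" using un by simp
    then have s: "sum (incr f) (C \<union> D) = f b - f a" using sum_incr_division True by blast
    \<comment> \<open>\<open>C\<close> and \<open>D\<close> may share degenerate intervals, so the
      sum over the union splits only because these have increment zero.\<close>
    have "sum (incr f) (C \<inter> D) = 0"
    proof (rule sum.neutral, rule)
      fix K assume K: "K \<in> C \<inter> D"
      then have "K \<subseteq> \<Union>C" "K \<subseteq> S" using division_ofD(2)[OF D] by auto
      then have "interior K = {}" using disj interior_mono by blast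
      obtain u w where "u \<le> w" "K = {u..w}" using division_of_real_IccE[OF D] K by blast
      moreover from this \<open>interior K = {}\<close> have "u = w" by auto
      ultimately show "incr f K = 0" by (simp add: incr_def)
    qed
    then show ?thesis using s
      sum.union_inter[of C D "incr f"] finq division_of_finite[OF D] C_def by (simp add: algebra_simps)
  qed
  show ?thesis using *[OF assms(1)] *[OF assms(2)] by simp
next
  case False
  then have "S = {}" using assms by auto
  then show ?thesis using assms by simp
qed

lemma division_measure:
  assumes "D division_of S"
  shows "S \<in> lmeasurable" "(\<Sum>K\<in>D. measure lebesgue K) = measure lebesgue S"
  using content_division[OF assms] lmeasurable_division[OF assms] by auto

text \<open>Completing \<open>D'\<close> to a division of \<open>\<Union>D\<close> adds intervals of
  total length below \<open>d\<close>, whose increments absolute continuity bounds by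
  \<open>e\<close>.\<close>

lemma abs_cont_on_incr_close:
  fixes f :: "real \<Rightarrow> real"
  assumes "abs_cont_on a b f" "0 < e"
  obtains d where "0 < d"
    "\<And>D D'. D division_of \<Union>D \<Longrightarrow> D' division_of \<Union>D' \<Longrightarrow> \<Union>D' \<subseteq> \<Union>D \<Longrightarrow> \<Union>D \<subseteq> {a..b} \<Longrightarrow>
       measure lebesgue (\<Union>D - \<Union>D') < d \<Longrightarrow> sum (incr f) D < sum (incr f) D' + e"
proof -
  obtain d where d: "0 < d"
    "\<And>D. D division_of \<Union>D \<Longrightarrow> \<Union>D \<subseteq> {a..b} \<Longrightarrow> measure lebesgue (\<Union>D) < d
      \<Longrightarrow> (\<Sum>K\<in>D. norm (incr f K)) < e"
    using abs_cont_on_division[OF assms] by metis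
  have "sum (incr f) D < sum (incr f) D' + e"
    if D: "D division_of \<Union>D" "D' division_of \<Union>D'" "\<Union>D' \<subseteq> \<Union>D" "\<Union>D \<subseteq> {a..b}"
      "measure lebesgue (\<Union>D - \<Union>D') < d" for D D'
  proof -
    obtain r where r: "D' \<subseteq> r" "r division_of \<Union>D"
      using partial_division_extend[OF D(2,1,3)] by blast
    have finr: "finite r" using r by auto
    have C: "(r - D') division_of \<Union>(r - D')"
      by (rule division_of_subset[OF division_of_union_self[OF r(2)]]) auto
    have sub: "\<Union>(r - D') \<subseteq> {a..b}" using division_ofD(6)[OF r(2)] D(4) by auto
    have "measure lebesgue (\<Union>(r - D')) = (\<Sum>K\<in>r - D'. measure lebesgue K)"
      using division_measure[OF C] by simp
    also have "\<dots> = (\<Sum>K\<in>r. measure lebesgue K) - (\<Sum>K\<in>D'. measure lebesgue K)"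
      using sum_diff[OF finr r(1)] .
    also have "\<dots> = measure lebesgue (\<Union>D) - measure lebesgue (\<Union>D')"
      using division_measure[OF r(2)] division_measure[OF D(2)] by simp
    also have "\<dots> = measure lebesgue (\<Union>D - \<Union>D')"
      by (rule measurable_measure_Diff[symmetric])
        (use division_measure[OF r(2)] division_measure[OF D(2)] D(3) in auto)
    finally have "(\<Sum>K\<in>r - D'. norm (incr f K)) < e" using d(2)[OF C sub] D(5) by simp
    then have "sum (incr f) (r - D') < e"
      using sum_mono[of "r - D'" "incr f" "\<lambda>K. norm (incr f K)"] by fastforce
    moreover have "sum (incr f) (r - D') = sum (incr f) r - sum (incr f) D'"
      using sum_diff[OF finr r(1)] .
    moreover have "sum (incr f) r = sum (incr f) D"
      by (rule sum_incr_division_cong[OF r(2) D(1) D(4)])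
    ultimately show ?thesis by simp
  qed
  then show thesis using that d(1) by blast
qed

section \<open>Finite Vitali coverings by intervals\<close>

lemma bounded_Ioo: "bounded {a<..<b::real}"
  by (metis bounded_box box_real(1))

lemma negligible_UN:
  "countable I \<Longrightarrow> (\<And>i. i \<in> I \<Longrightarrow> negligible (f i)) \<Longrightarrow> negligible (\<Union>i\<in>I. f i)"
  by (rule negligible_countable_Union) auto

text \<open>Closed balls of the line are closed intervals, so Vitali's theorem gives a countable
  disjoint family that misses only a null part of \<open>E\<close>; finitely many of its members
  already miss less than \<open>e\<close>.\<close>

lemma Vitali_finite_Icc:
  fixes E :: "real set"
  assumes E: "E \<in> lmeasurable" and G: "E \<subseteq> G" "open G" and e: "0 < e"
    and P: "\<And>x k. x \<in> E \<Longrightarrow> 0 < k \<Longrightarrow> \<exists>u w. u < x \<and> x < w \<and> w - u < k \<and> P u w"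
  obtains D where "D division_of \<Union>D" "\<Union>D \<subseteq> G" "measure lebesgue (E - \<Union>D) < e"
    "\<And>K. K \<in> D \<Longrightarrow> \<exists>u w. u < w \<and> K = {u..w} \<and> P u w"
proof -
  define I where "I = {(u, w). u < w \<and> {u..w} \<subseteq> G \<and> P u w}"
  define c r :: "real \<times> real \<Rightarrow> real" where "c = (\<lambda>i. (fst i + snd i) / 2)" and "r = (\<lambda>i. (snd i - fst i) / 2)"
  have "c i - r i = fst i" "c i + r i = snd i" for i by (auto simp: c_def r_def field_simps)
  then have cb: "cball (c i) (r i) = {fst i..snd i}" for i
    by (simp add: cball_eq_atLeastAtMost)
  obtain C where C: "countable C" "C \<subseteq> I"
     "pairwise (\<lambda>i j. disjnt (cball (c i) (r i)) (cball (c j) (r j))) C"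
     "negligible (E - (\<Union>i\<in>C. cball (c i) (r i)))"
  proof (rule Vitali_covering_theorem_cballs[of I r E c])
    show "0 < r i" if "i \<in> I" for i using that by (auto simp: I_def r_def)
    show "\<exists>i. i \<in> I \<and> x \<in> cball (c i) (r i) \<and> r i < k" if x: "x \<in> E" and k: "0 < k" for x k
    proof -
      obtain \<rho> where \<rho>: "\<rho> > 0" "ball x \<rho> \<subseteq> G" using G x by (meson openE subsetD)
      obtain u w where uw: "u < x" "x < w" "w - u < min k \<rho>" "P u w"
        using P[OF x, of "min k \<rho>"] k \<rho> by auto
      have "{u..w} \<subseteq> ball x \<rho>" using uw by (auto simp: dist_real_def)
      then have "(u, w) \<in> I" using uw \<rho> by (auto simp: I_def)
      moreover have "x \<in> cball (c (u, w)) (r (u, w))" using cb[of "(u, w)"] uw by simp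
      moreover have "r (u, w) < k" using uw by (auto simp: r_def)
      ultimately show ?thesis by blast
    qed
  qed
  let ?J = "\<lambda>i. {fst i..snd i}"
  note C = C[unfolded cb]
  \<comment> \<open>Finite subfamilies are selected by their traces on \<open>E\<close>: the
    measures of finite unions are then bounded by that of \<open>E\<close>, and the full union has
    exactly this measure.\<close>
  let ?F = "(\<lambda>i. E \<inter> ?J i) ` C"
  have meas: "S \<in> lmeasurable" if "S \<in> ?F" for S
    using that E by (auto intro: fmeasurable.Int)
  have bnd: "measure lebesgue (\<Union>\<D>) \<le> measure lebesgue E" if "\<D> \<subseteq> ?F" "finite \<D>" for \<D>
  proof (rule measure_mono_fmeasurable)
    show "\<Union>\<D> \<subseteq> E" using that by auto
    show "\<Union>\<D> \<in> sets lebesgue" using that meas by (meson countable_finite sets.countable_Union fmeasurableD subset_iff)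
  qed (use E in auto)
  obtain \<D> where \<D>: "\<D> \<subseteq> ?F" "finite \<D>" "measure lebesgue (\<Union>?F) - e < measure lebesgue (\<Union>\<D>)"
  proof (rule measure_countable_Union_approachable[of ?F e "measure lebesgue E"])
    show "countable ?F" using C(1) by simp
    show "0 < e" by (rule e)
    show "S \<in> lmeasurable" if "S \<in> ?F" for S using that by (rule meas)
    show "measure lebesgue (\<Union>\<D>) \<le> measure lebesgue E" if "\<D> \<subseteq> ?F" "finite \<D>" for \<D>
      using that by (rule bnd)
  qed
  obtain C' where C': "C' \<subseteq> C" "finite C'" "\<D> = (\<lambda>i. E \<inter> ?J i) ` C'"
    using finite_subset_image[OF \<D>(2,1)] by auto
  define D where "D = ?J ` C'"
  have lt: "fst i < snd i" "?J i \<subseteq> G" "P (fst i) (snd i)" if "i \<in> C'" for i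
  proof -
    have "i \<in> I" using that C'(1) C(2) by blast
    then show "fst i < snd i" "?J i \<subseteq> G" "P (fst i) (snd i)" by (simp_all add: I_def case_prod_beta)
  qed
  show thesis
  proof
    show "D division_of \<Union>D"
    proof (rule division_ofI)
      show "finite D" using C' by (simp add: D_def)
      show "K \<noteq> {}" if "K \<in> D" for K
        using that lt(1) by (fastforce simp: D_def)
      show "\<exists>a b. K = cbox a b" if "K \<in> D" for K
        using that unfolding D_def box_real(2) by blast
      show "interior K1 \<inter> interior K2 = {}" if K: "K1 \<in> D" "K2 \<in> D" "K1 \<noteq> K2" for K1 K2
      proof -
        obtain i j where ij: "i \<in> C'" "j \<in> C'" "K1 = ?J i" "K2 = ?J j"
          using K by (auto simp: D_def)
        then have "i \<in> C" "j \<in> C" "i \<noteq> j" using C'(1) K(3) by auto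
        then have "disjnt (?J i) (?J j)" by (rule pairwiseD[OF C(3)])
        then have "K1 \<inter> K2 = {}" by (simp only: disjnt_def ij)
        moreover have "interior K1 \<subseteq> K1" "interior K2 \<subseteq> K2" by (rule interior_subset)+
        ultimately show ?thesis by blast
      qed
    qed auto
    show "\<Union>D \<subseteq> G" unfolding D_def by (rule UN_least) (rule lt(2))
    show "\<exists>u w. u < w \<and> K = {u..w} \<and> P u w" if "K \<in> D" for K
    proof -
      obtain i where "i \<in> C'" "K = ?J i" using \<open>K \<in> D\<close> unfolding D_def by blast
      with lt[of i] show ?thesis by blast
    qed
    have "E \<inter> \<Union>D = \<Union>\<D>" unfolding C'(3) D_def by auto
    have UF: "\<Union>?F = E - (E - (\<Union>i\<in>C. ?J i))" by auto
    have "measure lebesgue (\<Union>?F) = measure lebesgue E"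
      unfolding UF by (rule measure_Diff_null_set) (use C(4) E in \<open>auto simp: negligible_iff_null_sets\<close>)
    moreover have "measure lebesgue (E - \<Union>\<D>) = measure lebesgue E - measure lebesgue (\<Union>\<D>)"
    proof (rule measurable_measure_Diff[OF E])
      show "\<Union>\<D> \<subseteq> E" using \<D> by auto
      show "\<Union>\<D> \<in> sets lebesgue" using \<D> meas by (meson countable_finite sets.countable_Union fmeasurableD subset_iff)
    qed
    moreover have "E - \<Union>D = E - \<Union>\<D>" using \<open>E \<inter> \<Union>D = \<Union>\<D>\<close> by blast
    ultimately show "measure lebesgue (E - \<Union>D) < e" using \<D>(3) by simp
  qed
qed

section \<open>Differentiability from straddling difference quotients\<close>

text \<open>The difference quotients are taken over intervals around \<open>x\<close> rather than from \<open>x\<close>, so that for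
  arbitrary \<open>f\<close> the points satisfying \<open>steep f s\<close> form a \<open>G\<^sub>\<delta>\<close> set.\<close>

definition steep :: "(real \<Rightarrow> real) \<Rightarrow> real \<Rightarrow> real \<Rightarrow> bool" where
  "steep f s x \<longleftrightarrow> (\<forall>k>0. \<exists>u w. u < x \<and> x < w \<and> w - u < k \<and> s * (w - u) < f w - f u)"

text \<open>The ways in which the straddling quotients fail to have a finite limit: a gap between
  lower and upper limit, an upper limit of plus infinity, a lower limit of minus infinity. Rational
  bounds and natural levels keep the set of such points a countable combination of
  \<open>steep\<close> sets.\<close>

definition erratic :: "(real \<Rightarrow> real) \<Rightarrow> real \<Rightarrow> bool" where
  "erratic f x \<longleftrightarrow>
     (\<exists>r\<in>\<rat>. \<exists>s\<in>\<rat>. r < s \<and> steep f s x \<and> steep (\<lambda>x. - f x) (- r) x)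
     \<or> (\<forall>n::nat. steep f n x) \<or> (\<forall>n::nat. steep (\<lambda>x. - f x) n x)"

lemma not_steep:
  assumes "\<not> steep f s x"
  obtains k where "k > 0" "\<And>u w. u < x \<Longrightarrow> x < w \<Longrightarrow> w - u < k \<Longrightarrow> f w - f u \<le> s * (w - u)"
  using assms unfolding steep_def by (metis not_le)

lemma steep_mono: "steep f s x \<Longrightarrow> s' \<le> s \<Longrightarrow> steep f s' x"
  unfolding steep_def by (smt (verit, best) mult_right_mono)

text \<open>This expresses that the lower limit of the straddling quotients does not exceed the
  upper one; small symmetric intervals are the witnesses.\<close>

lemma not_steep_uminus:
  assumes "\<not> steep f s x" "s < s'"
  shows "steep (\<lambda>x. - f x) (- s') x"
  unfolding steep_def
proof (intro allI impI)
  fix k :: real assume "k > 0"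
  obtain k' where k': "k' > 0" "\<And>u w. u < x \<Longrightarrow> x < w \<Longrightarrow> w - u < k' \<Longrightarrow> f w - f u \<le> s * (w - u)"
    using not_steep[OF assms(1)] by blast
  define h where "h = min k k' / 3"
  have h: "h > 0" "2 * h < k" "2 * h < k'" using \<open>k > 0\<close> k' by (auto simp: h_def min_def)
  have "f (x + h) - f (x - h) \<le> s * (x + h - (x - h))"
    using k'(2)[of "x - h" "x + h"] h by auto
  also have "\<dots> < s' * (x + h - (x - h))" using assms(2) h by simp
  finally show "\<exists>u w. u < x \<and> x < w \<and> w - u < k \<and> - s' * (w - u) < - f w - - f u"
    using h by (intro exI[of _ "x - h"] exI[of _ "x + h"]) (auto simp: algebra_simps)
qed

text \<open>\<open>L\<close> is the upper limit, obtained as the supremum of the levels at which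
  \<open>f\<close> is steep. Two rationals \<open>r < s\<close> just below \<open>L\<close>, of
  which \<open>s\<close> is such a level, push the lower limit up to at least \<open>r\<close>
  because there is no rational gap.\<close>

lemma not_erratic_straddle:
  assumes "\<not> erratic f x"
  obtains L where "\<And>e. e > 0 \<Longrightarrow> \<exists>k>0. \<forall>u w. u < x \<and> x < w \<and> w - u < k \<longrightarrow> \<bar>f w - f u - L * (w - u)\<bar> \<le> e * (w - u)"
proof -
  define S where "S = {s. steep f s x}"
  obtain n :: nat where n: "\<not> steep f n x" using assms by (auto simp: erratic_def)
  obtain m :: nat where m: "\<not> steep (\<lambda>x. - f x) m x" using assms by (auto simp: erratic_def)
  \<comment> \<open>Were the upper limit minus infinity, the lower limit would be too, against the
    choice of \<open>m\<close>; the level \<open>- real m - 1\<close> leaves the strict margin that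
    \<open>not_steep_uminus\<close> asks for.\<close>
  have "S \<noteq> {}"
  proof
    assume "S = {}"
    then have "\<not> steep f (- real m - 1) x" by (auto simp: S_def)
    then have "steep (\<lambda>x. - f x) (- (- real m)) x" by (rule not_steep_uminus) simp
    then show False using m by simp
  qed
  moreover have "bdd_above S"
    unfolding S_def bdd_above_def using n steep_mono[of f _ x "real n"] by (metis mem_Collect_eq linear)
  ultimately have Sup: "steep f s x \<Longrightarrow> s \<le> Sup S" "s < Sup S \<Longrightarrow> steep f s x" for s
    using cSup_upper[of s S] less_cSup_iff[of S s] steep_mono[of f _ x s]
    by (auto simp: S_def)
  show thesis
  proof (rule that[of "Sup S"])
    fix e :: real assume e: "e > 0"
    have "\<not> steep f (Sup S + e) x" using Sup(1) e by force
    then obtain k1 where k1: "k1 > 0" "\<And>u w. u < x \<Longrightarrow> x < w \<Longrightarrow> w - u < k1 \<Longrightarrow> f w - f u \<le> (Sup S + e) * (w - u)"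
      using not_steep by blast
    obtain r where r: "r \<in> \<rat>" "Sup S - e < r" "r < Sup S" using Rats_dense_in_real[of "Sup S - e" "Sup S"] e by auto
    obtain s where s: "s \<in> \<rat>" "r < s" "s < Sup S" using Rats_dense_in_real[OF r(3)] by auto
    have "\<not> steep (\<lambda>x. - f x) (- r) x" using assms Sup(2)[OF s(3)] r s by (auto simp: erratic_def)
    then obtain k2 where k2: "k2 > 0" "\<And>u w. u < x \<Longrightarrow> x < w \<Longrightarrow> w - u < k2 \<Longrightarrow> - f w - - f u \<le> - r * (w - u)"
      using not_steep by blast
    show "\<exists>k>0. \<forall>u w. u < x \<and> x < w \<and> w - u < k \<longrightarrow> \<bar>f w - f u - Sup S * (w - u)\<bar> \<le> e * (w - u)"
    proof (intro exI[of _ "min k1 k2"] conjI allI impI)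
      fix u w assume uw: "u < x \<and> x < w \<and> w - u < min k1 k2"
      have "(Sup S - e) * (w - u) \<le> r * (w - u)" using r(2) uw by (intro mult_right_mono) auto
      then show "\<bar>f w - f u - Sup S * (w - u)\<bar> \<le> e * (w - u)"
        using k1(2)[of u w] k2(2)[of u w] uw by (simp add: algebra_simps abs_le_iff)
    qed (use k1 k2 in auto)
  qed
qed

text \<open>Continuity at \<open>x\<close> lets one end point of a straddling interval tend to
  \<open>x\<close>, which turns the straddling estimate into the usual one with quotients taken from
  \<open>x\<close>.\<close>

lemma not_erratic_differentiable:
  assumes "\<not> erratic f x" "isCont f x"
  shows "f differentiable (at x)"
proof -
  obtain L where L: "\<And>e. e > 0 \<Longrightarrow> \<exists>k>0. \<forall>u w. u < x \<and> x < w \<and> w - u < k \<longrightarrow> \<bar>f w - f u - L * (w - u)\<bar> \<le> e * (w - u)"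
    using not_erratic_straddle[OF assms(1)] by blast
  have "(f has_derivative (\<lambda>h. h * L)) (at x)"
    unfolding has_derivative_at_alt
  proof (intro conjI allI impI)
    show "bounded_linear (\<lambda>h. h * L)" by (rule bounded_linear_mult_left)
    fix e :: real assume e: "0 < e"
    obtain k where k: "k > 0" "\<And>u w. u < x \<Longrightarrow> x < w \<Longrightarrow> w - u < k \<Longrightarrow> \<bar>f w - f u - L * (w - u)\<bar> \<le> e * (w - u)"
      using L[OF e] by blast
    have "\<bar>f y - f x - L * (y - x)\<bar> \<le> e * \<bar>y - x\<bar>" if y: "\<bar>y - x\<bar> < k" for y
    proof -
      consider "y < x" | "y = x" | "x < y" by linarith
      then show ?thesis
      proof cases
        case 1
        have "eventually (\<lambda>w. \<bar>f w - f y - L * (w - y)\<bar> \<le> e * (w - y)) (at_right x)"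
          by (rule eventually_mono[OF eventually_at_right_real[of x "y + k"]]) (use y 1 k(2) in auto)
        moreover have "((\<lambda>w. \<bar>f w - f y - L * (w - y)\<bar>) \<longlongrightarrow> \<bar>f x - f y - L * (x - y)\<bar>) (at_right x)"
          "((\<lambda>w. e * (w - y)) \<longlongrightarrow> e * (x - y)) (at_right x)"
          using assms(2) by (auto intro!: tendsto_intros simp: isCont_def filterlim_at_split)
        ultimately have "\<bar>f x - f y - L * (x - y)\<bar> \<le> e * (x - y)"
          by (intro tendsto_le[OF trivial_limit_at_right_real])
        then show ?thesis using 1 by (simp add: algebra_simps abs_if split: if_splits)
      next
        case 3
        have "eventually (\<lambda>w. \<bar>f y - f w - L * (y - w)\<bar> \<le> e * (y - w)) (at_left x)"
          by (rule eventually_mono[OF eventually_at_left_real[of "y - k" x]]) (use y 3 k(2) in auto)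
        moreover have "((\<lambda>w. \<bar>f y - f w - L * (y - w)\<bar>) \<longlongrightarrow> \<bar>f y - f x - L * (y - x)\<bar>) (at_left x)"
          "((\<lambda>w. e * (y - w)) \<longlongrightarrow> e * (y - x)) (at_left x)"
          using assms(2) by (auto intro!: tendsto_intros simp: isCont_def filterlim_at_split)
        ultimately have "\<bar>f y - f x - L * (y - x)\<bar> \<le> e * (y - x)"
          by (intro tendsto_le[OF trivial_limit_at_left_real])
        then show ?thesis using 3 by simp
      qed simp
    qed
    then show "\<exists>d>0. \<forall>y. norm (y - x) < d \<longrightarrow> norm (f y - f x - (y - x) * L) \<le> e * norm (y - x)"
      using k(1) by (auto simp: mult.commute)
  qed
  then show ?thesis by (auto simp: differentiable_def)
qed

lemma open_straddle: "open {x::real. \<exists>u w. u < x \<and> x < w \<and> Q u w}"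
proof -
  have "{x. \<exists>u w. u < x \<and> x < w \<and> Q u w} = (\<Union>p\<in>{p. Q (fst p) (snd p)}. {fst p<..<snd p})"
    by force
  then show ?thesis by auto
qed

lemma steep_iff_Suc:
  "steep f s x \<longleftrightarrow> (\<forall>n. \<exists>u w. u < x \<and> x < w \<and> w - u < 1 / Suc n \<and> s * (w - u) < f w - f u)"
  unfolding steep_def
proof (intro iffI allI impI)
  fix k :: real assume *: "\<forall>n. \<exists>u w. u < x \<and> x < w \<and> w - u < 1 / Suc n \<and> s * (w - u) < f w - f u" and "0 < k"
  then obtain n where "1 / real (Suc n) < k" using nat_approx_posE by blast
  with * show "\<exists>u w. u < x \<and> x < w \<and> w - u < k \<and> s * (w - u) < f w - f u"
    by (meson less_trans)
qed auto

lemma borel_steep: "{x. steep f s x} \<in> sets borel"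
proof -
  have "{x. steep f s x} = (\<Inter>n. {x. \<exists>u w. u < x \<and> x < w \<and> (w - u < 1 / real (Suc n) \<and> s * (w - u) < f w - f u)})"
    by (auto simp: steep_iff_Suc)
  also have "\<dots> \<in> sets borel"
    by (intro sets.countable_INT'' borel_open open_straddle) auto
  finally show ?thesis .
qed

text \<open>Cover \<open>E\<close> up to a small set by intervals on which \<open>f\<close> has slope above \<open>s\<close>, and then the part of \<open>E\<close>
  inside them by intervals on which \<open>f\<close> has slope below \<open>r\<close>. The two unions have almost the same length,
  so by absolute continuity almost the same total increment of \<open>f\<close>, which forces both lengths to be small.\<close>

lemma negligible_steep_gap:
  assumes f: "abs_cont_on a b f" and rs: "r < s" and E: "E \<in> sets borel" "E \<subseteq> {a<..<b}"
    and up: "\<And>x. x \<in> E \<Longrightarrow> steep f s x" and lo: "\<And>x. x \<in> E \<Longrightarrow> steep (\<lambda>x. - f x) (- r) x"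
  shows "negligible E"
proof -
  have bE: "bounded E" using E(2) bounded_subset bounded_Ioo by metis
  have Em: "E \<in> lmeasurable"
    by (rule bounded_set_imp_lmeasurable[OF bE]) (use E in auto)
  have est: "(s - r) * (measure lebesgue E - e) \<le> (1 + \<bar>r\<bar>) * e" if e: "e > 0" for e
  proof -
    obtain d0 where d0: "0 < d0"
      "\<And>D D'. D division_of \<Union>D \<Longrightarrow> D' division_of \<Union>D' \<Longrightarrow> \<Union>D' \<subseteq> \<Union>D \<Longrightarrow> \<Union>D \<subseteq> {a..b} \<Longrightarrow>
       measure lebesgue (\<Union>D - \<Union>D') < d0 \<Longrightarrow> sum (incr f) D < sum (incr f) D' + e"
      using abs_cont_on_incr_close[OF f e] by blast
    define d where "d = min d0 e"
    have d: "0 < d" "d \<le> d0" "d \<le> e" using d0 e by (auto simp: d_def)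
    obtain G0 where G0: "open G0" "E \<subseteq> G0" "G0 - E \<in> lmeasurable" "emeasure lebesgue (G0 - E) < ennreal (d / 2)"
      using sets_lebesgue_outer_open[of E "d / 2"] Em d by auto
    define G where "G = G0 \<inter> {a<..<b}"
    have G: "open G" "E \<subseteq> G" using G0 E by (auto simp: G_def)
    have GE: "G - E \<in> lmeasurable"
      by (rule bounded_set_imp_lmeasurable)
        (use G E in \<open>auto simp: G_def intro!: bounded_subset[of "{a<..<b}"] bounded_Ioo\<close>)
    have "measure lebesgue (G - E) \<le> measure lebesgue (G0 - E)"
      by (rule measure_mono_fmeasurable) (use GE G0 in \<open>auto simp: G_def\<close>)
    also have "\<dots> < d / 2" using G0(3,4) d by (simp add: emeasure_eq_measure2 ennreal_less_iff)
    finally have GEd: "measure lebesgue (G - E) < d / 2" .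
    obtain D where D: "D division_of \<Union>D" "\<Union>D \<subseteq> G" "measure lebesgue (E - \<Union>D) < d / 2"
      "\<And>K. K \<in> D \<Longrightarrow> \<exists>u w. u < w \<and> K = {u..w} \<and> s * (w - u) < f w - f u"
      by (rule Vitali_finite_Icc[OF Em G(2,1), of "d / 2" "\<lambda>u w. s * (w - u) < f w - f u"])
        (use up d in \<open>auto simp: steep_def\<close>)
    \<comment> \<open>The second covering must live inside an open set. Passing to the interiors of
      the finitely many intervals of \<open>D\<close> loses only their end points.\<close>
    define G2 where "G2 = (\<Union>K\<in>D. interior K)"
    have G2: "open G2" "G2 \<subseteq> \<Union>D" using interior_subset by (auto simp: G2_def)
    have EG2: "E \<inter> G2 \<in> lmeasurable" using Em G2 by (intro fmeasurable_Int_fmeasurable) auto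
    obtain D' where D': "D' division_of \<Union>D'" "\<Union>D' \<subseteq> G2" "measure lebesgue (E \<inter> G2 - \<Union>D') < d / 2"
      "\<And>K. K \<in> D' \<Longrightarrow> \<exists>u w. u < w \<and> K = {u..w} \<and> (- r) * (w - u) < - f w - - f u"
      by (rule Vitali_finite_Icc[OF EG2 _ G2(1), of "d / 2" "\<lambda>u w. (- r) * (w - u) < - f w - - f u"])
        (use lo d in \<open>auto simp: steep_def\<close>)
    note mD = division_measure[OF D(1)] and mD' = division_measure[OF D'(1)]
    have ab: "\<Union>D \<subseteq> {a..b}" using D(2) by (auto simp: G_def)
    have neg: "negligible (\<Union>D - G2)"
    proof (rule negligible_subset)
      show "negligible (\<Union>K\<in>D. K - interior K)"
      proof (rule negligible_UN)
        show "countable D" using D(1) by (auto intro: countable_finite)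
        fix K assume "K \<in> D"
        then obtain u w where "K = {u..w}" using D(4) by blast
        then have "K - interior K \<subseteq> {u, w}" by auto
        then show "negligible (K - interior K)" by (rule negligible_subset[OF negligible_finite, rotated]) auto
      qed
      show "\<Union>D - G2 \<subseteq> (\<Union>K\<in>D. K - interior K)" by (auto simp: G2_def)
    qed
    have diffm: "E \<inter> G2 - \<Union>D' \<in> lmeasurable" using EG2 mD'(1) by (intro fmeasurable.Diff) auto
    \<comment> \<open>What \<open>D\<close> covers and \<open>D'\<close> does not lies outside
      \<open>E\<close>, or in the part of \<open>E\<close> that the second covering misses, or among
      the end points; the first two sets have measure below \<open>d / 2\<close> each.\<close>
    have "measure lebesgue (\<Union>D - \<Union>D') \<le> measure lebesgue ((G - E) \<union> (E \<inter> G2 - \<Union>D') \<union> (\<Union>D - G2))"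
      by (rule measure_mono_fmeasurable)
        (use D(2) G2 mD(1) mD'(1) GE diffm negligible_imp_measurable[OF neg] in \<open>auto intro!: fmeasurable.Un\<close>)
    also have "\<dots> = measure lebesgue ((G - E) \<union> (E \<inter> G2 - \<Union>D'))"
      by (rule measure_Un_null_set) (use neg GE diffm in \<open>auto simp: negligible_iff_null_sets\<close>)
    also have "\<dots> \<le> measure lebesgue (G - E) + measure lebesgue (E \<inter> G2 - \<Union>D')"
      by (rule measure_Un_le) (use GE diffm in auto)
    also have "\<dots> < d" using GEd D'(3) by simp
    finally have small: "measure lebesgue (\<Union>D - \<Union>D') < d" .
    then have 1: "sum (incr f) D < sum (incr f) D' + e"
      using d0(2)[OF D(1) D'(1)] D'(2) G2 ab d by auto
    have "s * measure lebesgue (\<Union>D) = (\<Sum>K\<in>D. s * measure lebesgue K)"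
      by (simp add: mD(2)[symmetric] sum_distrib_left)
    also have "\<dots> \<le> sum (incr f) D"
    proof (rule sum_mono)
      fix K assume "K \<in> D"
      from D(4)[OF this] show "s * measure lebesgue K \<le> incr f K" by auto
    qed
    finally have 2: "s * measure lebesgue (\<Union>D) \<le> sum (incr f) D" .
    have "sum (incr f) D' \<le> (\<Sum>K\<in>D'. r * measure lebesgue K)"
    proof (rule sum_mono)
      fix K assume "K \<in> D'"
      from D'(4)[OF this] show "incr f K \<le> r * measure lebesgue K" by auto
    qed
    also have "\<dots> = r * measure lebesgue (\<Union>D')"
      by (simp add: mD'(2)[symmetric] sum_distrib_left)
    also have "\<dots> = r * measure lebesgue (\<Union>D) - r * measure lebesgue (\<Union>D - \<Union>D')"
    proof -
      have "measure lebesgue (\<Union>D - \<Union>D') = measure lebesgue (\<Union>D) - measure lebesgue (\<Union>D')"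
        by (rule measurable_measure_Diff[OF mD(1)]) (use mD'(1) D'(2) G2(2) in auto)
      then have "measure lebesgue (\<Union>D') = measure lebesgue (\<Union>D) - measure lebesgue (\<Union>D - \<Union>D')"
        by linarith
      then show ?thesis by (simp only: right_diff_distrib)
    qed
    also have "\<dots> \<le> r * measure lebesgue (\<Union>D) + \<bar>r\<bar> * e"
    proof -
      have "\<bar>r * measure lebesgue (\<Union>D - \<Union>D')\<bar> \<le> \<bar>r\<bar> * e"
        unfolding abs_mult using small d by (intro mult_left_mono) auto
      then show ?thesis by linarith
    qed
    finally have 3: "(s - r) * measure lebesgue (\<Union>D) \<le> (1 + \<bar>r\<bar>) * e"
      using 1 2 by (simp add: algebra_simps)
    have "measure lebesgue E \<le> measure lebesgue (\<Union>D \<union> (E - \<Union>D))"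
      by (rule measure_mono_fmeasurable) (use Em mD(1) in \<open>auto intro!: fmeasurable.Un fmeasurable.Diff\<close>)
    also have "\<dots> \<le> measure lebesgue (\<Union>D) + measure lebesgue (E - \<Union>D)"
      by (rule measure_Un_le) (use Em mD(1) in auto)
    also have "\<dots> \<le> measure lebesgue (\<Union>D) + e" using D(3) d by simp
    finally have "(s - r) * (measure lebesgue E - e) \<le> (s - r) * measure lebesgue (\<Union>D)"
      using rs by (intro mult_left_mono) auto
    with 3 show ?thesis by linarith
  qed
  have "(s - r) * measure lebesgue E \<le> 0"
  proof (rule field_le_epsilon)
    fix e :: real assume e: "0 < e"
    define e' where "e' = e / (1 + \<bar>r\<bar> + (s - r))"
    have pos: "1 + \<bar>r\<bar> + (s - r) > 0" using rs by linarith
    then have e': "e' > 0" "e' * (1 + \<bar>r\<bar> + (s - r)) = e" using e by (auto simp: e'_def)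
    show "(s - r) * measure lebesgue E \<le> 0 + e" using est[OF e'(1)] e'(2) by (simp add: algebra_simps)
  qed
  then have "measure lebesgue E = 0" using rs by (metis diff_gt_0_iff_gt mult_le_0_iff measure_le_0_iff not_le)
  then show ?thesis using Em by (simp add: negligible_iff_measure0)
qed

text \<open>Intervals of slope above \<open>n\<close> and of total length below \<open>d\<close>
  have total increment below 1 by absolute continuity, so their total length is below
  \<open>1 / n\<close>. Since this needs a total length below \<open>d\<close>, the set is first cut
  into short windows.\<close>

lemma negligible_steep_all:
  assumes f: "abs_cont_on a b f" and E: "E \<in> sets borel" "E \<subseteq> {a<..<b}"
    and up: "\<And>x n. x \<in> E \<Longrightarrow> steep f (real n) x"
  shows "negligible E"
proof -
  obtain d where d: "0 < d"
    "\<And>D. D division_of \<Union>D \<Longrightarrow> \<Union>D \<subseteq> {a..b} \<Longrightarrow> measure lebesgue (\<Union>D) < d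
      \<Longrightarrow> (\<Sum>K\<in>D. norm (incr f K)) < 1"
    using abs_cont_on_division[OF f zero_less_one] by blast
  have piece: "negligible (E \<inter> {c<..<c'})" if c: "c < c'" "c' - c < d" for c c'
  proof -
    define F where "F = E \<inter> {c<..<c'}"
    have Fm: "F \<in> lmeasurable"
      by (rule bounded_set_imp_lmeasurable)
        (use E in \<open>auto simp: F_def intro!: bounded_subset[of "{c<..<c'}"] bounded_Ioo\<close>)
    have est: "measure lebesgue F \<le> 2 / real n" if n: "n > 0" for n :: nat
    proof -
      define G where "G = {max a c<..<min b c'}"
      have G: "F \<subseteq> G" "open G" using E by (auto simp: F_def G_def)
      have n': "0 < 1 / real n" using n by simp
      obtain D where D: "D division_of \<Union>D" "\<Union>D \<subseteq> G" "measure lebesgue (F - \<Union>D) < 1 / real n"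
        "\<And>K. K \<in> D \<Longrightarrow> \<exists>u w. u < w \<and> K = {u..w} \<and> real n * (w - u) < f w - f u"
        by (rule Vitali_finite_Icc[OF Fm G n', of "\<lambda>u w. real n * (w - u) < f w - f u"])
          (use up in \<open>auto simp: steep_def F_def\<close>)
      note mD = division_measure[OF D(1)]
      have "measure lebesgue (\<Union>D) \<le> measure lebesgue {c..c'}"
        by (rule measure_mono_fmeasurable) (use D(2) mD(1) in \<open>auto simp: G_def\<close>)
      then have "(\<Sum>K\<in>D. norm (incr f K)) < 1" using c D(2) by (intro d(2)[OF D(1)]) (auto simp: G_def)
      moreover have "(\<Sum>K\<in>D. real n * measure lebesgue K) \<le> (\<Sum>K\<in>D. norm (incr f K))"
      proof (rule sum_mono)
        fix K assume "K \<in> D"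
        from D(4)[OF this] show "real n * measure lebesgue K \<le> norm (incr f K)" by auto
      qed
      ultimately have "real n * measure lebesgue (\<Union>D) < 1"
        by (simp add: sum_distrib_left[symmetric] mD(2))
      then have "measure lebesgue (\<Union>D) < 1 / real n" using n by (simp add: field_simps)
      moreover have "measure lebesgue F \<le> measure lebesgue (\<Union>D \<union> (F - \<Union>D))"
        by (rule measure_mono_fmeasurable) (use Fm mD(1) in \<open>auto intro!: fmeasurable.Un fmeasurable.Diff\<close>)
      moreover have "\<dots> \<le> measure lebesgue (\<Union>D) + measure lebesgue (F - \<Union>D)"
        by (rule measure_Un_le) (use Fm mD(1) in auto)
      ultimately show ?thesis using D(3) by simp
    qed
    have "measure lebesgue F \<le> 0"
    proof (rule LIMSEQ_le_const)
      show "(\<lambda>n. 2 / real (Suc n)) \<longlonglongrightarrow> 0"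
        using tendsto_mult[OF tendsto_const[of 2] LIMSEQ_inverse_real_of_nat] by (simp add: field_simps)
      show "\<exists>N. \<forall>n\<ge>N. measure lebesgue F \<le> 2 / real (Suc n)" using est by blast
    qed
    then have "measure lebesgue F = 0" by (simp add: measure_le_0_iff)
    then show ?thesis using Fm by (simp add: negligible_iff_measure0 F_def)
  qed
  \<comment> \<open>Open windows of length \<open>2 * h\<close> starting at the multiples of
    \<open>h\<close> overlap, so that they cover every point, and are still shorter than
    \<open>d\<close>.\<close>
  define h where "h = d / 3"
  have h: "h > 0" "2 * h < d" using d by (auto simp: h_def)
  have "E \<subseteq> (\<Union>k::int. E \<inter> {of_int k * h<..<of_int k * h + 2 * h})"
  proof
    fix x assume "x \<in> E"
    define q where "q = x / h"
    \<comment> \<open>The ceiling minus one, and not the floor, makes the lower inequality strict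
      even when \<open>q\<close> is an integer.\<close>
    define k where "k = \<lceil>q\<rceil> - 1"
    have "of_int k < q" "q < of_int k + 2" unfolding k_def by linarith+
    moreover have "x = q * h" using h by (simp add: q_def)
    ultimately have "of_int k * h < x" "x < of_int k * h + 2 * h"
      using h mult_strict_right_mono[of "of_int k" q h] mult_strict_right_mono[of q "of_int k + 2" h]
      by (simp_all add: distrib_right)
    then have "x \<in> E \<inter> {of_int k * h<..<of_int k * h + 2 * h}" using \<open>x \<in> E\<close> by simp
    then show "x \<in> (\<Union>k::int. E \<inter> {of_int k * h<..<of_int k * h + 2 * h})" by (rule UN_I[OF UNIV_I])
  qed
  moreover have "negligible (\<Union>k::int. E \<inter> {of_int k * h<..<of_int k * h + 2 * h})"
  proof (rule negligible_UN)
    fix k :: int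
    show "negligible (E \<inter> {of_int k * h<..<of_int k * h + 2 * h})"
      by (rule piece) (use h in simp_all)
  qed simp
  ultimately show ?thesis by (metis negligible_subset)
qed

lemma abs_cont_on_uminus: "abs_cont_on a b f \<Longrightarrow> abs_cont_on a b (\<lambda>x. - f x)"
  unfolding abs_cont_on_def by (simp add: norm_minus_commute)

lemma negligible_erratic:
  assumes f: "abs_cont_on a b f"
  shows "negligible {x\<in>{a<..<b}. erratic f x}"
proof -
  let ?S = "\<lambda>f s. {x. steep f s x}" and ?m = "\<lambda>x. - f x" and ?I = "{a<..<b}"
  have 1: "negligible (?I \<inter> ?S f s \<inter> ?S ?m (- r))" if "r < s" for r s
    by (rule negligible_steep_gap[OF f that]) (auto intro!: sets.Int borel_steep)
  have 2: "negligible (?I \<inter> (\<Inter>n. ?S f (real n)))"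
    by (rule negligible_steep_all[OF f]) (auto intro!: sets.Int sets.countable_INT'' borel_steep)
  have 3: "negligible (?I \<inter> (\<Inter>n. ?S ?m (real n)))"
    by (rule negligible_steep_all[OF abs_cont_on_uminus[OF f]])
      (auto intro!: sets.Int sets.countable_INT'' borel_steep)
  have "negligible (\<Union>p\<in>{p \<in> \<rat> \<times> \<rat>. fst p < snd p}. ?I \<inter> ?S f (snd p) \<inter> ?S ?m (- fst p))"
    by (rule negligible_UN)
      (use 1 in \<open>auto intro!: countable_subset[OF _ countable_SIGMA[OF countable_rat countable_rat]]\<close>)
  then have "negligible ((\<Union>p\<in>{p \<in> \<rat> \<times> \<rat>. fst p < snd p}. ?I \<inter> ?S f (snd p) \<inter> ?S ?m (- fst p))
    \<union> (?I \<inter> (\<Inter>n. ?S f (real n))) \<union> (?I \<inter> (\<Inter>n. ?S ?m (real n))))"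
    using 2 3 by (intro negligible_Un)
  then show ?thesis
  proof (rule negligible_subset, intro subsetI)
    fix x assume x: "x \<in> {x \<in> ?I. erratic f x}"
    then consider r s where "r \<in> \<rat>" "s \<in> \<rat>" "r < s" "steep f s x" "steep ?m (- r) x"
      | "\<forall>n::nat. steep f n x" | "\<forall>n::nat. steep ?m n x"
      by (auto simp: erratic_def)
    then show "x \<in> (\<Union>p\<in>{p \<in> \<rat> \<times> \<rat>. fst p < snd p}. ?I \<inter> ?S f (snd p) \<inter> ?S ?m (- fst p))
      \<union> (?I \<inter> (\<Inter>n. ?S f (real n))) \<union> (?I \<inter> (\<Inter>n. ?S ?m (real n)))"
    proof cases
      case 1
      then have "(r, s) \<in> {p \<in> \<rat> \<times> \<rat>. fst p < snd p}" "x \<in> ?I \<inter> ?S f (snd (r, s)) \<inter> ?S ?m (- fst (r, s))"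
        using x by auto
      then show ?thesis by blast
    qed (use x in auto)
  qed
qed

section \<open>The fundamental theorem of calculus for absolutely continuous curves\<close>

lemma abs_cont_on_continuous_on:
  assumes "abs_cont_on a b f"
  shows "continuous_on {a..b} f"
  unfolding continuous_on_iff
proof (intro ballI allI impI)
  fix x e :: real assume x: "x \<in> {a..b}" and e: "0 < e"
  from assms e obtain d where d: "0 < d" "\<forall>(m::nat) l r. (\<forall>i<m. a \<le> l i \<and> l i \<le> r i \<and> r i \<le> b) \<and>
        disjoint_family_on (\<lambda>i. {l i<..<r i}) {..<m} \<and> (\<Sum>i<m. r i - l i) < d \<longrightarrow>
        (\<Sum>i<m. norm (f (r i) - f (l i))) < e"
    unfolding abs_cont_on_def by blast
  have "dist (f y) (f x) < e" if "y \<in> {a..b}" "dist y x < d" for y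
    using d(2)[rule_format, of 1 "\<lambda>_. min x y" "\<lambda>_. max x y"] that x
    by (cases "x \<le> y") (auto simp: disjoint_family_on_def dist_norm norm_minus_commute)
  then show "\<exists>d>0. \<forall>x'\<in>{a..b}. dist x' x < d \<longrightarrow> dist (f x') (f x) < e" using d(1) by blast
qed

lemma abs_cont_on_inner:
  fixes f :: "real \<Rightarrow> 'a::euclidean_space"
  assumes f: "abs_cont_on a b f" and i: "i \<in> Basis"
  shows "abs_cont_on a b (\<lambda>x. f x \<bullet> i)"
  unfolding abs_cont_on_def
proof (intro allI impI)
  fix e :: real assume "0 < e"
  with f obtain d where d: "0 < d" "\<forall>(m::nat) l r. (\<forall>i<m. a \<le> l i \<and> l i \<le> r i \<and> r i \<le> b) \<and>
        disjoint_family_on (\<lambda>i. {l i<..<r i}) {..<m} \<and> (\<Sum>i<m. r i - l i) < d \<longrightarrow>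
        (\<Sum>i<m. norm (f (r i) - f (l i))) < e"
    unfolding abs_cont_on_def by blast
  have le: "(\<Sum>j<m. norm (f (r j) \<bullet> i - f (l j) \<bullet> i)) \<le> (\<Sum>j<m. norm (f (r j) - f (l j)))"
    for m :: nat and r l :: "nat \<Rightarrow> real"
    by (rule sum_mono) (use Basis_le_norm[OF i] in \<open>simp add: inner_diff_left[symmetric]\<close>)
  show "\<exists>\<delta>>0. \<forall>(m::nat) l r. (\<forall>i<m. a \<le> l i \<and> l i \<le> r i \<and> r i \<le> b) \<and>
          disjoint_family_on (\<lambda>i. {l i<..<r i}) {..<m} \<and> (\<Sum>i<m. r i - l i) < \<delta> \<longrightarrow>
          (\<Sum>j<m. norm (f (r j) \<bullet> i - f (l j) \<bullet> i)) < e"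
  proof (intro exI[of _ d] conjI allI impI)
    show "(\<Sum>j<m. norm (f (r j) \<bullet> i - f (l j) \<bullet> i)) < e"
      if "(\<forall>i<(m::nat). a \<le> l i \<and> l i \<le> r i \<and> r i \<le> b) \<and>
          disjoint_family_on (\<lambda>i. {l i<..<r i}) {..<m} \<and> (\<Sum>i<m. r i - l i) < d" for m l r
    proof -
      have "(\<Sum>i<m. norm (f (r i) - f (l i))) < e" using d(2) that by blast
      then show ?thesis using le[where m=m and r=r and l=l] by linarith
    qed
  qed (rule d(1))
qed

lemma abs_cont_on_AE_differentiable:
  fixes f :: "real \<Rightarrow> 'a::euclidean_space"
  assumes f: "abs_cont_on a b f"
  obtains N where "negligible N" "\<And>x. x \<in> {a..b} - N \<Longrightarrow> f differentiable (at x)"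
proof
  let ?N = "(\<Union>i\<in>Basis. {x\<in>{a<..<b}. erratic (\<lambda>x. f x \<bullet> i) x}) \<union> {a, b}"
  show "negligible ?N"
    using negligible_erratic[OF abs_cont_on_inner[OF f]] by (intro negligible_Un negligible_UN) (auto intro: countable_finite)
  show "f differentiable (at x)" if x: "x \<in> {a..b} - ?N" for x
  proof -
    have "(\<lambda>x. f x \<bullet> i) differentiable (at x)" if i: "i \<in> Basis" for i
    proof (rule not_erratic_differentiable)
      show "\<not> erratic (\<lambda>x. f x \<bullet> i) x" using x i by auto
      have "continuous_on {a<..<b} (\<lambda>x. f x \<bullet> i)"
        using abs_cont_on_continuous_on[OF abs_cont_on_inner[OF f i]] by (rule continuous_on_subset) auto
      then show "isCont (\<lambda>x. f x \<bullet> i) x"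
        using x by (simp add: continuous_on_eq_continuous_at)
    qed
    then show ?thesis by (subst differentiable_componentwise_within) simp
  qed
qed

text \<open>The straddle lemma of gauge integration: the interval is split at the tag
  \<open>x\<close> and the estimates on the two sides are added.\<close>

lemma has_vector_derivative_within_straddle:
  fixes f :: "real \<Rightarrow> 'a::real_normed_vector"
  assumes "(f has_vector_derivative D) (at x within S)" "0 < e"
  obtains d where "0 < d" "\<And>u w. u \<in> S \<Longrightarrow> w \<in> S \<Longrightarrow> u \<le> x \<Longrightarrow> x \<le> w \<Longrightarrow> u \<in> ball x d \<Longrightarrow> w \<in> ball x d
    \<Longrightarrow> norm ((w - u) *\<^sub>R D - (f w - f u)) \<le> e * (w - u)"
proof -
  obtain d where d: "0 < d" "\<And>y. y \<in> S \<Longrightarrow> norm (y - x) < d \<Longrightarrow> norm (f y - f x - (y - x) *\<^sub>R D) \<le> e * norm (y - x)"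
    using assms unfolding has_vector_derivative_def has_derivative_within_alt by blast
  have "norm ((w - u) *\<^sub>R D - (f w - f u)) \<le> e * (w - u)"
    if "u \<in> S" "w \<in> S" "u \<le> x" "x \<le> w" "u \<in> ball x d" "w \<in> ball x d" for u w
  proof -
    have "norm (f w - f x - (w - x) *\<^sub>R D) \<le> e * (w - x)" "norm (f u - f x - (u - x) *\<^sub>R D) \<le> e * (x - u)"
      using d(2)[of w] d(2)[of u] that by (auto simp: dist_real_def)
    moreover have "(w - u) *\<^sub>R D - (f w - f u) = (f u - f x - (u - x) *\<^sub>R D) - (f w - f x - (w - x) *\<^sub>R D)"
      by (simp add: algebra_simps)
    ultimately show ?thesis
      using norm_triangle_ineq4[of "f u - f x - (u - x) *\<^sub>R D" "f w - f x - (w - x) *\<^sub>R D"]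
      by (simp add: algebra_simps)
  qed
  with d(1) show thesis using that by blast
qed

text \<open>Henstock's gauge argument: at tags in the exceptional null set the gauge is a small open set containing it,
  where absolute continuity bounds the increments; at all other tags the derivative does.\<close>

theorem abs_cont_on_has_integral_derivative:
  fixes f :: "real \<Rightarrow> 'a::euclidean_space"
  assumes f: "abs_cont_on a b f" and ab: "a < b"
  shows "((\<lambda>x. vector_derivative f (at x within {a..b})) has_integral f b - f a) {a..b}"
proof -
  obtain N where N: "negligible N" "\<And>x. x \<in> {a..b} - N \<Longrightarrow> f differentiable (at x)"
    using abs_cont_on_AE_differentiable[OF f] by blast
  \<comment> \<open>With the value 0 on \<open>N\<close>, a tag in \<open>N\<close> contributes only
    the increment of \<open>f\<close> to the error of the Riemann sum.\<close>
  define g where "g = (\<lambda>x. if x \<in> N then 0 else vector_derivative f (at x within {a..b}))"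
  have der: "(f has_vector_derivative g x) (at x within {a..b})" if "x \<in> {a..b} - N" for x
  proof -
    have "f differentiable (at x within {a..b})"
      using N(2)[OF that] by (rule differentiable_at_withinI)
    then show ?thesis using that unfolding g_def by (simp add: vector_derivative_works)
  qed
  have "(g has_integral f b - f a) (cbox a b)"
    unfolding has_integral
  proof (intro allI impI)
    fix e :: real assume e: "0 < e"
    define e1 where "e1 = (e / 2) / (b - a)"
    have e1: "0 < e1" using e ab by (simp add: e1_def)
    have e1ab: "e1 * (b - a) = e / 2" using ab by (subst nonzero_eq_divide_eq[symmetric]) (auto simp: e1_def)
    have "\<exists>d>0. x \<in> {a..b} - N \<longrightarrow> (\<forall>u w. u \<in> {a..b} \<and> w \<in> {a..b} \<and> u \<le> x \<and> x \<le> w \<and> u \<in> ball x d \<and> w \<in> ball x d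
      \<longrightarrow> norm ((w - u) *\<^sub>R g x - (f w - f u)) \<le> e1 * (w - u))" for x
    proof (cases "x \<in> {a..b} - N")
      case True
      from has_vector_derivative_within_straddle[OF der[OF this] e1] show ?thesis by metis
    qed (use zero_less_one in blast)
    then obtain \<rho> where \<rho>: "\<And>x. 0 < \<rho> x"
      "\<And>x u w. x \<in> {a..b} - N \<Longrightarrow> u \<in> {a..b} \<Longrightarrow> w \<in> {a..b} \<Longrightarrow> u \<le> x \<Longrightarrow> x \<le> w \<Longrightarrow> u \<in> ball x (\<rho> x) \<Longrightarrow> w \<in> ball x (\<rho> x)
      \<Longrightarrow> norm ((w - u) *\<^sub>R g x - (f w - f u)) \<le> e1 * (w - u)"
      by metis
    obtain \<delta> where \<delta>: "0 < \<delta>"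
      "\<And>D. D division_of \<Union>D \<Longrightarrow> \<Union>D \<subseteq> {a..b} \<Longrightarrow> measure lebesgue (\<Union>D) < \<delta>
        \<Longrightarrow> (\<Sum>K\<in>D. norm (incr f K)) < e / 2"
      using abs_cont_on_division[OF f, of "e / 2"] e by (metis half_gt_zero)
    have Nm: "N \<in> sets lebesgue" "N \<in> null_sets lebesgue" using N(1) by (auto simp: negligible_iff_null_sets)
    obtain U where U: "open U" "N \<subseteq> U" "U - N \<in> lmeasurable" "emeasure lebesgue (U - N) < ennreal \<delta>"
      using sets_lebesgue_outer_open[OF Nm(1) \<delta>(1)] by blast
    have "emeasure lebesgue U = emeasure lebesgue (U - N)"
      using emeasure_Diff_null_set[OF Nm(2), of U] U(1) by auto
    then have Ue: "emeasure lebesgue U < ennreal \<delta>" using U(4) by simp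
    have Um: "U \<in> lmeasurable"
      by (rule fmeasurableI) (use U(1) less_trans[OF Ue ennreal_less_top] in auto)
    have Ul: "measure lebesgue U < \<delta>"
      using Ue \<delta>(1) by (simp add: emeasure_eq_measure2[OF Um] ennreal_less_iff)
    define \<gamma> where "\<gamma> = (\<lambda>x. if x \<in> N then U else ball x (\<rho> x))"
    have gauge: "gauge \<gamma>" unfolding gauge_def \<gamma>_def using U \<rho>(1) by auto
    show "\<exists>\<gamma>. gauge \<gamma> \<and> (\<forall>\<D>. \<D> tagged_division_of cbox a b \<and> \<gamma> fine \<D> \<longrightarrow>
      norm ((\<Sum>(x, k)\<in>\<D>. measure lborel k *\<^sub>R g x) - (f b - f a)) < e)"
    proof (intro exI conjI allI impI)
      show "gauge \<gamma>" by (rule gauge)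
      fix p assume p: "p tagged_division_of cbox a b \<and> \<gamma> fine p"
      then have p': "p tagged_division_of {a..b}" by simp
      have fin: "finite p" using p by auto
      define p1 where "p1 = {xk \<in> p. fst xk \<in> N}"
      have "p tagged_partial_division_of {a..b}" using p' by (simp add: tagged_division_of_def)
      then have "p1 tagged_partial_division_of {a..b}"
        by (rule tagged_partial_division_subset) (auto simp: p1_def)
      then have p1: "p1 tagged_division_of \<Union>(snd ` p1)"
        by (rule tagged_partial_division_of_Union_self)
      define D where "D = snd ` p1"
      have D: "D division_of \<Union>D" unfolding D_def by (rule division_of_tagged_division[OF p1])
      have "K \<subseteq> U" if "K \<in> D" for K
      proof -
        obtain x where "(x, K) \<in> p" "x \<in> N" using \<open>K \<in> D\<close> by (auto simp: D_def p1_def)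
        then show ?thesis using p unfolding fine_def \<gamma>_def by fastforce
      qed
      then have "\<Union>D \<subseteq> U" by blast
      then have "measure lebesgue (\<Union>D) \<le> measure lebesgue U"
        using division_measure[OF D] Um by (intro measure_mono_fmeasurable) auto
      moreover have "\<Union>D \<subseteq> {a..b}" using p' by (fastforce simp: D_def p1_def)
      ultimately have "(\<Sum>K\<in>D. norm (incr f K)) < e / 2" using \<delta>(2)[OF D] Ul by simp
      \<comment> \<open>\<open>incr f {}\<close> is an unspecified number, whereas the passage from
        divisions to tagged divisions asks for the value 0 on all degenerate boxes, the empty one
        included; hence the detour through the conditional.\<close>
      also have "(\<Sum>K\<in>D. norm (incr f K)) = (\<Sum>K\<in>D. if K = {} then 0 else norm (incr f K))"
        using division_ofD(3)[OF D] by (intro sum.cong) auto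
      also have "\<dots> = (\<Sum>(x, K)\<in>p1. if K = {} then 0 else norm (incr f K))"
        unfolding D_def
      proof (rule sum.over_tagged_division_lemma[OF p1, symmetric])
        fix u v :: real assume "box u v = {}"
        then consider "v < u" | "u = v" by fastforce
        then show "(if cbox u v = {} then 0 else norm (incr f (cbox u v))) = 0" by cases (auto simp: incr_def)
      qed
      also have "\<dots> = (\<Sum>(x, K)\<in>p1. norm (incr f K))"
      proof (intro sum.cong refl, clarify)
        fix x K assume "(x, K) \<in> p1"
        then have "x \<in> K" by (rule tagged_division_ofD(2)[OF p1])
        then show "(if K = {} then 0 else norm (incr f K)) = norm (incr f K)" by auto
      qed
      finally have 1: "(\<Sum>(x, K)\<in>p1. norm (incr f K)) < e / 2" .
      have K: "\<exists>u w. K = {u..w} \<and> u \<le> x \<and> x \<le> w \<and> a \<le> u \<and> w \<le> b" if "(x, K) \<in> p" for x K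
        using tagged_division_ofD(2,3,4)[OF p' that] by auto
      have "(\<Sum>(x, K)\<in>p. measure lborel K *\<^sub>R g x) - (f b - f a) = (\<Sum>(x, K)\<in>p. measure lborel K *\<^sub>R g x - incr f K)"
        using additive_tagged_division_1[OF less_imp_le[OF ab] p', of f]
        by (simp add: sum_subtractf case_prod_unfold incr_def)
      also have "norm \<dots> \<le> (\<Sum>(x, K)\<in>p. norm (measure lborel K *\<^sub>R g x - incr f K))"
        using norm_sum by (simp add: case_prod_unfold)
      also have "\<dots> \<le> (\<Sum>(x, K)\<in>p. e1 * measure lborel K + (if x \<in> N then norm (incr f K) else 0))"
      proof (rule sum_mono, clarify)
        fix x K assume xK: "(x, K) \<in> p"
        obtain u w where uw: "K = {u..w}" "u \<le> x" "x \<le> w" "a \<le> u" "w \<le> b" using K[OF xK] by blast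
        show "norm (measure lborel K *\<^sub>R g x - incr f K) \<le> e1 * measure lborel K + (if x \<in> N then norm (incr f K) else 0)"
        proof (cases "x \<in> N")
          case True
          then show ?thesis using e1 by (simp add: g_def)
        next
          case False
          then have "K \<subseteq> ball x (\<rho> x)" using p xK unfolding fine_def \<gamma>_def by fastforce
          then have "u \<in> ball x (\<rho> x)" "w \<in> ball x (\<rho> x)" using uw by (auto simp del: mem_ball)
          then have "norm ((w - u) *\<^sub>R g x - (f w - f u)) \<le> e1 * (w - u)"
            using uw False by (intro \<rho>(2)) auto
          then show ?thesis using uw False by simp
        qed
      qed
      also have "\<dots> = (\<Sum>(x, K)\<in>p. e1 * measure lborel K) + (\<Sum>(x, K)\<in>p. if x \<in> N then norm (incr f K) else 0)"
        by (simp only: case_prod_unfold sum.distrib)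
      also have "(\<Sum>(x, K)\<in>p. e1 * measure lborel K) = e1 * (\<Sum>(x, K)\<in>p. measure lborel K)"
        by (simp only: case_prod_unfold sum_distrib_left)
      also have "(\<Sum>(x, K)\<in>p. if x \<in> N then norm (incr f K) else 0) = (\<Sum>(x, K)\<in>p1. norm (incr f K))"
        by (simp only: case_prod_unfold p1_def sum.inter_filter[OF fin])
      also have "(\<Sum>(x, K)\<in>p. measure lborel K) = b - a"
        using additive_content_tagged_division[of p a b] p ab by simp
      also have "e1 * (b - a) + (\<Sum>(x, K)\<in>p1. norm (incr f K)) < e" using e1ab 1 by simp
      finally show "norm ((\<Sum>(x, k)\<in>p. measure lborel k *\<^sub>R g x) - (f b - f a)) < e" .
    qed
  qed
  then have "(g has_integral f b - f a) {a..b}" by simp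
  moreover have "vector_derivative f (at x within {a..b}) = g x" if "x \<in> {a..b} - N" for x
    using that by (simp add: g_def)
  ultimately show ?thesis by (rule has_integral_spike[OF N(1), rotated])
qed

section \<open>Almost everywhere differentiability from supergradients\<close>

lemma lipschitz_abs_cont_on:
  assumes "L-lipschitz_on {a..b} f"
  shows "abs_cont_on a b f"
  unfolding abs_cont_on_def
proof (intro allI impI)
  fix e :: real assume e: "0 < e"
  have L: "0 \<le> L" using assms lipschitz_on_nonneg by blast
  have "(\<Sum>i<m. norm (f (r i) - f (l i))) < e"
    if *: "\<forall>i<m. a \<le> l i \<and> l i \<le> r i \<and> r i \<le> b" "(\<Sum>i<m. r i - l i) < e / (L + 1)" for m :: nat and l r
  proof -
    have "(\<Sum>i<m. norm (f (r i) - f (l i))) \<le> (\<Sum>i<m. L * (r i - l i))"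
    proof (rule sum_mono)
      fix i assume "i \<in> {..<m}"
      then have "a \<le> l i" "l i \<le> r i" "r i \<le> b" using * by auto
      then show "norm (f (r i) - f (l i)) \<le> L * (r i - l i)"
        using lipschitz_onD[OF assms, of "r i" "l i"] by (simp add: dist_norm)
    qed
    also have "\<dots> = L * (\<Sum>i<m. r i - l i)" by (simp add: sum_distrib_left)
    also have "\<dots> \<le> L * (e / (L + 1))" using * L by (intro mult_left_mono) auto
    also have "\<dots> < e" using L e by (simp add: field_simps)
    finally show ?thesis .
  qed
  then show "\<exists>\<delta>>0. \<forall>(m::nat) l r. (\<forall>i<m. a \<le> l i \<and> l i \<le> r i \<and> r i \<le> b) \<and>
        disjoint_family_on (\<lambda>i. {l i<..<r i}) {..<m} \<and> (\<Sum>i<m. r i - l i) < \<delta> \<longrightarrow>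
        (\<Sum>i<m. norm (f (r i) - f (l i))) < e"
    using e L by (intro exI[of _ "e / (L + 1)"]) auto
qed

section \<open>Exceptional points along lines in a fixed direction\<close>

lemma borel_steep_direction:
  fixes F :: "'a::euclidean_space \<Rightarrow> real"
  assumes F: "continuous_on UNIV F"
  shows "{z. steep (\<lambda>\<tau>. F (z + \<tau> *\<^sub>R h)) s 0} \<in> sets borel"
proof -
  \<comment> \<open>For fixed \<open>u\<close> and \<open>w\<close> continuity of \<open>F\<close>
    makes the condition open in \<open>z\<close>, so even the uncountable union over
    \<open>u\<close> and \<open>w\<close> is open.\<close>
  have op: "open {z. s * (w - u) < F (z + w *\<^sub>R h) - F (z + u *\<^sub>R h)}" for u w
    by (intro open_Collect_less continuous_intros continuous_on_compose2[OF F]) auto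
  have "{z. steep (\<lambda>\<tau>. F (z + \<tau> *\<^sub>R h)) s 0}
    = (\<Inter>n. \<Union>(u, w)\<in>{(u, w). u < 0 \<and> 0 < w \<and> w - u < 1 / real (Suc n)}. {z. s * (w - u) < F (z + w *\<^sub>R h) - F (z + u *\<^sub>R h)})"
    unfolding steep_iff_Suc by fastforce
  also have "\<dots> \<in> sets borel"
    using op by (intro sets.countable_INT'' borel_open open_UN) auto
  finally show ?thesis .
qed

lemma borel_erratic_direction:
  fixes F :: "'a::euclidean_space \<Rightarrow> real"
  assumes F: "continuous_on UNIV F"
  shows "{z. erratic (\<lambda>\<tau>. F (z + \<tau> *\<^sub>R h)) 0} \<in> sets borel"
proof -
  let ?S = "\<lambda>F s. {z::'a. steep (\<lambda>\<tau>. F (z + \<tau> *\<^sub>R h)) s 0}" and ?m = "\<lambda>x. - F x"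
  have m: "?S F s \<in> sets borel" "?S ?m s \<in> sets borel" for s
    using F by (intro borel_steep_direction continuous_intros; assumption)+
  have "{z. erratic (\<lambda>\<tau>. F (z + \<tau> *\<^sub>R h)) 0} =
    (\<Union>r\<in>\<rat>. \<Union>s\<in>\<rat> \<inter> {r<..}. ?S F s \<inter> ?S ?m (- r)) \<union> (\<Inter>n. ?S F (real n)) \<union> (\<Inter>n. ?S ?m (real n))"
    unfolding erratic_def by auto
  also have "\<dots> \<in> sets borel"
    by (intro sets.Un sets.countable_UN'' sets.countable_INT'' sets.Int m) (auto simp: countable_rat)
  finally show ?thesis .
qed

lemma steep_shift: "steep f s x \<longleftrightarrow> steep (\<lambda>\<tau>. f (x + \<tau>)) s 0"
  unfolding steep_def
proof (intro iffI allI impI)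
  fix k :: real assume k: "0 < k"
  { assume "\<forall>k>0. \<exists>u w. u < x \<and> x < w \<and> w - u < k \<and> s * (w - u) < f w - f u"
    with k obtain u w where "u < x" "x < w" "w - u < k" "s * (w - u) < f w - f u" by blast
    then show "\<exists>u w. u < 0 \<and> 0 < w \<and> w - u < k \<and> s * (w - u) < f (x + w) - f (x + u)"
      by (intro exI[of _ "u - x"] exI[of _ "w - x"]) auto }
  { assume "\<forall>k>0. \<exists>u w. u < 0 \<and> 0 < w \<and> w - u < k \<and> s * (w - u) < f (x + w) - f (x + u)"
    with k obtain u w where "u < 0" "0 < w" "w - u < k" "s * (w - u) < f (x + w) - f (x + u)" by blast
    then show "\<exists>u w. u < x \<and> x < w \<and> w - u < k \<and> s * (w - u) < f w - f u"
      by (intro exI[of _ "x + u"] exI[of _ "x + w"]) auto }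
qed

lemma erratic_shift: "erratic f x \<longleftrightarrow> erratic (\<lambda>\<tau>. f (x + \<tau>)) 0"
  unfolding erratic_def by (subst (1 2 3 4) steep_shift) simp

lemma negligible_erratic_lipschitz:
  assumes "L-lipschitz_on UNIV f"
  shows "negligible {x. erratic f x}"
proof -
  have "{x. erratic f x} \<subseteq> (\<Union>n::nat. {x\<in>{- real n<..<real n}. erratic f x})"
  proof
    fix x assume x: "x \<in> {x. erratic f x}"
    obtain n :: nat where "\<bar>x\<bar> < n" using reals_Archimedean2 by blast
    then show "x \<in> (\<Union>n::nat. {x\<in>{- real n<..<real n}. erratic f x})" using x by (intro UN_I[of n]) auto
  qed
  moreover have "negligible (\<Union>n::nat. {x\<in>{- real n<..<real n}. erratic f x})"
    using lipschitz_on_subset[OF assms]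
    by (intro negligible_UN negligible_erratic lipschitz_abs_cont_on[of L]) auto
  ultimately show ?thesis by (rule negligible_subset[rotated])
qed

text \<open>By Fubini the pairs \<open>(z, \<tau>)\<close> with \<open>z + \<tau> h\<close> in the exceptional set are negligible, hence for some \<open>\<tau>\<close>
  the translate of that set by \<open>- \<tau> h\<close> is; no change of coordinates towards \<open>h\<close> is needed.\<close>

lemma negligible_erratic_direction:
  fixes F :: "'a::euclidean_space \<Rightarrow> real"
  assumes F: "L-lipschitz_on UNIV F"
  shows "negligible {z. erratic (\<lambda>\<tau>. F (z + \<tau> *\<^sub>R h)) 0}" (is "negligible ?B")
proof -
  have L: "0 \<le> L" using F lipschitz_on_nonneg by blast
  define B where "B = ?B"
  have B[measurable]: "B \<in> sets borel" unfolding B_def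
    by (rule borel_erratic_direction) (rule lipschitz_on_continuous_on[OF F])
  have lipz: "(L * norm h)-lipschitz_on UNIV (\<lambda>\<tau>. F (z + \<tau> *\<^sub>R h))" for z
  proof (rule lipschitz_onI)
    fix x y :: real
    have "dist (F (z + x *\<^sub>R h)) (F (z + y *\<^sub>R h)) \<le> L * dist (z + x *\<^sub>R h) (z + y *\<^sub>R h)"
      by (rule lipschitz_onD[OF F]) auto
    also have "dist (z + x *\<^sub>R h) (z + y *\<^sub>R h) = norm h * dist x y"
      by (simp add: dist_norm scaleR_left_diff_distrib[symmetric])
    finally show "dist (F (z + x *\<^sub>R h)) (F (z + y *\<^sub>R h)) \<le> L * norm h * dist x y" by simp
  qed (use L in simp)
  have "AE \<tau> in lborel. z + \<tau> *\<^sub>R h \<notin> B" for z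
  proof -
    have "{\<tau>. z + \<tau> *\<^sub>R h \<in> B} = {\<tau>. erratic (\<lambda>\<tau>. F (z + \<tau> *\<^sub>R h)) \<tau>}"
      unfolding B_def by (subst (2) erratic_shift) (simp add: scaleR_left_distrib add.assoc)
    with negligible_erratic_lipschitz[OF lipz] have "negligible {\<tau>. z + \<tau> *\<^sub>R h \<in> B}" by simp
    moreover have "{\<tau>. z + \<tau> *\<^sub>R h \<in> B} \<in> sets borel" by measurable
    ultimately show ?thesis
      by (intro AE_I[of _ _ "{\<tau>. z + \<tau> *\<^sub>R h \<in> B}"])
        (auto simp: negligible_iff_null_sets null_sets_def)
  qed
  \<comment> \<open>On every single line the bad parameters are the erratic points of a Lipschitz
    function of one variable; exchanging the quantifiers then gives one parameter that is good for
    almost all lines.\<close>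
  then have "AE z in lborel. AE \<tau> in lborel. z + \<tau> *\<^sub>R h \<notin> B" by simp
  then have "AE \<tau> in lborel. AE z in lborel. z + \<tau> *\<^sub>R h \<notin> B"
  proof (subst (asm) lborel_pair.AE_commute)
    have "(\<lambda>x. fst x + snd x *\<^sub>R h) \<in> borel_measurable (lborel \<Otimes>\<^sub>M lborel)" by measurable
    from measurable_sets[OF this, of "- B"] B
    show "{x \<in> space (lborel \<Otimes>\<^sub>M lborel). fst x + snd x *\<^sub>R h \<notin> B} \<in> sets (lborel \<Otimes>\<^sub>M lborel)"
      by (simp add: vimage_def Int_def conj_commute)
  qed
  moreover have "ae_filter (lborel :: real measure) \<noteq> bot"
    by (simp add: ae_filter_eq_bot_iff)
  ultimately obtain \<tau> where \<tau>: "AE z in lborel. z + \<tau> *\<^sub>R h \<notin> B"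
    using eventually_happens' by blast
  moreover have "{z. z + \<tau> *\<^sub>R h \<in> B} \<in> sets lborel" by measurable
  ultimately have "{z. z + \<tau> *\<^sub>R h \<in> B} \<in> null_sets lborel" by (subst AE_iff_null_sets) auto
  then have "negligible {z. z + \<tau> *\<^sub>R h \<in> B}"
    by (simp add: negligible_iff_null_sets null_sets_completionI)
  then have "negligible ((+) (\<tau> *\<^sub>R h) ` {z. z + \<tau> *\<^sub>R h \<in> B})" by (rule negligible_translation)
  moreover have "B \<subseteq> (+) (\<tau> *\<^sub>R h) ` {z. z + \<tau> *\<^sub>R h \<in> B}"
    by (auto intro!: image_eqI[where x = "_ - \<tau> *\<^sub>R h"])
  ultimately have "negligible B" by (rule negligible_subset)
  then show ?thesis by (simp add: B_def)
qed

section \<open>Elements of the Frechet superdifferential\<close>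

definition supergradient :: "('a::real_inner \<Rightarrow> real) \<Rightarrow> 'a \<Rightarrow> 'a \<Rightarrow> bool" where
  "supergradient f z q \<longleftrightarrow>
     (\<forall>e>0. \<forall>\<^sub>F y in nhds z. f y \<le> f z + q \<bullet> (y - z) + e * norm (y - z))"

text \<open>The upper bound on \<open>f\<close> bounds the quotient from above for positive
  \<open>\<tau>\<close> and, after division by a negative number, from below for negative
  \<open>\<tau>\<close>. A two-sided derivative is thereby pinned down.\<close>

lemma supergradient_direction:
  assumes q: "supergradient f z q" and D: "DERIV (\<lambda>\<tau>. f (z + \<tau> *\<^sub>R h)) 0 :> c"
  shows "c = q \<bullet> h"
proof -
  have close: "\<bar>c - q \<bullet> h\<bar> \<le> e * norm h" if e: "e > 0" for e
  proof -
    have lim: "((\<lambda>\<tau>. z + \<tau> *\<^sub>R h) \<longlongrightarrow> z) (at 0)" by (auto intro!: tendsto_eq_intros)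
    have "\<forall>\<^sub>F \<tau> in at 0. f (z + \<tau> *\<^sub>R h) \<le> f z + q \<bullet> (z + \<tau> *\<^sub>R h - z) + e * norm (z + \<tau> *\<^sub>R h - z)"
      using eventually_compose_filterlim[OF q[unfolded supergradient_def, rule_format, OF e] lim] .
    then have ev: "\<forall>\<^sub>F \<tau> in at 0. f (z + \<tau> *\<^sub>R h) - f z \<le> \<tau> * (q \<bullet> h) + e * (\<bar>\<tau>\<bar> * norm h)"
      by eventually_elim simp
    have quot: "((\<lambda>\<tau>. (f (z + \<tau> *\<^sub>R h) - f z) / \<tau>) \<longlongrightarrow> c) (at 0)"
      using D by (simp add: DERIV_def)
    have "\<forall>\<^sub>F \<tau> in at_right 0. (f (z + \<tau> *\<^sub>R h) - f z) / \<tau> \<le> q \<bullet> h + e * norm h"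
      using ev[unfolded eventually_at_split, THEN conjunct2] eventually_at_right_less[of 0]
      by eventually_elim (simp add: field_simps)
    then have "c \<le> q \<bullet> h + e * norm h"
      by (rule tendsto_upperbound[OF quot[unfolded filterlim_at_split, THEN conjunct2]]) simp
    moreover have "\<forall>\<^sub>F \<tau> in at_left 0. q \<bullet> h - e * norm h \<le> (f (z + \<tau> *\<^sub>R h) - f z) / \<tau>"
      using ev[unfolded eventually_at_split, THEN conjunct1] eventually_at_left_real[of "-1" 0, simplified]
      by eventually_elim (simp add: field_simps)
    then have "q \<bullet> h - e * norm h \<le> c"
      by (rule tendsto_lowerbound[OF quot[unfolded filterlim_at_split, THEN conjunct1]]) simp
    ultimately show ?thesis by linarith
  qed
  have "\<bar>c - q \<bullet> h\<bar> \<le> 0"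
  proof (rule field_le_epsilon)
    fix e :: real assume e: "0 < e"
    have "\<bar>c - q \<bullet> h\<bar> \<le> e / (norm h + 1) * norm h" using e by (intro close) (simp add: add_nonneg_pos)
    also have "\<dots> \<le> e" using e by (simp add: divide_le_eq add_nonneg_pos mult_left_mono)
    finally show "\<bar>c - q \<bullet> h\<bar> \<le> 0 + e" by simp
  qed
  then show ?thesis by simp
qed

text \<open>In the dense directions the directional derivative is \<open>q \<bullet> h\<close>,
  linear in \<open>h\<close>. Finitely many of these directions are \<open>\<eta>\<close>-dense in
  the unit ball, and the Lipschitz bound carries the estimate from them to all directions
  uniformly.\<close>

lemma lipschitz_supergradient_differentiable:
  fixes F :: "'a::euclidean_space \<Rightarrow> real"
  assumes F: "L-lipschitz_on UNIV F" and q: "supergradient F z q"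
    and D: "\<And>U. open U \<Longrightarrow> U \<noteq> {} \<Longrightarrow> \<exists>h\<in>D. h \<in> U"
    and good: "\<And>h. h \<in> D \<Longrightarrow> \<not> erratic (\<lambda>\<tau>. F (z + \<tau> *\<^sub>R h)) 0"
  shows "F differentiable (at z)"
proof -
  have L: "0 \<le> L" using F lipschitz_on_nonneg by blast
  have cF: "continuous_on UNIV F" by (rule lipschitz_on_continuous_on[OF F])
  have dir: "DERIV (\<lambda>\<tau>. F (z + \<tau> *\<^sub>R h)) 0 :> q \<bullet> h" if h: "h \<in> D" for h
  proof -
    have "continuous_on UNIV (\<lambda>\<tau>. F (z + \<tau> *\<^sub>R h))"
      by (intro continuous_on_compose2[OF cF] continuous_intros) auto
    then have "isCont (\<lambda>\<tau>. F (z + \<tau> *\<^sub>R h)) 0" by (simp add: continuous_on_eq_continuous_at)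
    then have "(\<lambda>\<tau>. F (z + \<tau> *\<^sub>R h)) differentiable (at 0)"
      using not_erratic_differentiable good[OF h] by blast
    then obtain c where "DERIV (\<lambda>\<tau>. F (z + \<tau> *\<^sub>R h)) 0 :> c"
      using real_differentiable_def by blast
    with supergradient_direction[OF q this] show ?thesis by simp
  qed
  have "(F has_derivative (\<lambda>v. q \<bullet> v)) (at z)"
    unfolding has_derivative_at_alt
  proof (intro conjI allI impI)
    show "bounded_linear (\<lambda>v. q \<bullet> v)" by (rule bounded_linear_inner_right)
    fix e :: real assume e: "0 < e"
    \<comment> \<open>Three errors of size \<open>\<tau> * \<eta>\<close> add up: the difference
      quotient itself with factor 1, the change of direction inside \<open>F\<close> with factor
      \<open>L\<close>, and the one inside the linear map with factor \<open>norm q\<close>.\<close>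
    define \<eta> where "\<eta> = e / (1 + L + norm q)"
    have pos: "1 + L + norm q > 0" using L by (simp add: add_pos_nonneg)
    have \<eta>: "0 < \<eta>" "\<eta> * (1 + L + norm q) = e" using e pos by (auto simp: \<eta>_def)
    have "compact (cball (0::'a) 1)" by simp
    moreover have "cball (0::'a) 1 \<subseteq> (\<Union>h\<in>D. ball h \<eta>)"
    proof
      fix w :: 'a
      obtain h where "h \<in> D" "h \<in> ball w \<eta>" using D[of "ball w \<eta>"] \<eta> by auto
      then show "w \<in> (\<Union>h\<in>D. ball h \<eta>)" by (auto simp: dist_commute)
    qed
    ultimately obtain H where H: "H \<subseteq> D" "finite H" "cball (0::'a) 1 \<subseteq> (\<Union>h\<in>H. ball h \<eta>)"
      using compactE_image[of "cball (0::'a) 1" D "\<lambda>h. ball h \<eta>"] by (metis open_ball)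
    have "\<forall>\<^sub>F \<tau> in nhds 0. norm (F (z + \<tau> *\<^sub>R h) - F z - \<tau> * (q \<bullet> h)) \<le> \<eta> * norm \<tau>" if h: "h \<in> H" for h
    proof -
      have "((\<lambda>\<tau>. F (z + \<tau> *\<^sub>R h)) has_derivative (\<lambda>\<tau>. \<tau> * (q \<bullet> h))) (at 0)"
        using dir[of h] H h unfolding has_field_derivative_def mult.commute[of "q \<bullet> h"] by blast
      then obtain d where "d > 0" "\<And>y. norm y < d \<Longrightarrow> norm (F (z + y *\<^sub>R h) - F z - y * (q \<bullet> h)) \<le> \<eta> * norm y"
        using \<eta>(1) by (auto simp: has_derivative_at_alt)
      then show ?thesis by (auto simp: eventually_nhds_metric)
    qed
    then have "\<forall>\<^sub>F \<tau> in nhds 0. \<forall>h\<in>H. norm (F (z + \<tau> *\<^sub>R h) - F z - \<tau> * (q \<bullet> h)) \<le> \<eta> * norm \<tau>"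
      using H(2) by (simp add: eventually_ball_finite)
    then obtain d where d: "d > 0" "\<And>\<tau> h. \<bar>\<tau>\<bar> < d \<Longrightarrow> h \<in> H \<Longrightarrow> norm (F (z + \<tau> *\<^sub>R h) - F z - \<tau> * (q \<bullet> h)) \<le> \<eta> * norm \<tau>"
      by (auto simp: eventually_nhds_metric)
    show "\<exists>d>0. \<forall>y. norm (y - z) < d \<longrightarrow> norm (F y - F z - q \<bullet> (y - z)) \<le> e * norm (y - z)"
    proof (intro exI[of _ d] conjI allI impI d(1))
      fix y assume y: "norm (y - z) < d"
      \<comment> \<open>For \<open>y = z\<close> the division by zero gives \<open>w = 0\<close>,
        which the finite covering handles as well because it covers the closed ball and not just the
        sphere.\<close>
      define \<tau> w where "\<tau> = norm (y - z)" and "w = (1 / norm (y - z)) *\<^sub>R (y - z)"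
      have yw: "y = z + \<tau> *\<^sub>R w" by (cases "y = z") (simp_all add: \<tau>_def w_def)
      have "norm w \<le> 1" by (simp add: w_def)
      then obtain h where h: "h \<in> H" "norm (w - h) < \<eta>" using H(3) by (force simp: dist_norm norm_minus_commute)
      have \<tau>: "0 \<le> \<tau>" "\<tau> < d" using y by (auto simp: \<tau>_def)
      have 1: "\<bar>F y - F (z + \<tau> *\<^sub>R h)\<bar> \<le> L * (\<tau> * \<eta>)"
      proof -
        have "\<bar>F y - F (z + \<tau> *\<^sub>R h)\<bar> \<le> L * dist y (z + \<tau> *\<^sub>R h)"
          using lipschitz_onD[OF F, of y "z + \<tau> *\<^sub>R h"] by (simp add: dist_real_def)
        also have "dist y (z + \<tau> *\<^sub>R h) = \<tau> * norm (w - h)"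
          using \<tau> by (simp add: yw dist_norm scaleR_right_diff_distrib[symmetric])
        also have "L * (\<tau> * norm (w - h)) \<le> L * (\<tau> * \<eta>)"
          using h \<tau> L by (intro mult_left_mono) auto
        finally show ?thesis .
      qed
      have 2: "\<bar>F (z + \<tau> *\<^sub>R h) - F z - \<tau> * (q \<bullet> h)\<bar> \<le> \<eta> * \<tau>"
        using d(2)[of \<tau> h] h \<tau> by simp
      have 3: "\<bar>\<tau> * (q \<bullet> h) - q \<bullet> (y - z)\<bar> \<le> norm q * (\<tau> * \<eta>)"
      proof -
        have "\<tau> * (q \<bullet> h) - q \<bullet> (y - z) = q \<bullet> (\<tau> *\<^sub>R (h - w))"
          by (simp add: yw inner_diff_right algebra_simps)
        also have "\<bar>\<dots>\<bar> \<le> norm q * norm (\<tau> *\<^sub>R (h - w))" by (rule Cauchy_Schwarz_ineq2)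
        also have "\<dots> \<le> norm q * (\<tau> * \<eta>)"
          using h \<tau> by (auto intro!: mult_left_mono simp: norm_minus_commute)
        finally show ?thesis .
      qed
      have "\<bar>F y - F z - q \<bullet> (y - z)\<bar> \<le> L * (\<tau> * \<eta>) + \<eta> * \<tau> + norm q * (\<tau> * \<eta>)"
        using 1 2 3 by linarith
      also have "\<dots> = (\<eta> * (1 + L + norm q)) * \<tau>" by (simp add: algebra_simps)
      also have "\<dots> = e * norm (y - z)" by (simp add: \<eta>(2)) (simp add: \<tau>_def)
      finally show "norm (F y - F z - q \<bullet> (y - z)) \<le> e * norm (y - z)" by simp
    qed
  qed
  then show ?thesis by (auto simp: differentiable_def)
qed

theorem negligible_not_differentiable:
  fixes f :: "'a::euclidean_space \<Rightarrow> real"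
  assumes S: "open S" and f: "locally_lipschitz_on S f"
    and q: "\<And>z. z \<in> S \<Longrightarrow> \<exists>q. supergradient f z q"
  shows "negligible {z\<in>S. \<not> f differentiable (at z)}"
proof (rule locally_negligible_alt[THEN iffD2], rule)
  let ?N = "{z\<in>S. \<not> f differentiable (at z)}"
  fix z assume z: "z \<in> ?N"
  obtain r1 L where r1: "r1 > 0" "L-lipschitz_on (cball z r1 \<inter> S) f"
    using f z by (auto simp: locally_lipschitz_on_def)
  obtain r2 where r2: "r2 > 0" "cball z r2 \<subseteq> S" using S z open_contains_cball by blast
  define r where "r = min r1 r2"
  have r: "r > 0" "cball z r \<subseteq> S" using r1 r2 by (auto simp: r_def)
  have fL: "L-lipschitz_on (cball z r) f"
    by (rule lipschitz_on_subset[OF r1(2)]) (use r2 in \<open>auto simp: r_def\<close>)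
  have L: "0 \<le> L" using fL lipschitz_on_nonneg by blast
  have ne: "cball z r \<noteq> {}" using r by simp
  \<comment> \<open>The metric projection onto the ball does not increase distances, so this extends
    \<open>f\<close> from the ball to the whole space with the same Lipschitz constant.\<close>
  define F where "F = (\<lambda>y. f (closest_point (cball z r) y))"
  have FL: "L-lipschitz_on UNIV F"
  proof (rule lipschitz_onI)
    fix x y
    have "dist (F x) (F y) \<le> L * dist (closest_point (cball z r) x) (closest_point (cball z r) y)"
      unfolding F_def by (intro lipschitz_onD[OF fL] closest_point_in_set closed_cball ne)
    also have "\<dots> \<le> L * dist x y"
      using L by (intro mult_left_mono closest_point_lipschitz convex_cball closed_cball ne)
    finally show "dist (F x) (F y) \<le> L * dist x y" .
  qed (rule L)
  have Ff: "F y = f y" if "y \<in> ball z r" for y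
    using that by (simp add: F_def closest_point_self)
  obtain D :: "'a set" where D: "countable D" "\<And>U. open U \<Longrightarrow> U \<noteq> {} \<Longrightarrow> \<exists>h\<in>D. h \<in> U"
    using countable_dense_setE by metis
  have "?N \<inter> ball z r \<subseteq> (\<Union>h\<in>D. {y. erratic (\<lambda>\<tau>. F (y + \<tau> *\<^sub>R h)) 0})"
  proof (rule subsetI, rule ccontr)
    fix y assume y: "y \<in> ?N \<inter> ball z r"
      and bad: "y \<notin> (\<Union>h\<in>D. {y. erratic (\<lambda>\<tau>. F (y + \<tau> *\<^sub>R h)) 0})"
    have ev: "\<forall>\<^sub>F x in nhds y. x \<in> ball z r" using y by (intro eventually_nhds_in_open) auto
    obtain q where "supergradient f y q" using q y by blast
    then have "supergradient F y q"
      unfolding supergradient_def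
    proof (intro allI impI)
      fix e :: real assume e: "0 < e" and
        *: "\<forall>e>0. \<forall>\<^sub>F x in nhds y. f x \<le> f y + q \<bullet> (x - y) + e * norm (x - y)"
      from *[rule_format, OF e] ev
      show "\<forall>\<^sub>F x in nhds y. F x \<le> F y + q \<bullet> (x - y) + e * norm (x - y)"
        by eventually_elim (use y Ff in auto)
    qed
    then have "F differentiable (at y)"
      using bad by (intro lipschitz_supergradient_differentiable[OF FL _ D(2)]) auto
    then obtain F' where "(F has_derivative F') (at y)" by (auto simp: differentiable_def)
    then have "(f has_derivative F') (at y)"
      by (rule has_derivative_transform_within_open[of _ _ _ _ "ball z r"]) (use y Ff in auto)
    then show False using y by (auto simp: differentiable_def)
  qed
  moreover have "negligible (\<Union>h\<in>D. {y. erratic (\<lambda>\<tau>. F (y + \<tau> *\<^sub>R h)) 0})"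
    by (intro negligible_UN D(1) negligible_erratic_direction[OF FL])
  ultimately have "negligible (?N \<inter> ball z r)" by (rule negligible_subset[rotated])
  moreover have "openin (top_of_set ?N) (?N \<inter> ball z r)" by (rule openin_open_Int) simp
  moreover have "z \<in> ?N \<inter> ball z r" using z r by simp
  ultimately show "\<exists>U. openin (top_of_set ?N) U \<and> z \<in> U \<and> negligible U" by blast
qed

section \<open>The Lagrangian\<close>

text \<open>Since \<open>grad\<close> is a definite description, the representing vector must be
  shown to exist, which is done in basis coordinates, and to be unique.\<close>

lemma differentiable_GDERIV_grad:
  fixes f :: "'a::euclidean_space \<Rightarrow> real"
  assumes "f differentiable (at x)"
  shows "GDERIV f x :> grad f x"
proof -
  obtain f' where f': "(f has_derivative f') (at x)" using assms by (auto simp: differentiable_def)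
  interpret linear f' using f' by (rule has_derivative_linear)
  have "f' = (\<lambda>h. h \<bullet> (\<Sum>i\<in>Basis. f' i *\<^sub>R i))"
  proof
    fix h
    have "f' h = f' (\<Sum>i\<in>Basis. (h \<bullet> i) *\<^sub>R i)" by (simp add: euclidean_representation)
    also have "\<dots> = h \<bullet> (\<Sum>i\<in>Basis. f' i *\<^sub>R i)"
      by (simp add: sum scaleR inner_sum_right mult.commute)
    finally show "f' h = h \<bullet> (\<Sum>i\<in>Basis. f' i *\<^sub>R i)" .
  qed
  with f' have ex: "GDERIV f x :> (\<Sum>i\<in>Basis. f' i *\<^sub>R i)" by (simp add: gderiv_def)
  have "D = E" if "GDERIV f x :> D" "GDERIV f x :> E" for D E
  proof -
    have "(\<lambda>h. h \<bullet> D) = (\<lambda>h. h \<bullet> E)"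
      using that unfolding gderiv_def by (rule has_derivative_unique)
    then have "\<And>h. h \<bullet> (D - E) = 0" by (metis inner_diff_right right_minus_eq)
    then show ?thesis by (metis inner_eq_zero_iff right_minus_eq)
  qed
  with ex show ?thesis unfolding grad_def by (metis (no_types, lifting) theI)
qed

lemma grad_eqI:
  fixes f :: "'a::euclidean_space \<Rightarrow> real"
  assumes "(f has_derivative (\<lambda>h. h \<bullet> D)) (at x)"
  shows "grad f x = D"
proof -
  have "f differentiable (at x)" using assms by (auto simp: differentiable_def)
  from differentiable_GDERIV_grad[OF this] have "(\<lambda>h. h \<bullet> grad f x) = (\<lambda>h. h \<bullet> D)"
    unfolding gderiv_def using assms by (rule has_derivative_unique)
  then have "\<And>h. h \<bullet> (grad f x - D) = 0" by (metis inner_diff_right right_minus_eq)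
  then show ?thesis by (metis inner_eq_zero_iff right_minus_eq)
qed

text \<open>If \<open>F\<close> omitted \<open>y\<close>, then \<open>G\<close>, which sends
  \<open>p\<close> to the vector of norm \<open>R\<close> opposite to \<open>F p - y\<close>, would
  have a fixed point in the ball by Brouwer's theorem. That point has norm \<open>R\<close> and
  \<open>(F p - y) \<bullet> p < 0\<close>, against \<open>pos\<close>.\<close>

lemma coercive_surj:
  fixes F :: "'a::euclidean_space \<Rightarrow> 'a"
  assumes F: "continuous_on UNIV F" and R: "0 < R"
    and pos: "\<And>p. norm p = R \<Longrightarrow> y \<bullet> p < F p \<bullet> p"
  obtains p where "F p = y"
proof (rule ccontr)
  assume "\<not> thesis"
  then have ne: "F p - y \<noteq> 0" for p using that by auto
  define G where "G = (\<lambda>p. (- R / norm (F p - y)) *\<^sub>R (F p - y))"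
  have nG: "norm (G p) = R" for p using ne[of p] R by (simp add: G_def)
  have "continuous_on (cball 0 R) G"
    unfolding G_def using ne by (intro continuous_intros continuous_on_subset[OF F]) auto
  moreover have "G \<in> cball 0 R \<rightarrow> cball 0 R" using nG by auto
  ultimately obtain p where p: "G p = p" using brouwer_ball[OF R] by metis
  have "(F p - y) \<bullet> p = (F p - y) \<bullet> G p" using p by simp
  also have "\<dots> = - (R * norm (F p - y))"
    using ne[of p] by (simp add: G_def dot_square_norm power2_eq_square)
  also have "\<dots> < 0" using R ne[of p] by simp
  finally show False using pos[of p] nG[of p] p by (simp add: inner_diff_left)
qed

locale lagrangian =
  fixes l :: "real ^ 'n \<Rightarrow> real"
  assumes l_differentiable: "\<And>u. l differentiable (at u)"
    and grad_continuous: "continuous_on UNIV (grad l)"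
    and l_convex: "strictly_convex l"
    and l_superlinear: "filterlim (\<lambda>u. l u / norm u) at_top at_infinity"
begin

lemma l_has_derivative: "(l has_derivative (\<lambda>h. h \<bullet> grad l u)) (at u)"
  using differentiable_GDERIV_grad[OF l_differentiable] by (simp add: gderiv_def)

lemma l_continuous: "continuous_on S l"
  using l_differentiable by (meson continuous_at_imp_continuous_on differentiable_imp_continuous_within)

lemma l_tangent: "l u + grad l u \<bullet> (w - u) \<le> l w"
proof (cases "u = w")
  case False
  have "((\<lambda>\<theta>. l (u + \<theta> *\<^sub>R (w - u))) has_derivative (\<lambda>h. (h *\<^sub>R (w - u)) \<bullet> grad l (u + 0 *\<^sub>R (w - u)))) (at 0)"
    by (rule has_derivative_compose[OF _ l_has_derivative]) (auto intro!: derivative_eq_intros)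
  then have "DERIV (\<lambda>\<theta>. l (u + \<theta> *\<^sub>R (w - u))) 0 :> (w - u) \<bullet> grad l u"
    by (simp add: has_field_derivative_def mult.commute[of _ "(w - u) \<bullet> grad l u"] mult_commute_abs)
  then have "((\<lambda>\<theta>. (l (u + \<theta> *\<^sub>R (w - u)) - l u) / \<theta>) \<longlongrightarrow> (w - u) \<bullet> grad l u) (at_right 0)"
    by (auto simp: DERIV_def filterlim_at_split)
  moreover have "\<forall>\<^sub>F \<theta> in at_right 0. (l (u + \<theta> *\<^sub>R (w - u)) - l u) / \<theta> \<le> l w - l u"
  proof (rule eventually_mono[OF eventually_at_right_real[OF zero_less_one]])
    fix \<theta> :: real assume \<theta>: "\<theta> \<in> {0<..<1}"
    have "l ((1 - \<theta>) *\<^sub>R u + \<theta> *\<^sub>R w) < (1 - \<theta>) * l u + \<theta> * l w"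
      using l_convex \<theta> False by (auto simp: strictly_convex_def)
    also have "(1 - \<theta>) *\<^sub>R u + \<theta> *\<^sub>R w = u + \<theta> *\<^sub>R (w - u)" by (simp add: algebra_simps)
    finally show "(l (u + \<theta> *\<^sub>R (w - u)) - l u) / \<theta> \<le> l w - l u"
      using \<theta> by (simp add: field_simps)
  qed
  ultimately have "(w - u) \<bullet> grad l u \<le> l w - l u"
    by (rule tendsto_upperbound) simp
  then show ?thesis by (simp add: inner_commute)
qed simp

text \<open>Strictness is gained at the midpoint, which satisfies the tangent inequality and lies
  strictly below the chord. Added for two points, the strict inequality makes \<open>grad l\<close>
  injective.\<close>

lemma l_tangent_strict:
  assumes "u \<noteq> w"
  shows "l u + grad l u \<bullet> (w - u) < l w"
proof -
  have half: "(1/2 :: real) \<in> {0<..<1}" by simp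
  let ?m = "(1 - 1/2) *\<^sub>R u + (1/2) *\<^sub>R w"
  have "l ?m < (1 - 1/2) * l u + (1/2) * l w"
    using l_convex assms half unfolding strictly_convex_def by blast
  moreover have "l u + grad l u \<bullet> (?m - u) \<le> l ?m" by (rule l_tangent)
  moreover have "(1 - \<theta>) *\<^sub>R u + \<theta> *\<^sub>R w - u = \<theta> *\<^sub>R (w - u)" for \<theta> by (simp add: algebra_simps)
  then have "?m - u = (1/2) *\<^sub>R (w - u)" .
  ultimately show ?thesis by simp
qed

lemma inj_grad: "inj (grad l)"
proof (rule injI, rule ccontr)
  fix u w assume "grad l u = grad l w" "u \<noteq> w"
  then show False using l_tangent_strict[of u w] l_tangent_strict[of w u]
    by (simp add: inner_diff_right)
qed

lemma l_lower_bound: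
  obtains C where "0 \<le> C" "\<And>u. M * norm u - C \<le> l u"
proof -
  obtain b where b: "\<And>u. b \<le> norm u \<Longrightarrow> M \<le> l u / norm u"
    using l_superlinear unfolding filterlim_at_top eventually_at_infinity by blast
  define R where "R = max b 1"
  obtain C where C: "\<And>u. u \<in> cball 0 R \<Longrightarrow> norm (M * norm u - l u) \<le> C"
  proof -
    have "compact ((\<lambda>u. M * norm u - l u) ` cball 0 R)"
      by (intro compact_continuous_image continuous_intros l_continuous compact_cball)
    from compact_imp_bounded[OF this] show thesis using that unfolding bounded_iff by blast
  qed
  show thesis
  proof (rule that[of "max C 0"])
    fix u
    show "M * norm u - max C 0 \<le> l u"
    proof (cases "norm u \<le> R")
      case True
      then show ?thesis using C[of u] by simp
    next
      case False
      then have "M \<le> l u / norm u" "norm u > 0" using b[of u] by (auto simp: R_def)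
      then have "M * norm u \<le> l u" by (simp add: field_simps)
      then show ?thesis by simp
    qed
  qed simp
qed

lemma surj_grad: "surj (grad l)"
proof -
  have "\<exists>u. grad l u = y" for y
  proof -
    obtain C where C: "0 \<le> C" "\<And>u. (norm y + 1) * norm u - C \<le> l u" using l_lower_bound by blast
    \<comment> \<open>The tangent at \<open>u\<close>, evaluated at 0, gives
      \<open>grad l u \<bullet> u\<close> at least \<open>norm y * R + R - C - l 0\<close>; this
      radius makes the surplus over \<open>norm y * R\<close> positive.\<close>
    define R where "R = C + \<bar>l 0\<bar> + 1"
    have R: "0 < R" using C by (simp add: R_def)
    have "y \<bullet> u < grad l u \<bullet> u" if "norm u = R" for u
    proof -
      have "l u + grad l u \<bullet> (0 - u) \<le> l 0" by (rule l_tangent)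
      moreover have "norm y * norm u + norm u - C \<le> l u" using C(2)[of u] by (simp add: algebra_simps)
      moreover have "y \<bullet> u \<le> norm y * norm u" by (rule norm_cauchy_schwarz)
      ultimately show ?thesis using that by (simp add: R_def)
    qed
    from coercive_surj[OF grad_continuous R this] show ?thesis by blast
  qed
  then show ?thesis unfolding surj_def by metis
qed

lemma grad_iota [simp]: "grad l (iota l p) = p"
  using surj_grad by (rule surj_f_inv_f)

lemma iota_grad [simp]: "iota l (grad l u) = u"
  using inj_grad by (rule inv_f_f)

text \<open>Invariance of domain: a continuous injection between Euclidean spaces of the same
  dimension is open, so its inverse is continuous.\<close>

lemma iota_continuous: "continuous_on S (iota l)"
proof -
  have "continuous_on (grad l ` UNIV) (iota l)"
    by (rule continuous_on_inverse_open) (auto simp: grad_continuous)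
  then show ?thesis using surj_grad continuous_on_subset by blast
qed

lemma iota_tangent: "l (iota l q) + q \<bullet> (w - iota l q) \<le> l w"
  using l_tangent[of "iota l q" w] by simp

text \<open>The tangent inequality at \<open>iota l q\<close> is tested at the multiple of
  \<open>q\<close> of norm \<open>M\<close>, where \<open>l\<close> is bounded independently of
  \<open>q\<close>. The arbitrary slope \<open>M\<close> is what makes the displacement map
  coercive.\<close>

lemma iota_inner_lower_bound:
  assumes "0 \<le> M"
  obtains C where "0 \<le> C" "\<And>q. M * norm q - C \<le> q \<bullet> iota l q"
proof -
  obtain C0 where C0: "0 \<le> C0" "\<And>u. 0 * norm u - C0 \<le> l u" using l_lower_bound by blast
  obtain C1 where C1: "\<And>u. u \<in> cball 0 M \<Longrightarrow> norm (l u) \<le> C1"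
  proof -
    have "compact (l ` cball 0 M)" by (intro compact_continuous_image l_continuous compact_cball)
    from compact_imp_bounded[OF this] show thesis using that unfolding bounded_iff by blast
  qed
  show thesis
  proof (rule that[of "C0 + max C1 0"])
    fix q :: "real ^ 'n"
    define w where "w = (M / norm q) *\<^sub>R q"
    have "norm w \<le> M" using assms by (simp add: w_def)
    then have "l w \<le> C1" using C1[of w] by simp
    moreover have "q \<bullet> w = M * norm q"
      by (simp add: w_def dot_square_norm power2_eq_square)
    moreover have "l (iota l q) + q \<bullet> (w - iota l q) \<le> l w" by (rule iota_tangent)
    moreover have "- C0 \<le> l (iota l q)" using C0(2)[of "iota l q"] by simp
    ultimately show "M * norm q - (C0 + max C1 0) \<le> q \<bullet> iota l q"
      by (simp add: inner_diff_right)
  qed (use C0 in simp)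
qed

text \<open>\<open>grad l\<close> is bounded on balls, so large momenta force large velocities; this
  confines the minimising momenta to a ball.\<close>

lemma iota_bounded_imp:
  obtains R where "0 < R" "\<And>q. norm (iota l q) \<le> M \<Longrightarrow> norm q \<le> R"
proof -
  have "compact (grad l ` cball 0 M)"
    by (intro compact_continuous_image continuous_on_subset[OF grad_continuous]) auto
  from compact_imp_bounded[OF this]
  obtain R where R: "\<And>u. u \<in> cball 0 M \<Longrightarrow> norm (grad l u) \<le> R"
    unfolding bounded_iff by blast
  show thesis
  proof (rule that[of "max R 1"])
    fix q :: "real ^ 'n" assume "norm (iota l q) \<le> M"
    then have "norm (grad l (iota l q)) \<le> R" by (intro R) simp
    then show "norm q \<le> max R 1" by simp
  qed simp
qed

lemma conjugate_eq: "conjugate l p = p \<bullet> iota l p - l (iota l p)"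
  unfolding conjugate_def
proof (rule cSup_eq_maximum)
  show "p \<bullet> iota l p - l (iota l p) \<in> range (\<lambda>u. p \<bullet> u - l u)" by blast
  show "x \<le> p \<bullet> iota l p - l (iota l p)" if "x \<in> range (\<lambda>u. p \<bullet> u - l u)" for x
    using that iota_tangent[of p] by (auto simp: inner_diff_right algebra_simps)
qed

end

section \<open>The discounted problem\<close>

locale discounted = lagrangian l for l :: "real ^ 'n \<Rightarrow> real" +
  fixes g :: "real ^ 'n \<Rightarrow> real" and d :: "real \<Rightarrow> real \<Rightarrow> real" and T a Kg Kd :: real
  assumes T_pos: "0 < T"
    and g_lipschitz: "Kg-lipschitz_on UNIV g"
    and a_pos: "0 < a"
    and d_range: "\<And>t s. t \<in> {0..T} \<Longrightarrow> s \<in> {0..T} \<Longrightarrow> d t s \<in> {a<..1}"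
    and d_lipschitz: "Kd-lipschitz_on ({0..T} \<times> {0..T}) (\<lambda>(t, s). d t s)"
    and d_diag: "\<And>t. t \<in> {0..T} \<Longrightarrow> d t t = 1"
    and d_differentiable:
      "\<And>t s. 0 \<le> t \<Longrightarrow> t \<le> s \<Longrightarrow> s \<le> T \<Longrightarrow> (\<lambda>\<tau>. d \<tau> s) differentiable (at t within {0..s})"
    and d_summable: "\<And>t. t \<in> {0..T} \<Longrightarrow> set_integrable lebesgue {t..T} (partial_t d t)"
begin

definition u :: "real \<Rightarrow> real ^ 'n \<Rightarrow> real \<Rightarrow> real ^ 'n" where
  "u t p s = iota l ((1 / d t s) *\<^sub>R p)"

definition displacement :: "real \<Rightarrow> real ^ 'n \<Rightarrow> real ^ 'n" where
  "displacement t p = integral {t..T} (u t p)"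

abbreviation "v \<equiv> v_fun l g d T"

lemma Kg_nonneg: "0 \<le> Kg" using g_lipschitz lipschitz_on_nonneg by blast

lemma Kd_nonneg: "0 \<le> Kd" using d_lipschitz lipschitz_on_nonneg by blast

lemma g_diff_le: "\<bar>g x - g y\<bar> \<le> Kg * norm (x - y)"
  using lipschitz_onD[OF g_lipschitz, of x y] by (simp add: dist_norm)

lemma g_continuous: "continuous_on S g"
  using lipschitz_on_continuous_on[OF g_lipschitz] continuous_on_subset by blast

lemma d_bounds:
  assumes "t \<in> {0..T}" "s \<in> {0..T}"
  shows "a < d t s" "d t s \<le> 1" "0 < d t s"
  using d_range[OF assms] a_pos by auto

lemma d_diff_le:
  assumes "t \<in> {0..T}" "t' \<in> {0..T}" "s \<in> {0..T}"
  shows "\<bar>d t s - d t' s\<bar> \<le> Kd * \<bar>t - t'\<bar>"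
  using lipschitz_onD[OF d_lipschitz, of "(t, s)" "(t', s)"] assms
  by (simp add: dist_real_def dist_Pair_Pair)

lemma d_continuous:
  assumes "t \<in> {0..T}"
  shows "continuous_on {0..T} (d t)"
proof -
  have "continuous_on {0..T} (\<lambda>s. case (t, s) of (t, s) \<Rightarrow> d t s)"
    by (rule continuous_on_compose2[OF lipschitz_on_continuous_on[OF d_lipschitz]
      continuous_on_Pair[OF continuous_on_const continuous_on_id]]) (use assms in auto)
  then show ?thesis by simp
qed

lemma u_continuous_param:
  assumes "t \<in> {0..T}"
  shows "continuous_on (UNIV \<times> {0..T}) (\<lambda>(p, s). u t p s)"
proof -
  have "continuous_on (UNIV \<times> {0..T}) (\<lambda>z :: (real ^ 'n) \<times> real. (1 / d t (snd z)) *\<^sub>R fst z)"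
    using d_bounds(3)[OF assms]
    by (intro continuous_intros continuous_on_compose2[OF d_continuous[OF assms]]) (auto simp: less_imp_neq[symmetric])
  then show ?thesis
    unfolding u_def case_prod_unfold
    by (intro continuous_on_compose2[OF iota_continuous[of UNIV]]) auto
qed

lemma u_continuous:
  assumes "t \<in> {0..T}"
  shows "continuous_on {0..T} (u t p)"
proof -
  have "continuous_on {0..T} (\<lambda>s. case (p, s) of (p, s) \<Rightarrow> u t p s)"
    by (rule continuous_on_compose2[OF u_continuous_param[OF assms]
      continuous_on_Pair[OF continuous_on_const continuous_on_id]]) auto
  then show ?thesis by simp
qed

lemma u_continuous':
  assumes "t \<in> {0..T}" "0 \<le> t'"
  shows "continuous_on {t'..T} (u t p)"
  using continuous_on_subset[OF u_continuous[OF assms(1)]] assms(2) by auto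

lemma dl_continuous:
  assumes "t \<in> {0..T}" "0 \<le> t'" "continuous_on {t'..T} f"
  shows "continuous_on {t'..T} (\<lambda>s. d t s * l (f s))"
  using assms by (intro continuous_intros continuous_on_subset[OF d_continuous[OF assms(1)]]
    continuous_on_compose2[OF l_continuous[of UNIV]]) auto

lemma LINT_eq_integral:
  fixes f :: "real \<Rightarrow> 'b::euclidean_space"
  assumes "continuous_on {t..T} f"
  shows "(LINT s:{t..T}|lebesgue. f s) = integral {t..T} f"
  using set_lebesgue_integral_eq_integral(2)[OF absolutely_integrable_continuous_real[OF assms]] .

lemma p_cost_eq:
  assumes "t \<in> {0..T}"
  shows "p_cost l g d T x t p =
    integral {t..T} (\<lambda>s. d t s * l (u t p s)) + d t T * g (x + displacement t p)"
  unfolding p_cost_def displacement_def u_def[symmetric]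
  using assms by (simp add: LINT_eq_integral u_continuous' dl_continuous)

lemma p_cost_T: "p_cost l g d T x T p = g x"
  using T_pos p_cost_eq[of T x p] d_diag[of T] by (simp add: displacement_def)

lemma displacement_continuous:
  assumes "t \<in> {0..T}"
  shows "continuous_on UNIV (displacement t)"
proof -
  have "continuous_on (UNIV \<times> cbox t T) (\<lambda>(p, s). u t p s)"
    by (rule continuous_on_subset[OF u_continuous_param[OF assms]]) (use assms in auto)
  from integral_continuous_on_param[OF this]
  show ?thesis by (simp add: displacement_def[abs_def])
qed

lemma p_cost_continuous:
  assumes t: "t \<in> {0..T}"
  shows "continuous_on UNIV (p_cost l g d T x t)"
proof -
  have "continuous_on (UNIV \<times> cbox t T) (\<lambda>z. d t (snd z) * l (case z of (p, s) \<Rightarrow> u t p s))"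
    using t by (intro continuous_intros continuous_on_compose2[OF d_continuous[OF t]]
      continuous_on_compose2[OF l_continuous[of UNIV]] continuous_on_subset[OF u_continuous_param[OF t]]) auto
  then have "continuous_on (UNIV \<times> cbox t T) (\<lambda>(p, s). d t s * l (u t p s))"
    by (simp add: case_prod_unfold)
  from integral_continuous_on_param[OF this]
  show ?thesis
    unfolding p_cost_eq[OF t, abs_def]
    by (intro continuous_intros continuous_on_compose2[OF g_continuous[of UNIV]] displacement_continuous[OF t])
      auto
qed

text \<open>The coercivity of \<open>iota\<close> survives the integration over time: multiplying by
  \<open>d t s\<close> undoes the scaling of the momentum and can only shrink the constant
  \<open>C\<close>. For \<open>t = T\<close> every displacement is zero, which excludes that
  time.\<close>

lemma displacement_surj:
  assumes t: "t \<in> {0..<T}"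
  obtains p where "displacement t p = y"
proof -
  have t': "t \<in> {0..T}" using t by simp
  \<comment> \<open>Integrated over an interval of length \<open>T - t\<close>, this slope yields
    \<open>norm y * R\<close> plus \<open>(T - t) * R\<close>; with \<open>R = C + 1\<close> the
    second term exceeds the loss \<open>(T - t) * C\<close> by exactly \<open>T - t\<close>.\<close>
  define M where "M = norm y / (T - t) + 1"
  have M: "0 \<le> M" using t by (simp add: M_def)
  obtain C where C: "0 \<le> C" "\<And>q. M * norm q - C \<le> q \<bullet> iota l q"
    using iota_inner_lower_bound[OF M] by blast
  define R where "R = C + 1"
  have R: "0 < R" using C by (simp add: R_def)
  have "y \<bullet> p < displacement t p \<bullet> p" if p: "norm p = R" for p
  proof -
    have low: "M * R - C \<le> u t p s \<bullet> p" if s: "s \<in> {t..T}" for s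
    proof -
      have d: "0 < d t s" "d t s \<le> 1" using d_bounds[of t s] t s by auto
      let ?q = "(1 / d t s) *\<^sub>R p"
      have "M * R - C \<le> M * R - d t s * C" using d C by (simp add: mult_left_le_one_le)
      also have "\<dots> = d t s * (M * norm ?q - C)" using d p by (simp add: field_simps)
      also have "\<dots> \<le> d t s * (?q \<bullet> iota l ?q)" using mult_left_mono[OF C(2) less_imp_le[OF d(1)]] .
      also have "\<dots> = u t p s \<bullet> p" using d by (simp add: u_def inner_commute)
      finally show ?thesis .
    qed
    have int: "u t p integrable_on {t..T}"
      using t by (intro integrable_continuous_real u_continuous') auto
    have "y \<bullet> p \<le> norm y * R" using norm_cauchy_schwarz[of y p] p by simp
    also have "\<dots> < norm y * R + (T - t)" using t by simp
    also have "\<dots> = (T - t) * (M * R - C)" using t by (simp add: M_def R_def field_simps)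
    also have "\<dots> = integral {t..T} (\<lambda>_. M * R - C)" using t by simp
    also have "\<dots> \<le> integral {t..T} (\<lambda>s. u t p s \<bullet> p)"
    proof (rule integral_le)
      show "(\<lambda>s. u t p s \<bullet> p) integrable_on {t..T}"
        using t by (intro integrable_continuous_real continuous_intros u_continuous') auto
    qed (use low in auto)
    also have "\<dots> = displacement t p \<bullet> p"
      unfolding displacement_def
      using integral_linear[OF int bounded_linear_inner_left[of p]] by (simp add: o_def)
    finally show ?thesis .
  qed
  from coercive_surj[OF displacement_continuous[OF t'] R this] show thesis using that by blast
qed

lemma d_iota_tangent:
  assumes "t \<in> {0..T}" "s \<in> {0..T}"
  shows "d t s * l (u t p s) + p \<bullet> (w - u t p s) \<le> d t s * l w"
proof -
  have d: "0 < d t s" using d_bounds assms by auto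
  have "d t s * (l (u t p s) + ((1 / d t s) *\<^sub>R p) \<bullet> (w - u t p s)) \<le> d t s * l w"
    using mult_left_mono[OF iota_tangent less_imp_le[OF d]] unfolding u_def .
  then show ?thesis using d by (simp add: distrib_left)
qed

text \<open>Along \<open>u t p\<close> the momentum \<open>d\<^sub>t \<nabla>l\<close> is the constant \<open>p\<close>, so the first-order term of the
  convexity inequality integrates to zero against any velocity with the same displacement.\<close>

lemma u_optimal:
  assumes t: "t \<in> {0..T}" and f: "f integrable_on {t..T}" and disp: "displacement t p = integral {t..T} f"
  shows "((\<lambda>s. d t s * l (u t p s) + p \<bullet> (f s - u t p s)) has_integral
    integral {t..T} (\<lambda>s. d t s * l (u t p s))) {t..T}"
proof -
  have u: "(u t p has_integral displacement t p) {t..T}"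
    unfolding displacement_def using t by (intro integrable_integral integrable_continuous_real u_continuous') auto
  have dl: "((\<lambda>s. d t s * l (u t p s)) has_integral integral {t..T} (\<lambda>s. d t s * l (u t p s))) {t..T}"
    using t by (intro integrable_integral integrable_continuous_real dl_continuous u_continuous') auto
  have "((\<lambda>s. f s - u t p s) has_integral 0) {t..T}"
    using has_integral_diff[OF integrable_integral[OF f] u] disp by simp
  from has_integral_linear[OF this bounded_linear_inner_right[of p]]
  have "((\<lambda>s. p \<bullet> (f s - u t p s)) has_integral 0) {t..T}" by (simp add: o_def)
  from has_integral_add[OF dl this] show ?thesis by simp
qed

text \<open>The upper bound at \<open>p = 0\<close> and the lower bound for large \<open>p\<close> differ from \<open>d\<^sub>t(T) g(x)\<close> by multiples of \<open>T - t\<close>,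
  which is why \<open>R\<close> depends neither on \<open>x\<close> nor on \<open>t\<close>, even as \<open>t\<close> tends to \<open>T\<close>.\<close>

lemma minimizer_exists:
  obtains R where "0 < R"
    "\<And>x t. t \<in> {0..T} \<Longrightarrow> \<exists>p. norm p \<le> R \<and> (\<forall>q. p_cost l g d T x t p \<le> p_cost l g d T x t q)"
proof -
  \<comment> \<open>The discount can shrink this slope, but not below \<open>Kg + 1\<close>: the
    part \<open>Kg\<close> pays for the change of the terminal cost, and the remaining 1 beats the
    constants.\<close>
  obtain C where C: "0 \<le> C" "\<And>w. (Kg + 1) / a * norm w - C \<le> l w" using l_lower_bound by blast
  \<comment> \<open>This bounds, per unit of time, the cost of the competitor \<open>p = 0\<close>,
    which moves with the constant velocity \<open>iota l 0\<close>.\<close>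
  define C' where "C' = \<bar>l (iota l 0)\<bar> + Kg * norm (iota l 0)"
  obtain R where R: "0 < R" "\<And>q. norm (iota l q) \<le> C + C' \<Longrightarrow> norm q \<le> R" using iota_bounded_imp by blast
  have "\<exists>p. norm p \<le> R \<and> (\<forall>q. p_cost l g d T x t p \<le> p_cost l g d T x t q)" if t: "t \<in> {0..T}" for x t
  proof (cases "t = T")
    case True
    then show ?thesis using R(1) by (intro exI[of _ 0]) (simp add: p_cost_T)
  next
    case False
    then have tT: "t < T" using t by simp
    have dT: "0 < d t T" "d t T \<le> 1" using d_bounds[OF t, of T] T_pos by auto
    have "u t 0 = (\<lambda>s. iota l 0)" by (auto simp: u_def)
    then have "p_cost l g d T x t 0 = integral {t..T} (\<lambda>s. d t s * l (iota l 0)) + d t T * g (x + (T - t) *\<^sub>R iota l 0)"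
      using tT by (simp add: p_cost_eq[OF t] displacement_def)
    also have "\<dots> \<le> (T - t) * \<bar>l (iota l 0)\<bar> + (d t T * g x + (T - t) * (Kg * norm (iota l 0)))"
    proof (rule add_mono)
      have "integral {t..T} (\<lambda>s. d t s * l (iota l 0)) \<le> integral {t..T} (\<lambda>s. \<bar>l (iota l 0)\<bar>)"
      proof (rule integral_le)
        show "(\<lambda>s. d t s * l (iota l 0)) integrable_on {t..T}"
          using t by (intro integrable_continuous_real dl_continuous) auto
        fix s assume "s \<in> {t..T}"
        then have "0 < d t s" "d t s \<le> 1" using d_bounds[OF t, of s] t by auto
        then have "\<bar>d t s * l (iota l 0)\<bar> \<le> 1 * \<bar>l (iota l 0)\<bar>" unfolding abs_mult by (intro mult_right_mono) auto
        then show "d t s * l (iota l 0) \<le> \<bar>l (iota l 0)\<bar>" by linarith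
      qed auto
      then show "integral {t..T} (\<lambda>s. d t s * l (iota l 0)) \<le> (T - t) * \<bar>l (iota l 0)\<bar>" using tT by simp
      have "g (x + (T - t) *\<^sub>R iota l 0) - g x \<le> (T - t) * (Kg * norm (iota l 0))"
      proof -
        have "\<bar>g (x + (T - t) *\<^sub>R iota l 0) - g x\<bar> \<le> Kg * norm ((T - t) *\<^sub>R iota l 0)"
          using g_diff_le[of "x + (T - t) *\<^sub>R iota l 0" x] by (simp only: add_diff_cancel_left')
        also have "\<dots> = (T - t) * (Kg * norm (iota l 0))" using tT by simp
        finally show ?thesis by linarith
      qed
      then have "d t T * (g (x + (T - t) *\<^sub>R iota l 0) - g x) \<le> d t T * ((T - t) * (Kg * norm (iota l 0)))"
        using dT by (intro mult_left_mono) auto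
      also have "\<dots> \<le> 1 * ((T - t) * (Kg * norm (iota l 0)))"
        using dT tT Kg_nonneg by (intro mult_right_mono) auto
      finally show "d t T * g (x + (T - t) *\<^sub>R iota l 0) \<le> d t T * g x + (T - t) * (Kg * norm (iota l 0))"
        by (simp add: right_diff_distrib)
    qed
    finally have up: "p_cost l g d T x t 0 \<le> d t T * g x + (T - t) * C'" by (simp add: C'_def algebra_simps)
    have lo: "d t T * g x + (T - t) * C' \<le> p_cost l g d T x t q" if q: "R < norm q" for q
    proof -
      have uint: "u t q integrable_on {t..T}" "(\<lambda>s. norm (u t q s)) integrable_on {t..T}"
        using t by (intro integrable_continuous_real continuous_intros u_continuous'; simp)+
      have dlint: "(\<lambda>s. d t s * l (u t q s)) integrable_on {t..T}"
        using t by (intro integrable_continuous_real dl_continuous u_continuous') auto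
      have pt: "C' + Kg * norm (u t q s) \<le> d t s * l (u t q s)" if s: "s \<in> {t..T}" for s
      proof -
        have ds: "a < d t s" "d t s \<le> 1" "0 < d t s" using d_bounds[OF t, of s] t s by auto
        \<comment> \<open>Since \<open>d t s\<close> is at most 1, the rescaled momentum is also
          outside the ball of radius \<open>R\<close>, so the velocity is large at every
          time.\<close>
        have "norm q \<le> norm ((1 / d t s) *\<^sub>R q)" using ds by (simp add: field_simps mult_left_le)
        then have big: "C + C' < norm (u t q s)" using R(2)[of "(1 / d t s) *\<^sub>R q"] q unfolding u_def by linarith
        have "(Kg + 1) * norm (u t q s) = a * ((Kg + 1) / a * norm (u t q s))" using a_pos by simp
        also have "\<dots> \<le> d t s * ((Kg + 1) / a * norm (u t q s))"
          using ds a_pos Kg_nonneg by (intro mult_right_mono) auto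
        finally have 1: "(Kg + 1) * norm (u t q s) \<le> d t s * ((Kg + 1) / a * norm (u t q s))" .
        have 2: "d t s * C \<le> C" using ds C by (simp add: mult_left_le_one_le)
        have "d t s * ((Kg + 1) / a * norm (u t q s) - C) \<le> d t s * l (u t q s)"
          using ds C(2) by (intro mult_left_mono) auto
        then have "(Kg + 1) * norm (u t q s) - C \<le> d t s * l (u t q s)"
          using 1 2 by (simp add: right_diff_distrib)
        then show ?thesis using big by (simp add: distrib_right)
      qed
      have "(T - t) * C' + Kg * integral {t..T} (\<lambda>s. norm (u t q s)) = integral {t..T} (\<lambda>s. C' + Kg * norm (u t q s))"
        using tT uint by (subst integral_add) (auto intro: integrable_on_mult_right)
      also have "\<dots> \<le> integral {t..T} (\<lambda>s. d t s * l (u t q s))"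
        using pt uint dlint by (intro integral_le integrable_add integrable_on_mult_right) auto
      finally have 1: "(T - t) * C' + Kg * integral {t..T} (\<lambda>s. norm (u t q s)) \<le> integral {t..T} (\<lambda>s. d t s * l (u t q s))" .
      have "norm (displacement t q) \<le> integral {t..T} (\<lambda>s. norm (u t q s))"
        unfolding displacement_def using uint by (intro integral_norm_bound_integral) auto
      then have "Kg * norm (displacement t q) \<le> Kg * integral {t..T} (\<lambda>s. norm (u t q s))"
        using Kg_nonneg by (intro mult_left_mono)
      moreover have "g x - Kg * norm (displacement t q) \<le> g (x + displacement t q)"
        using g_diff_le[of x "x + displacement t q"] by simp
      then have "d t T * (g x - Kg * norm (displacement t q)) \<le> d t T * g (x + displacement t q)"
        using dT by (intro mult_left_mono) auto
      moreover have "d t T * (Kg * norm (displacement t q)) \<le> 1 * (Kg * norm (displacement t q))"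
        using dT Kg_nonneg by (intro mult_right_mono) auto
      ultimately show ?thesis using 1 by (simp add: p_cost_eq[OF t] right_diff_distrib)
    qed
    obtain p where p: "p \<in> cball 0 R" "\<And>q. q \<in> cball 0 R \<Longrightarrow> p_cost l g d T x t p \<le> p_cost l g d T x t q"
      using continuous_attains_inf[of "cball 0 R" "p_cost l g d T x t"] R(1)
        continuous_on_subset[OF p_cost_continuous[OF t]] by auto
    have "p_cost l g d T x t p \<le> p_cost l g d T x t q" for q
    proof (cases "norm q \<le> R")
      case True then show ?thesis using p(2) by simp
    next
      case False
      then show ?thesis using p(2)[of 0] R(1) up lo[of q] by simp
    qed
    then show ?thesis using p(1) by auto
  qed
  with R(1) show thesis using that by blast
qed

lemma v_eq_p_cost:
  assumes "\<And>q. p_cost l g d T x t p \<le> p_cost l g d T x t q"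
  shows "v x t = p_cost l g d T x t p"
  unfolding v_fun_def by (rule cInf_eq_minimum) (use assms in auto)

lemma v_le_p_cost:
  assumes "t \<in> {0..T}"
  shows "v x t \<le> p_cost l g d T x t q"
  using minimizer_exists v_eq_p_cost assms by metis

text \<open>A continuous velocity is no better than the \<open>u t p\<close> with the same
  displacement. This admits competitors with non-constant momentum, such as velocities that are
  optimal for a different initial time.\<close>

lemma v_le_cost:
  assumes t: "t \<in> {0..T}" and f: "continuous_on {t..T} f"
  shows "v x t \<le> integral {t..T} (\<lambda>s. d t s * l (f s)) + d t T * g (x + integral {t..T} f)"
proof (cases "t = T")
  case True
  then show ?thesis using v_le_p_cost[OF t, of x 0] d_diag[OF t] by (simp add: p_cost_T)
next
  case False
  then have "t \<in> {0..<T}" using t by auto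
  then obtain p where p: "displacement t p = integral {t..T} f" using displacement_surj by blast
  have fi: "f integrable_on {t..T}" using f by (rule integrable_continuous_real)
  have "integral {t..T} (\<lambda>s. d t s * l (u t p s)) \<le> integral {t..T} (\<lambda>s. d t s * l (f s))"
  proof (rule has_integral_le[OF u_optimal[OF t fi p] integrable_integral])
    show "(\<lambda>s. d t s * l (f s)) integrable_on {t..T}"
      using t f by (intro integrable_continuous_real dl_continuous) auto
  qed (use t d_iota_tangent in auto)
  then show ?thesis using v_le_p_cost[OF t, of x p] by (simp add: p_cost_eq[OF t] p)
qed

lemma v_T: "v x T = g x"
  using v_eq_p_cost[of x T 0] by (simp add: p_cost_T)

end

section \<open>The value function\<close>

lemma ext_integral_integrable:
  assumes "integrable M f"
  shows "ext_integral M f = ereal (integral\<^sup>L M f)"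
proof -
  have fin: "(\<integral>\<^sup>+x. ennreal (f x) \<partial>M) \<noteq> \<infinity>" "(\<integral>\<^sup>+x. ennreal (- f x) \<partial>M) \<noteq> \<infinity>"
    using assms by (auto simp: real_integrable_def)
  have "enn2ereal X = ereal (enn2real X)" if "X \<noteq> \<infinity>" for X
    using that by (cases X rule: ennreal_cases) (auto simp: enn2ereal_ennreal)
  then show ?thesis
    using fin unfolding ext_integral_def real_lebesgue_integral_def[OF assms] by simp
qed

lemma ext_integral_cong:
  assumes "\<And>x. x \<in> space M \<Longrightarrow> f x = h x"
  shows "ext_integral M f = ext_integral M h"
  unfolding ext_integral_def using assms by (simp cong: nn_integral_cong)

lemma ext_integral_null:
  assumes "emeasure M (space M) = 0"
  shows "ext_integral M f = 0"
proof -
  have "(\<integral>\<^sup>+x. h x \<partial>M) = 0" for h :: "_ \<Rightarrow> ennreal"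
  proof -
    have "AE x in M. h x = 0"
      using assms by (intro AE_I[of _ _ "space M"]) auto
    then have "(\<integral>\<^sup>+x. h x \<partial>M) = (\<integral>\<^sup>+x. 0 \<partial>M)" by (rule nn_integral_cong_AE)
    then show ?thesis by simp
  qed
  then show ?thesis by (simp add: ext_integral_def zero_ennreal.rep_eq)
qed

text \<open>The lower bound makes the negative part finite. Either the positive part is infinite and
  nothing is left to prove, or \<open>f\<close> is integrable and the comparison is one of gauge
  integrals, the sense in which the derivative of a curve has been integrated.\<close>

lemma ext_integral_ge:
  fixes f k :: "real \<Rightarrow> real"
  assumes f: "f \<in> borel_measurable (lebesgue_on {b..c})" and low: "\<And>s. s \<in> {b..c} \<Longrightarrow> - m \<le> f s"
    and k: "(k has_integral I) {b..c}" and le: "\<And>s. s \<in> {b..c} \<Longrightarrow> k s \<le> f s"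
  shows "ereal I \<le> ext_integral (lebesgue_on {b..c}) f"
proof -
  let ?M = "lebesgue_on {b..c}"
  have "(\<integral>\<^sup>+s. ennreal (- f s) \<partial>?M) \<le> (\<integral>\<^sup>+s. ennreal \<bar>m\<bar> \<partial>?M)"
    using low by (intro nn_integral_mono ennreal_leI) fastforce
  also have "\<dots> < \<infinity>" by (simp add: emeasure_restrict_space ennreal_mult_less_top emeasure_lborel_Icc_eq)
  finally have neg: "(\<integral>\<^sup>+s. ennreal (- f s) \<partial>?M) < \<infinity>" .
  show ?thesis
  proof (cases "(\<integral>\<^sup>+s. ennreal (f s) \<partial>?M) = \<infinity>")
    case True
    then show ?thesis using neg
      by (cases "\<integral>\<^sup>+s. ennreal (- f s) \<partial>?M" rule: ennreal_cases)
        (auto simp: ext_integral_def enn2ereal_ennreal)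
  next
    case False
    then have int: "integrable ?M f" using f neg by (simp add: real_integrable_def)
    have "(f has_integral integral {b..c} f) {b..c}"
      using int by (intro integrable_integral integrable_on_lebesgue_on) auto
    then have "I \<le> integral {b..c} f" using le by (intro has_integral_le[OF k])
    also have "\<dots> = integral\<^sup>L ?M f" using int by (intro lebesgue_integral_eq_integral[symmetric]) auto
    finally show ?thesis by (simp add: ext_integral_integrable[OF int])
  qed
qed

lemma continuous_on_Icc_bound:
  fixes f :: "real \<Rightarrow> 'a::real_normed_vector"
  assumes "continuous_on {b..c} f"
  obtains B where "\<And>s. s \<in> {b..c} \<Longrightarrow> norm (f s) \<le> B"
proof -
  have "bounded (f ` {b..c})"
    using assms by (intro compact_imp_bounded compact_continuous_image compact_Icc)
  then obtain B where "\<forall>y\<in>f ` {b..c}. norm y \<le> B" unfolding bounded_iff by blast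
  then show thesis using that[of B] by blast
qed

lemma integral_tail_diff:
  fixes f :: "real \<Rightarrow> 'a::banach"
  assumes f: "continuous_on {b..c} f" and B: "\<And>s. s \<in> {b..c} \<Longrightarrow> norm (f s) \<le> B"
    and t: "t \<in> {b..c}" "t' \<in> {b..c}"
  shows "norm (integral {t'..c} f - integral {t..c} f) \<le> B * \<bar>t' - t\<bar>"
proof -
  have *: "norm (integral {t'..c} f - integral {t..c} f) \<le> B * (t - t')"
    if "t' \<le> t" "t \<in> {b..c}" "t' \<in> {b..c}" for t t'
  proof -
    have "f integrable_on {t'..c}"
      using that by (intro integrable_continuous_real continuous_on_subset[OF f]) auto
    then have "integral {t'..t} f + integral {t..c} f = integral {t'..c} f"
      using that by (intro Henstock_Kurzweil_Integration.integral_combine) auto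
    then have "integral {t'..c} f - integral {t..c} f = integral {t'..t} f" by (simp add: algebra_simps)
    moreover have "norm (integral {t'..t} f) \<le> B * (t - t')"
      using that by (intro integral_bound continuous_on_subset[OF f] B) auto
    ultimately show ?thesis by simp
  qed
  show ?thesis
  proof (cases "t' \<le> t")
    case True
    with *[OF this] t show ?thesis by simp
  next
    case False
    with *[of t t'] t show ?thesis by (simp add: norm_minus_commute)
  qed
qed

context discounted
begin

lemma optimal_curve_AC:
  fixes x p :: "real ^ 'n"
  assumes t: "t \<in> {0..T}"
  defines "y \<equiv> \<lambda>s. x + integral {t..s} (u t p)"
  shows "y \<in> AC T x t" "\<And>s. s \<in> {t..T} \<Longrightarrow> (y has_vector_derivative u t p s) (at s within {t..T})"
proof -
  have cu: "continuous_on {t..T} (u t p)" using t by (intro u_continuous') auto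
  show der: "(y has_vector_derivative u t p s) (at s within {t..T})" if "s \<in> {t..T}" for s
    unfolding y_def using integral_has_vector_derivative[OF cu that]
    by (auto intro!: derivative_eq_intros)
  obtain B where B: "\<And>s. s \<in> {t..T} \<Longrightarrow> norm (u t p s) \<le> B"
    using continuous_on_Icc_bound[OF cu] by blast
  have "0 \<le> B" using B[of t] t by (meson atLeastAtMost_iff norm_ge_zero order_refl order_trans)
  have "B-lipschitz_on {t..T} y"
  proof (rule bounded_derivative_imp_lipschitz)
    show "(y has_derivative (\<lambda>h. h *\<^sub>R u t p s)) (at s within {t..T})" if "s \<in> {t..T}" for s
      using der[OF that] by (simp add: has_vector_derivative_def)
    show "onorm (\<lambda>h. h *\<^sub>R u t p s) \<le> B" if "s \<in> {t..T}" for s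
    proof (rule onorm_bound[OF \<open>0 \<le> B\<close>])
      fix h :: real
      show "norm (h *\<^sub>R u t p s) \<le> B * norm h"
        using mult_left_mono[OF B[OF that] abs_ge_zero[of h]] by (simp add: mult.commute)
    qed
  qed (use \<open>0 \<le> B\<close> in auto)
  then have "abs_cont_on t T y" by (rule lipschitz_abs_cont_on)
  then show "y \<in> AC T x t" by (simp add: AC_def y_def)
qed

lemma value_fun_T: "value_fun l g d T x T = ereal (g x)"
proof -
  have "emeasure (lebesgue_on {T..T}) (space (lebesgue_on {T..T})) = 0"
    by (simp add: emeasure_restrict_space)
  \<comment> \<open>Over a single point \<open>vector_derivative\<close> has no meaningful value,
    but the point is a null set and the running cost vanishes in any case.\<close>
  note null = ext_integral_null[OF this, unfolded atLeastAtMost_singleton]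
  have ne: "AC T x T \<noteq> {}" using optimal_curve_AC(1)[of T] T_pos by auto
  have "value_fun l g d T x T = (INF y\<in>AC T x T. ereal (g x))"
    unfolding value_fun_def using T_pos d_diag[of T]
    by (intro INF_cong) (auto simp: null AC_def)
  also have "\<dots> = ereal (g x)" using ne by (rule INF_const)
  finally show ?thesis .
qed

lemma value_fun_eq:
  assumes t: "t \<in> {0..T}"
  shows "value_fun l g d T x t = ereal (v x t)"
proof (cases "t = T")
  case True
  then show ?thesis by (simp add: value_fun_T v_T)
next
  case False
  then have tT: "t < T" "t \<in> {0..<T}" using t by auto
  let ?M = "lebesgue_on {t..T}"
  let ?L = "\<lambda>y s. d t s * l (vector_derivative y (at s within {t..T}))"
  show ?thesis
  proof (rule antisym)
    obtain p where p: "\<And>q. p_cost l g d T x t p \<le> p_cost l g d T x t q"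
      using minimizer_exists t by metis
    define y where "y = (\<lambda>s. x + integral {t..s} (u t p))"
    have y: "y \<in> AC T x t" "\<And>s. s \<in> {t..T} \<Longrightarrow> (y has_vector_derivative u t p s) (at s within {t..T})"
      unfolding y_def using optimal_curve_AC[OF t] by auto
    have c: "continuous_on {t..T} (\<lambda>s. d t s * l (u t p s))"
      using t by (intro dl_continuous u_continuous') auto
    have "ext_integral ?M (?L y) = ext_integral ?M (\<lambda>s. d t s * l (u t p s))"
    proof (rule ext_integral_cong)
      fix s assume "s \<in> space ?M"
      then have s: "s \<in> {t..T}" by simp
      show "?L y s = d t s * l (u t p s)"
        unfolding vector_derivative_within_closed_interval[OF tT(1) s y(2)[OF s]] ..
    qed
    also have "\<dots> = ereal (integral {t..T} (\<lambda>s. d t s * l (u t p s)))"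
      by (simp add: ext_integral_integrable[OF continuous_imp_integrable_real[OF c]]
        lebesgue_integral_eq_integral[OF continuous_imp_integrable_real[OF c]])
    finally have "ext_integral ?M (?L y) + ereal (d t T * g (y T)) = ereal (v x t)"
      by (simp add: v_eq_p_cost[OF p] p_cost_eq[OF t] displacement_def y_def)
    moreover have "value_fun l g d T x t \<le> ext_integral ?M (?L y) + ereal (d t T * g (y T))"
      unfolding value_fun_def by (rule INF_lower[OF y(1)])
    ultimately show "value_fun l g d T x t \<le> ereal (v x t)" by (simp only:)
    show "ereal (v x t) \<le> value_fun l g d T x t"
      unfolding value_fun_def
    proof (rule INF_greatest)
      fix y assume y: "y \<in> AC T x t"
      let ?y' = "\<lambda>s. vector_derivative y (at s within {t..T})"
      have y': "(?y' has_integral y T - x) {t..T}"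
        using abs_cont_on_has_integral_derivative[of t T y] y tT by (simp add: AC_def)
      then have int: "?y' integrable_on {t..T}" by blast
      \<comment> \<open>With this \<open>p\<close> the comparison curve ends at \<open>y T\<close>
        as well, so the terminal costs agree.\<close>
      obtain p where p: "displacement t p = y T - x" using displacement_surj[OF tT(2)] by blast
      have p': "displacement t p = integral {t..T} ?y'" using p y' by (simp add: integral_unique)
      have yT: "x + displacement t p = y T" by (simp add: p)
      obtain C where C: "0 \<le> C" "\<And>w. 0 * norm w - C \<le> l w" using l_lower_bound by blast
      have "ereal (integral {t..T} (\<lambda>s. d t s * l (u t p s))) \<le> ext_integral ?M (?L y)"
      proof (rule ext_integral_ge[OF _ _ u_optimal[OF t int p']])
        have m1: "?y' \<in> borel_measurable ?M" by (rule integrable_imp_measurable[OF int])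
        have m2: "d t \<in> borel_measurable ?M"
          using t by (intro continuous_imp_measurable_on_sets_lebesgue continuous_on_subset[OF d_continuous[OF t]]) auto
        have "l \<in> borel_measurable borel" by (intro borel_measurable_continuous_onI l_continuous)
        from measurable_compose[OF m1 this] m2 show "?L y \<in> borel_measurable ?M" by simp
        fix s assume s: "s \<in> {t..T}"
        then have ds: "0 < d t s" "d t s \<le> 1" using d_bounds[OF t, of s] t by auto
        show "d t s * l (u t p s) + p \<bullet> (?y' s - u t p s) \<le> ?L y s"
          using t s by (intro d_iota_tangent) auto
        have "d t s * C \<le> C" using ds C by (simp add: mult_left_le_one_le)
        moreover have "d t s * (- C) \<le> ?L y s" using ds C(2) by (intro mult_left_mono) auto
        ultimately show "- C \<le> ?L y s" by simp
      qed
      then have le: "ereal (integral {t..T} (\<lambda>s. d t s * l (u t p s))) + ereal (d t T * g (y T))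
        \<le> ext_integral ?M (?L y) + ereal (d t T * g (y T))"
        by (rule add_right_mono)
      have "v x t \<le> integral {t..T} (\<lambda>s. d t s * l (u t p s)) + d t T * g (y T)"
        using v_le_p_cost[OF t, of x p] by (simp add: p_cost_eq[OF t] yT)
      then show "ereal (v x t) \<le> ext_integral ?M (?L y) + ereal (d t T * g (y T))"
        by (intro order_trans[OF _ le]) simp
    qed
  qed
qed

section \<open>Lipschitz estimates in space and time\<close>

lemma v_lipschitz_space:
  assumes t: "t \<in> {0..T}"
  shows "\<bar>v x t - v x' t\<bar> \<le> Kg * norm (x - x')"
proof -
  \<comment> \<open>The momentum that is optimal at \<open>x'\<close> is used unchanged at
    \<open>x\<close>: the running cost stays the same and the end point is translated.\<close>
  have *: "v x t \<le> v x' t + Kg * norm (x - x')" for x x'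
  proof -
    obtain p where p: "\<And>q. p_cost l g d T x' t p \<le> p_cost l g d T x' t q"
      using minimizer_exists t by metis
    have dT: "0 < d t T" "d t T \<le> 1" using d_bounds[OF t, of T] T_pos by auto
    have "g (x + displacement t p) - g (x' + displacement t p) \<le> Kg * norm (x - x')"
      using g_diff_le[of "x + displacement t p" "x' + displacement t p"] by simp
    then have "d t T * (g (x + displacement t p) - g (x' + displacement t p)) \<le> d t T * (Kg * norm (x - x'))"
      using dT by (intro mult_left_mono) auto
    also have "\<dots> \<le> 1 * (Kg * norm (x - x'))" using dT Kg_nonneg by (intro mult_right_mono) auto
    finally have "p_cost l g d T x t p \<le> p_cost l g d T x' t p + Kg * norm (x - x')"
      by (simp add: p_cost_eq[OF t] right_diff_distrib)
    then show ?thesis using v_le_p_cost[OF t, of x p] v_eq_p_cost[OF p] by simp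
  qed
  show ?thesis using *[of x x'] *[of x' x] by (simp add: norm_minus_commute)
qed

lemma iota_l_bounded:
  assumes "0 \<le> R"
  obtains M B where "0 \<le> M" "0 \<le> B"
    "\<And>t p s. t \<in> {0..T} \<Longrightarrow> s \<in> {0..T} \<Longrightarrow> norm p \<le> R \<Longrightarrow> norm (u t p s) \<le> M \<and> \<bar>l (u t p s)\<bar> \<le> B"
proof -
  have "compact (iota l ` cball 0 (R / a))"
    by (intro compact_continuous_image iota_continuous compact_cball)
  from compact_imp_bounded[OF this]
  obtain M where M: "\<And>q. q \<in> cball 0 (R / a) \<Longrightarrow> norm (iota l q) \<le> M"
    unfolding bounded_iff by blast
  have "compact (l ` iota l ` cball 0 (R / a))"
    by (intro compact_continuous_image iota_continuous l_continuous compact_cball)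
  from compact_imp_bounded[OF this]
  obtain B where B: "\<And>q. q \<in> cball 0 (R / a) \<Longrightarrow> \<bar>l (iota l q)\<bar> \<le> B"
    unfolding bounded_iff real_norm_def by blast
  note MB = M B
  have z: "(0::real ^ 'n) \<in> cball 0 (R / a)" using assms a_pos by simp
  show thesis
  proof (rule that[of M B])
    show "0 \<le> M" by (rule order_trans[OF norm_ge_zero MB(1)[OF z]])
    show "0 \<le> B" by (rule order_trans[OF abs_ge_zero MB(2)[OF z]])
    fix t p s assume ts: "t \<in> {0..T}" "s \<in> {0..T}" and p: "norm (p :: real ^ 'n) \<le> R"
    have d: "a < d t s" "0 < d t s" using d_bounds[OF ts] by auto
    have "norm ((1 / d t s) *\<^sub>R p) = norm p / d t s" using d by simp
    also have "\<dots> \<le> R / a" using p d a_pos assms by (intro frac_le) auto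
    finally have "(1 / d t s) *\<^sub>R p \<in> cball 0 (R / a)" by simp
    then show "norm (u t p s) \<le> M \<and> \<bar>l (u t p s)\<bar> \<le> B" using MB unfolding u_def by blast
  qed
qed

lemma integral_discount_diff:
  assumes t: "t \<in> {0..T}" "t' \<in> {0..T}" "t0 \<in> {0..T}"
    and f: "continuous_on {0..T} f" and B: "\<And>s. s \<in> {0..T} \<Longrightarrow> \<bar>f s\<bar> \<le> B"
  shows "\<bar>integral {t0..T} (\<lambda>s. d t' s * f s) - integral {t0..T} (\<lambda>s. d t s * f s)\<bar> \<le> T * (Kd * \<bar>t' - t\<bar> * B)"
proof -
  have c: "continuous_on {t0..T} (\<lambda>s. d \<tau> s * f s)" if "\<tau> \<in> {0..T}" for \<tau>
    using t(3) by (intro continuous_intros continuous_on_subset[OF d_continuous[OF that]] continuous_on_subset[OF f]) auto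
  have B0: "0 \<le> B" using B[of 0] T_pos by (auto intro: order_trans[OF abs_ge_zero])
  have "integral {t0..T} (\<lambda>s. d t' s * f s) - integral {t0..T} (\<lambda>s. d t s * f s)
    = integral {t0..T} (\<lambda>s. d t' s * f s - d t s * f s)"
    using c t by (intro integral_diff[symmetric] integrable_continuous_real) auto
  moreover have "norm \<dots> \<le> (Kd * \<bar>t' - t\<bar> * B) * (T - t0)"
  proof (rule integral_bound)
    fix s assume s: "s \<in> {t0..T}"
    then have s': "s \<in> {0..T}" using t by auto
    have "norm (d t' s * f s - d t s * f s) = \<bar>d t' s - d t s\<bar> * \<bar>f s\<bar>"
      by (simp add: left_diff_distrib[symmetric] abs_mult)
    also have "\<dots> \<le> (Kd * \<bar>t' - t\<bar>) * B"
      using d_diff_le[OF t(2,1) s'] B[OF s'] Kd_nonneg by (intro mult_mono) auto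
    finally show "norm (d t' s * f s - d t s * f s) \<le> Kd * \<bar>t' - t\<bar> * B" .
  next
    show "continuous_on {t0..T} (\<lambda>s. d t' s * f s - d t s * f s)"
      by (intro continuous_on_diff c t)
  qed (use t in auto)
  moreover have "(Kd * \<bar>t' - t\<bar> * B) * (T - t0) \<le> (Kd * \<bar>t' - t\<bar> * B) * T"
    using B0 Kd_nonneg t by (intro mult_left_mono) auto
  ultimately show ?thesis by (simp add: mult.commute)
qed

text \<open>The velocity that is optimal for \<open>t\<close> is a continuous function on all of
  \<open>{0..T}\<close>, so it can be started at any \<open>t'\<close>, also at an earlier one,
  where it merely serves as a competitor. The uniform radius of the minimisers makes all constants
  independent of \<open>t\<close>.\<close>

lemma v_lipschitz_time:
  obtains L where "0 \<le> L"
    "\<And>x t t'. norm x \<le> \<rho> \<Longrightarrow> t \<in> {0..T} \<Longrightarrow> t' \<in> {0..T} \<Longrightarrow> \<bar>v x t - v x t'\<bar> \<le> L * \<bar>t - t'\<bar>"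
proof -
  obtain R where R: "0 < R"
    "\<And>x t. t \<in> {0..T} \<Longrightarrow> \<exists>p. norm p \<le> R \<and> (\<forall>q. p_cost l g d T x t p \<le> p_cost l g d T x t q)"
    using minimizer_exists by blast
  obtain M B where MB: "0 \<le> M" "0 \<le> B"
    "\<And>t p s. t \<in> {0..T} \<Longrightarrow> s \<in> {0..T} \<Longrightarrow> norm p \<le> R \<Longrightarrow> norm (u t p s) \<le> M \<and> \<bar>l (u t p s)\<bar> \<le> B"
    using iota_l_bounded[OF less_imp_le[OF R(1)]] by metis
  define G where "G = \<bar>g 0\<bar> + Kg * (\<bar>\<rho>\<bar> + M * T)"
  have G0: "0 \<le> G" using Kg_nonneg MB(1) T_pos by (simp add: G_def)
  \<comment> \<open>The terms stand for the changed discount in the running cost, the changed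
    interval of integration, the changed terminal discount and the moved end point; only
    \<open>G\<close> depends on \<open>\<rho>\<close>.\<close>
  define L where "L = T * (Kd * B) + B + Kd * G + Kg * M"
  have one: "v x t' \<le> v x t + L * \<bar>t' - t\<bar>" if x: "norm x \<le> \<rho>" and t: "t \<in> {0..T}" and t': "t' \<in> {0..T}" for x t t'
  proof -
    obtain p where p: "norm p \<le> R" "\<And>q. p_cost l g d T x t p \<le> p_cost l g d T x t q"
      using R(2)[OF t] by blast
    note b = MB(3)[OF t _ p(1)]
    have cu: "continuous_on {0..T} (u t p)" by (rule u_continuous[OF t])
    have clu: "continuous_on {0..T} (\<lambda>s. l (u t p s))"
      by (intro continuous_on_compose2[OF l_continuous[of UNIV]] cu) auto
    let ?I = "\<lambda>t1 t2. integral {t1..T} (\<lambda>s. d t2 s * l (u t p s))" and ?W = "\<lambda>t1. integral {t1..T} (u t p)"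
    have I1: "\<bar>?I t' t' - ?I t' t\<bar> \<le> T * (Kd * \<bar>t' - t\<bar> * B)"
      using b by (intro integral_discount_diff[OF t t' t' clu]) auto
    have I2: "norm (?I t' t - ?I t t) \<le> B * \<bar>t' - t\<bar>"
    proof (rule integral_tail_diff[OF _ _ t t'])
      show "continuous_on {0..T} (\<lambda>s. d t s * l (u t p s))" by (intro continuous_intros d_continuous[OF t] clu)
      fix s assume s: "s \<in> {0..T}"
      have "\<bar>d t s\<bar> * \<bar>l (u t p s)\<bar> \<le> 1 * B"
        using d_bounds[OF t s] b[OF s] by (intro mult_mono) auto
      then show "norm (d t s * l (u t p s)) \<le> B" by (simp add: abs_mult)
    qed
    have W: "norm (?W t' - ?W t) \<le> M * \<bar>t' - t\<bar>"
      using b by (intro integral_tail_diff[OF cu _ t t']) auto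
    have W': "norm (?W t') \<le> M * T"
    proof -
      have "norm (?W t') \<le> M * (T - t')"
        using t' b by (intro integral_bound continuous_on_subset[OF cu]) auto
      also have "\<dots> \<le> M * T" using t' MB(1) by (intro mult_left_mono) auto
      finally show ?thesis .
    qed
    have gb: "\<bar>g (x + ?W t')\<bar> \<le> G"
    proof -
      have "\<bar>g (x + ?W t') - g 0\<bar> \<le> Kg * norm (x + ?W t')" using g_diff_le[of "x + ?W t'" 0] by simp
      also have "\<dots> \<le> Kg * (\<bar>\<rho>\<bar> + M * T)"
        using W' x Kg_nonneg norm_triangle_ineq[of x "?W t'"] by (intro mult_left_mono) auto
      finally show ?thesis by (simp add: G_def)
    qed
    have TT: "T \<in> {0..T}" using T_pos by simp
    have g1: "(d t' T - d t T) * g (x + ?W t') \<le> Kd * \<bar>t' - t\<bar> * G"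
    proof -
      have "\<bar>(d t' T - d t T) * g (x + ?W t')\<bar> \<le> Kd * \<bar>t' - t\<bar> * G"
        unfolding abs_mult using d_diff_le[OF t' t TT] gb Kd_nonneg by (intro mult_mono) auto
      then show ?thesis by linarith
    qed
    have g2: "d t T * (g (x + ?W t') - g (x + ?W t)) \<le> Kg * (M * \<bar>t' - t\<bar>)"
    proof -
      have "\<bar>g (x + ?W t') - g (x + ?W t)\<bar> \<le> Kg * norm (?W t' - ?W t)"
        using g_diff_le[of "x + ?W t'" "x + ?W t"] by simp
      also have "\<dots> \<le> Kg * (M * \<bar>t' - t\<bar>)" using W Kg_nonneg by (intro mult_left_mono)
      finally have "\<bar>d t T\<bar> * \<bar>g (x + ?W t') - g (x + ?W t)\<bar> \<le> 1 * (Kg * (M * \<bar>t' - t\<bar>))"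
        using d_bounds[OF t TT] by (intro mult_mono) auto
      then show ?thesis unfolding abs_mult[symmetric] by linarith
    qed
    have "v x t' \<le> ?I t' t' + d t' T * g (x + ?W t')"
      using t' by (intro v_le_cost continuous_on_subset[OF cu]) auto
    also have "\<dots> = ?I t' t' + d t T * g (x + ?W t) + (d t' T - d t T) * g (x + ?W t') + d t T * (g (x + ?W t') - g (x + ?W t))"
      by (simp add: algebra_simps)
    also have "\<dots> \<le> ?I t t + T * (Kd * \<bar>t' - t\<bar> * B) + B * \<bar>t' - t\<bar> + d t T * g (x + ?W t) + Kd * \<bar>t' - t\<bar> * G + Kg * (M * \<bar>t' - t\<bar>)"
      using I1 I2 g1 g2 by (simp only: real_norm_def) linarith
    also have "\<dots> = v x t + L * \<bar>t' - t\<bar>"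
    proof -
      have "v x t = ?I t t + d t T * g (x + ?W t)"
        using v_eq_p_cost[OF p(2)] p_cost_eq[OF t] unfolding displacement_def by metis
      then show ?thesis by (simp add: L_def algebra_simps)
    qed
    finally show ?thesis .
  qed
  show thesis
  proof (rule that[of L])
    show "0 \<le> L" using Kd_nonneg Kg_nonneg MB T_pos G0 by (simp add: L_def)
    fix x :: "real ^ 'n" and t t' assume "norm x \<le> \<rho>" "t \<in> {0..T}" "t' \<in> {0..T}"
    then show "\<bar>v x t - v x t'\<bar> \<le> L * \<bar>t - t'\<bar>"
      using one[of x t t'] one[of x t' t] by (simp add: abs_minus_commute abs_le_iff)
  qed
qed

lemma v_locally_lipschitz:
  assumes "I \<subseteq> {0..T}"
  shows "locally_lipschitz_on (UNIV \<times> I) (\<lambda>(x, t). v x t)"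
  unfolding locally_lipschitz_on_def
proof
  fix z :: "(real ^ 'n) \<times> real" assume "z \<in> UNIV \<times> I"
  obtain L where L: "0 \<le> L" "\<And>x t t'. norm x \<le> norm (fst z) + 1 \<Longrightarrow> t \<in> {0..T} \<Longrightarrow> t' \<in> {0..T} \<Longrightarrow> \<bar>v x t - v x t'\<bar> \<le> L * \<bar>t - t'\<bar>"
    using v_lipschitz_time[of "norm (fst z) + 1"] by blast
  have "(Kg + L)-lipschitz_on (cball z 1 \<inter> UNIV \<times> I) (\<lambda>(x, t). v x t)"
  proof (rule lipschitz_onI)
    fix z1 z2 assume z12: "z1 \<in> cball z 1 \<inter> UNIV \<times> I" "z2 \<in> cball z 1 \<inter> UNIV \<times> I"
    obtain x1 t1 x2 t2 where z: "z1 = (x1, t1)" "z2 = (x2, t2)" by (cases z1, cases z2)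
    have t: "t1 \<in> {0..T}" "t2 \<in> {0..T}" using z12 z assms by auto
    have "dist (fst z) x2 \<le> 1" using z12(2) dist_fst_le[of z z2] by (simp add: z)
    then have x2: "norm x2 \<le> norm (fst z) + 1"
      using norm_triangle_sub[of x2 "fst z"] by (simp add: dist_norm norm_minus_commute)
    have "\<bar>v x1 t1 - v x2 t2\<bar> \<le> Kg * norm (x1 - x2) + L * \<bar>t1 - t2\<bar>"
      using v_lipschitz_space[OF t(1), of x1 x2] L(2)[OF x2 t] by linarith
    also have "\<dots> \<le> Kg * dist z1 z2 + L * dist z1 z2"
    proof (intro add_mono mult_left_mono Kg_nonneg L(1))
      show "norm (x1 - x2) \<le> dist z1 z2" using dist_fst_le[of z1 z2] by (simp add: z dist_norm)
      show "\<bar>t1 - t2\<bar> \<le> dist z1 z2" using dist_snd_le[of z1 z2] by (simp add: z dist_real_def)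
    qed
    finally show "dist (case z1 of (x, t) \<Rightarrow> v x t) (case z2 of (x, t) \<Rightarrow> v x t) \<le> (Kg + L) * dist z1 z2"
      by (simp add: z dist_real_def distrib_right)
  qed (use Kg_nonneg L(1) in simp)
  then have "(1::real) > 0 \<and> (\<exists>L. L-lipschitz_on (cball z 1 \<inter> UNIV \<times> I) (\<lambda>(x, t). v x t))"
    by (intro conjI zero_less_one exI)
  then show "\<exists>r>0. \<exists>L. L-lipschitz_on (cball z r \<inter> UNIV \<times> I) (\<lambda>(x, t). v x t)"
    by (rule exI)
qed

end

section \<open>The Hamilton-Jacobi equation\<close>

lemma integral_tail_has_vector_derivative:
  fixes f :: "real \<Rightarrow> 'a::banach"
  assumes f: "continuous_on {b..c} f" and t: "t \<in> {b<..<c}"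
  shows "((\<lambda>t. integral {t..c} f) has_vector_derivative - f t) (at t)"
proof -
  have "((\<lambda>t. integral {b..t} f) has_vector_derivative f t) (at t within {b..c})"
    using t by (intro integral_has_vector_derivative[OF f]) auto
  then have "((\<lambda>t. integral {b..c} f - integral {b..t} f) has_vector_derivative 0 - f t) (at t within {b..c})"
    by (intro derivative_intros)
  then have "((\<lambda>t. integral {b..c} f - integral {b..t} f) has_vector_derivative - f t) (at t)"
    using t by (simp add: at_within_Icc_at)
  then show ?thesis
  proof (rule has_vector_derivative_transform_within_open[of _ _ _ "{b<..<c}"])
    fix s assume s: "s \<in> {b<..<c}"
    have "integral {b..s} f + integral {s..c} f = integral {b..c} f"
      using s by (intro Henstock_Kurzweil_Integration.integral_combine integrable_continuous_real f) auto
    then show "integral {b..c} f - integral {b..s} f = integral {s..c} f" by (simp add: algebra_simps)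
  qed (use t in auto)
qed

lemma DERIV_zero_quadratic:
  fixes Q :: "real \<Rightarrow> real"
  assumes "\<forall>\<^sub>F s in at t. \<bar>Q s\<bar> \<le> K * (s - t)\<^sup>2" "Q t = 0"
  shows "DERIV Q t :> 0"
proof -
  have "((\<lambda>s. (Q s - Q t) / (s - t)) \<longlongrightarrow> 0) (at t)"
  proof (rule Lim_null_comparison)
    show "\<forall>\<^sub>F s in at t. norm ((Q s - Q t) / (s - t)) \<le> K * \<bar>s - t\<bar>"
      using assms(1) eventually_neq_at_within[of t t UNIV]
      by eventually_elim (simp add: assms(2) abs_divide divide_le_eq power2_eq_square abs_mult[symmetric] mult.assoc)
    show "((\<lambda>s. K * \<bar>s - t\<bar>) \<longlongrightarrow> 0) (at t)" by (auto intro!: tendsto_eq_intros)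
  qed
  then show ?thesis by (simp add: has_field_derivative_iff)
qed

context discounted
begin

text \<open>Off the diagonal \<open>t\<close> is interior to \<open>{0..s}\<close>, so the one-sided
  derivative behind \<open>partial_t\<close> is two-sided. The diagonal is a single point of the
  time integral and is discarded there.\<close>

lemma d_has_derivative:
  assumes "0 < t" "t < s" "s \<le> T"
  shows "DERIV (\<lambda>\<tau>. d \<tau> s) t :> partial_t d t s"
proof -
  have "((\<lambda>\<tau>. d \<tau> s) has_vector_derivative partial_t d t s) (at t within {0..s})"
    unfolding partial_t_def using d_differentiable[of t s] assms by (simp add: vector_derivative_works)
  then show ?thesis
    using assms by (simp add: at_within_Icc_at has_real_derivative_iff_has_vector_derivative)
qed

text \<open>A Leibniz rule with a moving lower limit. \<open>A\<close> varies the discount at a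
  fixed limit, by dominated convergence with the Lipschitz bound \<open>Kd * B\<close>;
  \<open>E\<close> varies the limit at a fixed discount and contributes \<open>- f t\<close> because
  \<open>d t t = 1\<close>; \<open>Q\<close> is the mixed second difference, which is quadratically
  small.\<close>

lemma discounted_integral_DERIV:
  assumes t: "0 < t" "t < T" and f: "continuous_on {0..T} f"
  shows "DERIV (\<lambda>\<tau>. integral {\<tau>..T} (\<lambda>s. d \<tau> s * f s)) t :>
    integral {t..T} (\<lambda>s. partial_t d t s * f s) - f t"
proof -
  have tT: "t \<in> {0..T}" using t by simp
  obtain B where B: "\<And>s. s \<in> {0..T} \<Longrightarrow> \<bar>f s\<bar> \<le> B"
    using continuous_on_Icc_bound[OF f] by (metis real_norm_def)
  have B0: "0 \<le> B" using B[OF tT] by (auto intro: order_trans[OF abs_ge_zero])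
  have c: "continuous_on {0..T} (\<lambda>s. d \<tau> s * f s)" if "\<tau> \<in> {0..T}" for \<tau>
    by (intro continuous_intros d_continuous[OF that] f)
  have c': "continuous_on {t0..T} (\<lambda>s. d \<tau> s * f s)" if "\<tau> \<in> {0..T}" "0 \<le> t0" for \<tau> t0
    by (rule continuous_on_subset[OF c[OF that(1)]]) (use that in auto)
  have near: "\<forall>\<^sub>F \<tau> in at t. \<tau> \<in> {0<..<T}"
    using t by (intro eventually_at_in_open') auto
  define A where "A = (\<lambda>\<tau>. integral {t..T} (\<lambda>s. d \<tau> s * f s))"
  define E where "E = (\<lambda>\<tau>. integral {\<tau>..T} (\<lambda>s. d t s * f s))"
  define Q where "Q = (\<lambda>\<tau>. integral {\<tau>..T} (\<lambda>s. (d \<tau> s - d t s) * f s) - integral {t..T} (\<lambda>s. (d \<tau> s - d t s) * f s))"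
  have A: "DERIV A t :> integral {t..T} (\<lambda>s. partial_t d t s * f s)"
    unfolding has_field_derivative_iff tendsto_at_iff_sequentially
  proof (intro allI impI)
    fix X assume X: "\<forall>i. X i \<in> UNIV - {t}" "X \<longlonglongrightarrow> t"
    obtain N where N: "\<And>n. N \<le> n \<Longrightarrow> X n \<in> {0<..<T}"
      using topological_tendstoD[OF X(2), of "{0<..<T}"] t unfolding eventually_sequentially by auto
    define Y where "Y = (\<lambda>n. X (n + N))"
    have Y: "Y n \<noteq> t" "Y n \<in> {0..T}" for n using X(1) N[of "n + N"] by (auto simp: Y_def)
    have Yt: "Y \<longlonglongrightarrow> t" unfolding Y_def using X(2) by (rule LIMSEQ_ignore_initial_segment)
    define q where "q = (\<lambda>n s. (d (Y n) s * f s - d t s * f s) / (Y n - t))"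
    have qint: "q n integrable_on {t..T}" for n
      unfolding q_def using t Y by (intro integrable_continuous_real continuous_intros c' tT) auto
    \<comment> \<open>At \<open>s = t\<close> the quotients need not converge to
      \<open>partial_t\<close>, which is only a left derivative there; both integrands are set to 0
      at this one point.\<close>
    have "(\<lambda>n. integral {t..T} (\<lambda>s. if s = t then 0 else q n s)) \<longlonglongrightarrow> integral {t..T} (\<lambda>s. if s = t then 0 else partial_t d t s * f s)"
    proof (rule dominated_convergence(2)[where h = "\<lambda>_. Kd * B"])
      show "(\<lambda>s. if s = t then 0 else q n s) integrable_on {t..T}" for n
        by (rule integrable_spike[OF qint[of n], of "{t}"]) auto
      show "norm (if s = t then 0 else q n s) \<le> Kd * B" if s: "s \<in> {t..T}" for n s
      proof -
        have s': "s \<in> {0..T}" using s t by auto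
        have "\<bar>q n s\<bar> = \<bar>d (Y n) s - d t s\<bar> * \<bar>f s\<bar> / \<bar>Y n - t\<bar>"
          by (simp add: q_def left_diff_distrib[symmetric] abs_mult abs_divide)
        also have "\<dots> \<le> (Kd * \<bar>Y n - t\<bar>) * B / \<bar>Y n - t\<bar>"
          using d_diff_le[OF Y(2) tT s', of n] B[OF s'] Kd_nonneg by (intro divide_right_mono mult_mono) auto
        also have "\<dots> = Kd * B" using Y(1)[of n] by simp
        finally show ?thesis using Kd_nonneg B0 by simp
      qed
      show "(\<lambda>n. if s = t then 0 else q n s) \<longlonglongrightarrow> (if s = t then 0 else partial_t d t s * f s)" if s: "s \<in> {t..T}" for s
      proof (cases "s = t")
        case False
        then have "DERIV (\<lambda>\<tau>. d \<tau> s) t :> partial_t d t s" using s t by (intro d_has_derivative) auto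
        then have "((\<lambda>\<tau>. (d \<tau> s - d t s) / (\<tau> - t)) \<longlongrightarrow> partial_t d t s) (at t)"
          by (simp add: has_field_derivative_iff)
        then have "((\<lambda>\<tau>. (d \<tau> s - d t s) / (\<tau> - t)) \<circ> Y) \<longlonglongrightarrow> partial_t d t s"
          unfolding tendsto_at_iff_sequentially using Y(1) Yt by blast
        from tendsto_mult_right[OF this, of "f s"] False show ?thesis
          by (simp add: q_def o_def left_diff_distrib diff_divide_distrib)
      qed simp
    qed auto
    also have "(\<lambda>n. integral {t..T} (\<lambda>s. if s = t then 0 else q n s)) = (\<lambda>n. integral {t..T} (q n))"
      by (intro ext integral_spike[of "{t}"]) auto
    also have "integral {t..T} (\<lambda>s. if s = t then 0 else partial_t d t s * f s) = integral {t..T} (\<lambda>s. partial_t d t s * f s)"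
      by (intro integral_spike[of "{t}"]) auto
    also have "(\<lambda>n. integral {t..T} (q n)) = (\<lambda>n. (A (Y n) - A t) / (Y n - t))"
    proof
      fix n
      have "integral {t..T} (q n) = integral {t..T} (\<lambda>s. d (Y n) s * f s - d t s * f s) / (Y n - t)"
        unfolding q_def by (rule integral_divide)
      also have "integral {t..T} (\<lambda>s. d (Y n) s * f s - d t s * f s) = A (Y n) - A t"
        unfolding A_def using t Y by (intro integral_diff integrable_continuous_real c' tT) auto
      finally show "integral {t..T} (q n) = (A (Y n) - A t) / (Y n - t)" .
    qed
    finally have "(\<lambda>n. ((\<lambda>\<tau>. (A \<tau> - A t) / (\<tau> - t)) \<circ> X) (n + N)) \<longlonglongrightarrow> integral {t..T} (\<lambda>s. partial_t d t s * f s)"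
      by (simp add: Y_def o_def)
    then show "((\<lambda>\<tau>. (A \<tau> - A t) / (\<tau> - t)) \<circ> X) \<longlonglongrightarrow> integral {t..T} (\<lambda>s. partial_t d t s * f s)"
      by (rule LIMSEQ_offset)
  qed
  have "(E has_vector_derivative - (d t t * f t)) (at t)"
    unfolding E_def using integral_tail_has_vector_derivative[OF c[OF tT], of t] t by simp
  then have E: "DERIV E t :> - f t"
    by (simp add: has_real_derivative_iff_has_vector_derivative d_diag[OF tT])
  have Q: "DERIV Q t :> 0"
  proof (rule DERIV_zero_quadratic)
    show "\<forall>\<^sub>F \<tau> in at t. \<bar>Q \<tau>\<bar> \<le> (Kd * B) * (\<tau> - t)\<^sup>2"
      using near
    proof eventually_elim
      fix \<tau> assume "\<tau> \<in> {0<..<T}"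
      then have \<tau>: "\<tau> \<in> {0..T}" by simp
      have "norm (Q \<tau>) \<le> (Kd * \<bar>\<tau> - t\<bar> * B) * \<bar>\<tau> - t\<bar>"
        unfolding Q_def
      proof (rule integral_tail_diff[OF _ _ tT \<tau>])
        show "continuous_on {0..T} (\<lambda>s. (d \<tau> s - d t s) * f s)"
          by (intro continuous_intros d_continuous \<tau> tT f)
        fix s assume s: "s \<in> {0..T}"
        show "norm ((d \<tau> s - d t s) * f s) \<le> Kd * \<bar>\<tau> - t\<bar> * B"
          using d_diff_le[OF \<tau> tT s] B[OF s] Kd_nonneg by (simp add: abs_mult mult_mono)
      qed
      also have "(Kd * \<bar>\<tau> - t\<bar> * B) * \<bar>\<tau> - t\<bar> = (Kd * B) * (\<bar>\<tau> - t\<bar> * \<bar>\<tau> - t\<bar>)" by simp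
      also have "\<bar>\<tau> - t\<bar> * \<bar>\<tau> - t\<bar> = (\<tau> - t)\<^sup>2" by (simp add: power2_eq_square)
      finally show "\<bar>Q \<tau>\<bar> \<le> (Kd * B) * (\<tau> - t)\<^sup>2" by simp
    qed
  qed (simp add: Q_def)
  have "DERIV (\<lambda>\<tau>. A \<tau> + (E \<tau> - E t) + Q \<tau>) t :> integral {t..T} (\<lambda>s. partial_t d t s * f s) - f t"
    by (rule DERIV_cong[OF DERIV_add[OF DERIV_add[OF A DERIV_diff[OF E DERIV_const]] Q]]) simp
  then show ?thesis
  proof (rule has_field_derivative_transform_within_open[of _ _ _ "{0<..<T}"])
    fix \<tau> assume "\<tau> \<in> {0<..<T}"
    then have \<tau>: "\<tau> \<in> {0..T}" by simp
    have i: "(\<lambda>s. d \<tau>' s * f s) integrable_on {t0..T}" if "\<tau>' \<in> {0..T}" "0 \<le> t0" for \<tau>' t0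
      using that by (intro integrable_continuous_real c')
    have "integral {t0..T} (\<lambda>s. (d \<tau> s - d t s) * f s) = integral {t0..T} (\<lambda>s. d \<tau> s * f s) - integral {t0..T} (\<lambda>s. d t s * f s)" if "0 \<le> t0" for t0
      unfolding left_diff_distrib by (intro integral_diff i \<tau> tT that)
    then show "A \<tau> + (E \<tau> - E t) + Q \<tau> = integral {\<tau>..T} (\<lambda>s. d \<tau> s * f s)"
      using \<tau> t by (simp add: A_def E_def Q_def)
  qed (use t in auto)
qed

lemma DERIV_upper_bound:
  fixes h :: "real \<Rightarrow> real"
  assumes "DERIV h t :> D" "0 < e"
  shows "\<forall>\<^sub>F \<tau> in nhds t. h \<tau> \<le> h t + D * (\<tau> - t) + e * \<bar>\<tau> - t\<bar>"
proof -
  obtain \<delta> where "0 < \<delta>" "\<And>y. \<bar>y - t\<bar> < \<delta> \<Longrightarrow> \<bar>h y - h t - D * (y - t)\<bar> \<le> e * \<bar>y - t\<bar>"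
    using assms unfolding has_field_derivative_def has_derivative_at_alt by auto
  then show ?thesis
    unfolding eventually_nhds_metric dist_real_def by (intro exI[of _ \<delta>]) fastforce
qed

text \<open>The competitor for the data \<open>(x', t')\<close> is the optimal velocity for \<open>(x, t)\<close> plus the constant
  that makes both curves end at the same point, so only the discount enters the terminal cost.\<close>

lemma v_supergradient:
  fixes x p :: "real ^ 'n"
  assumes t: "0 < t" "t < T" and p: "\<And>q. p_cost l g d T x t p \<le> p_cost l g d T x t q"
  defines "Y \<equiv> x + displacement t p"
  shows "supergradient (\<lambda>(x, t). v x t) (x, t)
    (- p, p \<bullet> iota l p - l (iota l p)
      + integral {t..T} (\<lambda>s. partial_t d t s * l (u t p s)) + partial_t d t T * g Y)"
    (is "supergradient _ _ (_, ?D)")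
  unfolding supergradient_def
proof (intro allI impI)
  fix e :: real assume e: "0 < e"
  have tT: "t \<in> {0..T}" using t by simp
  have cu: "continuous_on {0..T} (u t p)" by (rule u_continuous[OF tT])
  have clu: "continuous_on {0..T} (\<lambda>s. l (u t p s))"
    by (intro continuous_on_compose2[OF l_continuous[of UNIV]] cu) auto
  define W where "W = (\<lambda>\<tau>. integral {\<tau>..T} (u t p))"
  \<comment> \<open>The cost of the corrected competitor started at time \<open>\<tau>\<close> from
    \<open>x\<close>, with the effect of the correction replaced by its first-order term
    \<open>p \<bullet> (W t - W \<tau>)\<close>.\<close>
  define \<theta> where "\<theta> = (\<lambda>\<tau>. integral {\<tau>..T} (\<lambda>s. d \<tau> s * l (u t p s)) + d \<tau> T * g Y + p \<bullet> (W t - W \<tau>))"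
  have \<theta>t: "\<theta> t = v x t"
    by (simp add: \<theta>_def v_eq_p_cost[OF p] p_cost_eq[OF tT] Y_def)
  have utt: "u t p t = iota l p" by (simp add: u_def d_diag[OF tT])
  have "(W has_vector_derivative - iota l p) (at t)"
    unfolding W_def using integral_tail_has_vector_derivative[OF cu, of t] t utt by simp
  then have "((\<lambda>\<tau>. p \<bullet> (W t - W \<tau>)) has_vector_derivative p \<bullet> (0 - (- iota l p))) (at t)"
    by (intro bounded_linear.has_vector_derivative[OF bounded_linear_inner_right] derivative_intros)
  then have W: "DERIV (\<lambda>\<tau>. p \<bullet> (W t - W \<tau>)) t :> p \<bullet> iota l p"
    by (simp add: has_real_derivative_iff_has_vector_derivative)
  have \<theta>': "DERIV \<theta> t :> ?D"
    unfolding \<theta>_def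
    by (rule DERIV_cong[OF DERIV_add[OF DERIV_add[OF discounted_integral_DERIV[OF t clu]
      DERIV_cmult_right[OF d_has_derivative[OF t order_refl]]] W]]) (simp add: utt)
  obtain M where M: "0 \<le> M" "\<And>s. s \<in> {0..T} \<Longrightarrow> norm (u t p s) \<le> M"
  proof -
    have "bounded (u t p ` {0..T})" by (intro compact_imp_bounded compact_continuous_image cu compact_Icc)
    then obtain b where "0 < b" "\<forall>y\<in>u t p ` {0..T}. norm y \<le> b" unfolding bounded_pos by blast
    then show thesis using that[of b] by auto
  qed
  have "compact (cball (0 :: real ^ 'n) (M + 1))" by simp
  then have ucont: "uniformly_continuous_on (cball 0 (M + 1)) (grad l)"
    by (intro compact_uniformly_continuous continuous_on_subset[OF grad_continuous]) auto
  obtain B where B: "0 < B" "\<And>w. norm w \<le> M + 1 \<Longrightarrow> norm (grad l w) \<le> B"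
  proof -
    have "bounded (grad l ` cball 0 (M + 1))"
      by (intro compact_imp_bounded compact_continuous_image continuous_on_subset[OF grad_continuous]) auto
    then obtain b where "0 < b" "\<forall>y\<in>grad l ` cball 0 (M + 1). norm y \<le> b" unfolding bounded_pos by blast
    then show thesis using that[of b] by auto
  qed
  \<comment> \<open>One half of \<open>e\<close> is spent on the error of the correction, which is
    at most \<open>(1 + M) * \<omega>\<close> per unit distance, and the other half on the
    differentiability of \<open>\<theta>\<close>. Within \<open>\<omega>\<close>, one half goes to
    the variation of \<open>grad l\<close> and one to that of the discount.\<close>
  define \<omega> where "\<omega> = e / (2 * (1 + M))"
  have \<omega>: "0 < \<omega>" "(1 + M) * \<omega> = e / 2" using e M by (auto simp: \<omega>_def field_simps)
  obtain \<delta> where \<delta>: "0 < \<delta>" "\<And>b c. norm b \<le> M + 1 \<Longrightarrow> norm c \<le> M + 1 \<Longrightarrow> norm (b - c) < \<delta> \<Longrightarrow> norm (grad l b - grad l c) < \<omega> / 2"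
    using ucont[unfolded uniformly_continuous_on_def dist_norm, rule_format, of "\<omega> / 2"] \<omega>(1)
    by (auto simp: norm_minus_commute)
  \<comment> \<open>Running for the time \<open>T - snd z\<close> with this additional constant
    velocity makes up for the changed initial point and the changed interval at once.\<close>
  define c where "c = (\<lambda>z. (1 / (T - snd z)) *\<^sub>R (x - fst z + (W t - W (snd z))))"
  have contW: "isCont W t"
    using \<open>(W has_vector_derivative - iota l p) (at t)\<close> by (rule has_vector_derivative_continuous)
  have "(c \<longlongrightarrow> (1 / (T - t)) *\<^sub>R (x - x + (W t - W t))) (nhds (x, t))"
  proof -
    have s: "(snd \<longlongrightarrow> t) (nhds (x, t))" and f: "(fst \<longlongrightarrow> x) (nhds (x, t))"
      using tendsto_fst[OF filterlim_ident, of "(x, t)"] tendsto_snd[OF filterlim_ident, of "(x, t)"] by simp_all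
    have "((\<lambda>z. W (snd z)) \<longlongrightarrow> W t) (nhds (x, t))"
      by (rule isCont_tendsto_compose[OF contW s])
    then show ?thesis unfolding c_def using t s f by (intro tendsto_intros) auto
  qed
  then have "(c \<longlongrightarrow> 0) (nhds (x, t))" by simp
  then have ev_c: "\<forall>\<^sub>F z in nhds (x, t). norm (c z) < min 1 \<delta>"
    using \<delta>(1) by (auto simp: tendsto_iff dest!: spec[of _ "min 1 \<delta>"])
  have lim_snd: "filterlim snd (nhds t) (nhds (x, t))"
    using tendsto_snd[OF filterlim_ident, of "(x, t)"] by simp
  have ev_t: "\<forall>\<^sub>F z in nhds (x, t). snd z \<in> {0<..<T}"
    by (rule eventually_compose_filterlim[OF eventually_nhds_in_open lim_snd]) (use t in auto)
  have ev_d: "\<forall>\<^sub>F z in nhds (x, t). Kd * \<bar>snd z - t\<bar> * B < \<omega> / 2"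
  proof -
    have "((\<lambda>z. Kd * \<bar>snd z - t\<bar> * B) \<longlongrightarrow> Kd * \<bar>t - t\<bar> * B) (nhds (x, t))"
      by (intro tendsto_intros lim_snd)
    then show ?thesis using \<omega>(1) by (intro order_tendstoD(2)) auto
  qed
  have ev_\<theta>: "\<forall>\<^sub>F z in nhds (x, t). \<theta> (snd z) \<le> \<theta> t + ?D * (snd z - t) + (e / 2) * \<bar>snd z - t\<bar>"
    by (rule eventually_compose_filterlim[OF DERIV_upper_bound[OF \<theta>'] lim_snd]) (use e in simp)
  from ev_c ev_t ev_d ev_\<theta>
  show "\<forall>\<^sub>F z in nhds (x, t). (case z of (x, t) \<Rightarrow> v x t) \<le>
    (case (x, t) of (x, t) \<Rightarrow> v x t) + (- p, ?D) \<bullet> (z - (x, t)) + e * norm (z - (x, t))"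
  proof eventually_elim
    fix z :: "(real ^ 'n) \<times> real"
    assume cz: "norm (c z) < min 1 \<delta>" and tz: "snd z \<in> {0<..<T}"
      and dz: "Kd * \<bar>snd z - t\<bar> * B < \<omega> / 2"
      and \<theta>z: "\<theta> (snd z) \<le> \<theta> t + ?D * (snd z - t) + (e / 2) * \<bar>snd z - t\<bar>"
    obtain x' t' where z: "z = (x', t')" by (cases z)
    define k where "k = c z"
    define \<Delta> where "\<Delta> = x - x' + (W t - W t')"
    have t': "t' \<in> {0..T}" "0 < t'" "t' < T" using tz z by auto
    have k: "norm k < 1" "norm k < \<delta>" using cz by (auto simp: k_def)
    have k\<Delta>: "(T - t') *\<^sub>R k = \<Delta>" using t' by (simp add: k_def c_def z \<Delta>_def)
    have cu': "continuous_on {t'..T} (u t p)" using t' by (intro continuous_on_subset[OF cu]) auto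
    have cuk: "continuous_on {t'..T} (\<lambda>s. u t p s + k)" by (intro continuous_intros cu')
    have int: "integral {t'..T} (\<lambda>s. u t p s + k) = W t' + \<Delta>"
      using t' cu' k\<Delta> by (subst integral_add) (auto simp: W_def intro: integrable_continuous_real)
    then have end_point: "x' + integral {t'..T} (\<lambda>s. u t p s + k) = Y"
      by (simp add: \<Delta>_def Y_def W_def displacement_def)
    have pt: "d t' s * l (u t p s + k) \<le> d t' s * l (u t p s) + (p \<bullet> k + norm k * \<omega>)"
      if s: "s \<in> {t'..T}" for s
    proof -
      have s': "s \<in> {0..T}" using s t' by auto
      have ds: "0 < d t' s" "d t' s \<le> 1" "0 < d t s" "d t s \<le> 1" using d_bounds t'(1) tT s' by auto
      let ?w = "u t p s"
      have nw: "norm ?w \<le> M" "norm (?w + k) \<le> M + 1"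
        using M(2)[OF s'] k(1) norm_triangle_ineq[of ?w k] by auto
      have mom: "d t s *\<^sub>R grad l ?w = p" using ds by (simp add: u_def)
      \<comment> \<open>The tangent is taken at the perturbed velocity, so convexity yields a bound
        from above. Replacing the perturbed momentum at \<open>t'\<close> by the one at
        \<open>t\<close>, which is exactly \<open>p\<close>, costs at most
        \<open>\<omega> * norm k\<close>.\<close>
      have "l (?w + k) + grad l (?w + k) \<bullet> (?w - (?w + k)) \<le> l ?w" by (rule l_tangent)
      then have "l (?w + k) \<le> l ?w + grad l (?w + k) \<bullet> k" by simp
      then have "d t' s * l (?w + k) \<le> d t' s * (l ?w + grad l (?w + k) \<bullet> k)"
        using ds by (intro mult_left_mono) auto
      also have "\<dots> = d t' s * l ?w + p \<bullet> k + (d t' s *\<^sub>R grad l (?w + k) - d t s *\<^sub>R grad l ?w) \<bullet> k"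
        unfolding mom by (simp add: inner_diff_left distrib_left)
      also have "(d t' s *\<^sub>R grad l (?w + k) - d t s *\<^sub>R grad l ?w) \<bullet> k \<le> \<omega> * norm k"
      proof -
        have split: "d t' s *\<^sub>R b - d t s *\<^sub>R c = (d t' s - d t s) *\<^sub>R b + d t s *\<^sub>R (b - c)"
          for b c :: "real ^ 'n"
          by (simp only: scaleR_left_diff_distrib scaleR_right_diff_distrib) simp
        have "norm (d t' s *\<^sub>R grad l (?w + k) - d t s *\<^sub>R grad l ?w)
          \<le> norm ((d t' s - d t s) *\<^sub>R grad l (?w + k)) + norm (d t s *\<^sub>R (grad l (?w + k) - grad l ?w))"
          unfolding split by (rule norm_triangle_ineq)
        also have "\<dots> = \<bar>d t' s - d t s\<bar> * norm (grad l (?w + k)) + d t s * norm (grad l (?w + k) - grad l ?w)"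
          using ds by (simp only: norm_scaleR abs_of_pos)
        also have "\<dots> \<le> Kd * \<bar>t' - t\<bar> * B + 1 * (\<omega> / 2)"
        proof (rule add_mono)
          show "\<bar>d t' s - d t s\<bar> * norm (grad l (?w + k)) \<le> Kd * \<bar>t' - t\<bar> * B"
            using d_diff_le[OF t'(1) tT s'] B(2)[OF nw(2)] Kd_nonneg by (intro mult_mono) auto
          have "norm (grad l (?w + k) - grad l ?w) < \<omega> / 2" using nw k by (intro \<delta>(2)) auto
          then show "d t s * norm (grad l (?w + k) - grad l ?w) \<le> 1 * (\<omega> / 2)"
            using ds by (intro mult_mono) auto
        qed
        also have "\<dots> \<le> \<omega>" using dz z by simp
        finally have "norm (d t' s *\<^sub>R grad l (?w + k) - d t s *\<^sub>R grad l ?w) * norm k \<le> \<omega> * norm k"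
          by (intro mult_right_mono) auto
        then show ?thesis by (rule order_trans[OF norm_cauchy_schwarz])
      qed
      finally show ?thesis by (simp add: mult.commute)
    qed
    have "v x' t' \<le> integral {t'..T} (\<lambda>s. d t' s * l (u t p s + k)) + d t' T * g Y"
      using v_le_cost[OF t'(1) cuk, of x'] end_point by simp
    also have "integral {t'..T} (\<lambda>s. d t' s * l (u t p s + k))
      \<le> integral {t'..T} (\<lambda>s. d t' s * l (u t p s) + (p \<bullet> k + norm k * \<omega>))"
      using pt t' cu' cuk by (intro integral_le integrable_continuous_real continuous_intros dl_continuous) auto
    also have "\<dots> = integral {t'..T} (\<lambda>s. d t' s * l (u t p s)) + (T - t') * (p \<bullet> k + norm k * \<omega>)"
      using t' cu' by (subst integral_add) (auto intro!: integrable_continuous_real dl_continuous)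
    also have "(T - t') * (p \<bullet> k + norm k * \<omega>) = p \<bullet> \<Delta> + norm \<Delta> * \<omega>"
    proof -
      have "norm ((T - t') *\<^sub>R k) = (T - t') * norm k" using t' by simp
      then show ?thesis unfolding k\<Delta>[symmetric] by (simp only: inner_scaleR_right distrib_left mult.assoc)
    qed
    finally have "v x' t' \<le> \<theta> t' - p \<bullet> (x' - x) + norm \<Delta> * \<omega>"
      by (simp add: \<theta>_def \<Delta>_def inner_diff_right inner_add_right)
    moreover have "norm \<Delta> * \<omega> \<le> (e / 2) * norm (z - (x, t))"
    proof -
      have "norm (W t - W t') \<le> M * \<bar>t - t'\<bar>"
        unfolding W_def using M by (intro integral_tail_diff[OF cu _ t'(1) tT]) auto
      moreover have "\<bar>t - t'\<bar> \<le> norm (z - (x, t))" "norm (x - x') \<le> norm (z - (x, t))"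
        using norm_snd_le[of "t' - t" "x' - x"] norm_fst_le[of "x' - x" "t' - t"]
        by (simp_all add: z norm_minus_commute abs_minus_commute)
      moreover from this have "M * \<bar>t - t'\<bar> \<le> M * norm (z - (x, t))" using M by (intro mult_left_mono) auto
      ultimately have "norm \<Delta> \<le> (1 + M) * norm (z - (x, t))"
        unfolding \<Delta>_def using norm_triangle_ineq[of "x - x'" "W t - W t'"] by (simp add: distrib_right)
      then have "norm \<Delta> * \<omega> \<le> ((1 + M) * norm (z - (x, t))) * \<omega>" using \<omega> by (intro mult_right_mono) auto
      also have "\<dots> = ((1 + M) * \<omega>) * norm (z - (x, t))" by simp
      finally show ?thesis by (simp only: \<omega>(2))
    qed
    moreover have "(e / 2) * \<bar>t' - t\<bar> \<le> (e / 2) * norm (z - (x, t))"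
      using norm_snd_le[of "t' - t" "x' - x"] e by (intro mult_left_mono) (simp_all add: z)
    ultimately have "v x' t' \<le> \<theta> t + ?D * (t' - t) - p \<bullet> (x' - x) + e * norm (z - (x, t))"
      using \<theta>z unfolding z snd_conv by linarith
    then show "(case z of (x, t) \<Rightarrow> v x t) \<le>
      (case (x, t) of (x, t) \<Rightarrow> v x t) + (- p, ?D) \<bullet> (z - (x, t)) + e * norm (z - (x, t))"
      by (simp add: z \<theta>t)
  qed
qed

lemma v_supergradient_exists:
  assumes "0 < t" "t < T"
  shows "\<exists>q. supergradient (\<lambda>(x, t). v x t) (x, t) q"
proof -
  have "t \<in> {0..T}" using assms by simp
  then obtain p where "\<And>q. p_cost l g d T x t p \<le> p_cost l g d T x t q"
    using minimizer_exists by metis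
  from v_supergradient[OF assms this] show ?thesis by blast
qed

text \<open>For the argument \<open>iota l p\<close> the velocity \<open>U_curve\<close> is the
  extremal \<open>u t p\<close>. Summability of \<open>partial_t\<close> times a bounded continuous
  factor makes the Lebesgue and the gauge integral agree.\<close>

lemma w_fun_eq:
  assumes t: "t \<in> {0..T}"
  shows "w_fun l g d T x t (iota l p) =
    integral {t..T} (\<lambda>s. partial_t d t s * l (u t p s)) + partial_t d t T * g (x + displacement t p)"
proof -
  have U: "U_curve l d t (iota l p) = u t p" by (auto simp: U_curve_def u_def)
  have cu: "continuous_on {t..T} (u t p)" using t by (intro u_continuous') auto
  have clu: "continuous_on {t..T} (\<lambda>s. l (u t p s))"
    by (intro continuous_on_compose2[OF l_continuous[of UNIV]] cu) auto
  have "(\<lambda>s. l (u t p s) * partial_t d t s) absolutely_integrable_on {t..T}"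
  proof (rule absolutely_integrable_bounded_measurable_product_real)
    show "(\<lambda>s. l (u t p s)) \<in> borel_measurable (lebesgue_on {t..T})"
      by (rule continuous_imp_measurable_on_sets_lebesgue[OF clu]) simp
    show "bounded ((\<lambda>s. l (u t p s)) ` {t..T})"
      by (intro compact_imp_bounded compact_continuous_image clu compact_Icc)
  qed (use d_summable[OF t] in auto)
  then have "(LINT s:{t..T}|lebesgue. partial_t d t s * l (u t p s)) = integral {t..T} (\<lambda>s. partial_t d t s * l (u t p s))"
    by (intro set_lebesgue_integral_eq_integral(2)) (simp add: mult.commute)
  moreover have "Y_curve l d t x (iota l p) T = x + displacement t p"
    by (simp add: Y_curve_def U displacement_def LINT_eq_integral[OF cu])
  ultimately show ?thesis by (simp add: w_fun_def U)
qed

text \<open>Where \<open>v\<close> is differentiable, its derivative equals the supergradient of any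
  minimiser \<open>p\<close>. Thus the space gradient is \<open>- p\<close>, the argument of
  \<open>w\<close> is \<open>iota l p\<close>, and the time component of the supergradient is the
  equation.\<close>

lemma v_hamilton_jacobi:
  assumes t: "0 < t" "t < T" and diff: "(\<lambda>(x, t). v x t) differentiable (at (x, t))"
  shows "- deriv (\<lambda>t. v x t) t + conjugate l (- grad (\<lambda>x. v x t) x)
    + w_fun l g d T x t (iota l (- grad (\<lambda>x. v x t) x)) = 0"
proof -
  let ?V = "\<lambda>(x, t). v x t"
  have tT: "t \<in> {0..T}" using t by simp
  then obtain p where p: "\<And>q. p_cost l g d T x t p \<le> p_cost l g d T x t q"
    using minimizer_exists by metis
  define D where "D = p \<bullet> iota l p - l (iota l p)
      + integral {t..T} (\<lambda>s. partial_t d t s * l (u t p s)) + partial_t d t T * g (x + displacement t p)"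
  have q: "supergradient ?V (x, t) (- p, D)"
    unfolding D_def by (rule v_supergradient[OF t p])
  obtain V' where V': "(?V has_derivative V') (at (x, t))" using diff by (auto simp: differentiable_def)
  \<comment> \<open>Restricting to the line through \<open>(x, t)\<close> in the direction
    \<open>h\<close> turns the total derivative into a one-dimensional one, to which the
    supergradient applies.\<close>
  have V'_eq: "V' h = (- p, D) \<bullet> h" for h
  proof -
    interpret linear V' using V' by (rule has_derivative_linear)
    have "((\<lambda>\<tau>. ?V ((x, t) + \<tau> *\<^sub>R h)) has_derivative (\<lambda>\<tau>. V' (\<tau> *\<^sub>R h))) (at 0)"
      by (rule has_derivative_compose[of "\<lambda>\<tau>. (x, t) + \<tau> *\<^sub>R h" "\<lambda>\<tau>. \<tau> *\<^sub>R h" 0 UNIV ?V V'])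
        (use V' in \<open>auto intro!: derivative_eq_intros\<close>)
    then have "DERIV (\<lambda>\<tau>. ?V ((x, t) + \<tau> *\<^sub>R h)) 0 :> V' h"
      unfolding has_field_derivative_def scaleR real_scaleR_def mult.commute[of _ "V' h"] .
    from supergradient_direction[OF q this] show ?thesis .
  qed
  have "((\<lambda>y. ?V (y, t)) has_derivative (\<lambda>h. V' (h, 0))) (at x)"
    by (rule has_derivative_compose[of "\<lambda>y. (y, t)" "\<lambda>h. (h, 0)" x UNIV ?V V'])
      (use V' in \<open>auto intro!: derivative_eq_intros\<close>)
  then have "((\<lambda>y. v y t) has_derivative (\<lambda>h. h \<bullet> (- p))) (at x)"
    by (simp add: V'_eq inner_commute)
  then have vx: "grad (\<lambda>y. v y t) x = - p" by (rule grad_eqI)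
  have "((\<lambda>\<tau>. ?V (x, \<tau>)) has_derivative (\<lambda>h. V' (0, h))) (at t)"
    by (rule has_derivative_compose[of "\<lambda>\<tau>. (x, \<tau>)" "\<lambda>h. (0, h)" t UNIV ?V V'])
      (use V' in \<open>auto intro!: derivative_eq_intros\<close>)
  then have "DERIV (\<lambda>\<tau>. v x \<tau>) t :> D"
    unfolding has_field_derivative_def by (simp add: V'_eq)
  then have vt: "deriv (\<lambda>\<tau>. v x \<tau>) t = D" by (rule DERIV_imp_deriv)
  show ?thesis
    unfolding vx vt by (simp add: conjugate_eq w_fun_eq[OF tT] D_def)
qed

lemma v_AE_hamilton_jacobi:
  "AE (x, t) in lebesgue_on (UNIV \<times> {0<..<T}).
    (\<lambda>(x, t). v x t) differentiable (at (x, t)) \<and>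
    - deriv (\<lambda>t. v x t) t + conjugate l (- grad (\<lambda>x. v x t) x)
      + w_fun l g d T x t (iota l (- grad (\<lambda>x. v x t) x)) = 0"
proof -
  let ?S = "UNIV \<times> {0<..<T} :: ((real ^ 'n) \<times> real) set"
  let ?N = "{z \<in> ?S. \<not> (\<lambda>(x, t). v x t) differentiable (at z)}"
  have S: "open ?S" by (intro open_Times) auto
  have "negligible ?N"
  proof (rule negligible_not_differentiable[OF S])
    show "locally_lipschitz_on ?S (\<lambda>(x, t). v x t)" by (rule v_locally_lipschitz) auto
  qed (use v_supergradient_exists in auto)
  then have "AE z in lebesgue. z \<notin> ?N" unfolding negligible_iff_null_sets by (rule AE_not_in)
  then have "AE z in lebesgue. z \<in> ?S \<longrightarrow> (case z of (x, t) \<Rightarrow> (\<lambda>(x, t). v x t) differentiable (at (x, t)) \<and>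
    - deriv (\<lambda>t. v x t) t + conjugate l (- grad (\<lambda>x. v x t) x)
      + w_fun l g d T x t (iota l (- grad (\<lambda>x. v x t) x)) = 0)"
  proof (rule AE_mp, intro AE_I2 impI)
    fix z :: "(real ^ 'n) \<times> real"
    assume "z \<notin> ?N" "z \<in> ?S"
    then obtain x t where "z = (x, t)" "0 < t" "t < T" "(\<lambda>(x, t). v x t) differentiable (at (x, t))"
      by auto
    with v_hamilton_jacobi show "case z of (x, t) \<Rightarrow> (\<lambda>(x, t). v x t) differentiable (at (x, t)) \<and>
      - deriv (\<lambda>t. v x t) t + conjugate l (- grad (\<lambda>x. v x t) x)
        + w_fun l g d T x t (iota l (- grad (\<lambda>x. v x t) x)) = 0"
      by (simp only: prod.case)
  qed
  moreover have "?S \<inter> space lebesgue \<in> sets lebesgue" using S by simp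
  ultimately show ?thesis using AE_restrict_space_iff by blast
qed

end

theorem theorem5p1:
  fixes l g :: "real ^ 'n \<Rightarrow> real" and d :: "real \<Rightarrow> real \<Rightarrow> real" and T a :: real
  assumes T_pos: "0 < T"
    and l_C2: "C2 l"
    and l_convex: "strictly_convex l"
    and l_superlinear: "filterlim (\<lambda>u. l u / norm u) at_top at_infinity"
    and l_hessian: "\<And>u. pos_def (hessian l u)"
    and g_lipschitz: "\<exists>K. K-lipschitz_on UNIV g"
    and g_differentiable: "\<And>x. g differentiable (at x)"
    and a_pos: "0 < a"
    and d_range: "\<And>t s. t \<in> {0..T} \<Longrightarrow> s \<in> {0..T} \<Longrightarrow> d t s \<in> {a<..1}"
    and d_lipschitz: "\<exists>K. K-lipschitz_on ({0..T} \<times> {0..T}) (\<lambda>(t, s). d t s)"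
    and d_diag: "\<And>t. t \<in> {0..T} \<Longrightarrow> d t t = 1"
    and d_differentiable:
      "\<And>t s. 0 \<le> t \<Longrightarrow> t \<le> s \<Longrightarrow> s \<le> T \<Longrightarrow> (\<lambda>\<tau>. d \<tau> s) differentiable (at t within {0..s})"
    and d_continuous:
      "\<And>s. s \<in> {0..T} \<Longrightarrow>
         continuous_on {0..s} (\<lambda>t. d t s) \<and> continuous_on {0..s} (\<lambda>t. partial_t d t s)"
    and d_summable:
      "\<And>t. t \<in> {0..T} \<Longrightarrow>
         set_integrable lebesgue {t..T} (d t) \<and> set_integrable lebesgue {t..T} (partial_t d t)"
  defines "v \<equiv> v_fun l g d T"
  shows "(\<forall>x. \<forall>t\<in>{0..T}. \<exists>p. v x t = p_cost l g d T x t p \<and>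
            (\<forall>q. p_cost l g d T x t p \<le> p_cost l g d T x t q))
       \<and> (\<forall>x. \<forall>t\<in>{0..T}. ereal (v x t) = value_fun l g d T x t)
       \<and> locally_lipschitz_on (UNIV \<times> {0..<T}) (\<lambda>(x, t). v x t)
       \<and> (AE (x, t) in lebesgue_on (UNIV \<times> {0<..<T}).
            (\<lambda>(x, t). v x t) differentiable (at (x, t)) \<and>
            (let v_x = grad (\<lambda>x. v x t) x; v_t = deriv (\<lambda>t. v x t) t
             in - v_t + conjugate l (- v_x) + w_fun l g d T x t (iota l (- v_x)) = 0))
       \<and> (\<forall>x. v x T = g x)"
proof -
  obtain Kg where Kg: "Kg-lipschitz_on UNIV g" using g_lipschitz by blast
  obtain Kd where Kd: "Kd-lipschitz_on ({0..T} \<times> {0..T}) (\<lambda>(t, s). d t s)" using d_lipschitz by blast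
  interpret discounted l g d T a Kg Kd
  proof
    show "l differentiable (at u)" for u using l_C2 by (simp add: C2_def)
    have "grad l differentiable (at u)" for u using l_C2 by (simp add: C2_def)
    then show "continuous_on UNIV (grad l)"
      by (meson continuous_at_imp_continuous_on differentiable_imp_continuous_within)
    show "set_integrable lebesgue {t..T} (partial_t d t)" if "t \<in> {0..T}" for t
      using d_summable[OF that] by simp
  qed (fact l_convex l_superlinear T_pos Kg a_pos d_range Kd d_diag d_differentiable)+
  show ?thesis
    unfolding v_def Let_def
  proof (intro conjI allI ballI)
    fix x :: "real ^ 'n" and t assume t: "t \<in> {0..T}"
    then obtain p where "\<And>q. p_cost l g d T x t p \<le> p_cost l g d T x t q"
      using minimizer_exists by metis
    then show "\<exists>p. v_fun l g d T x t = p_cost l g d T x t p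
        \<and> (\<forall>q. p_cost l g d T x t p \<le> p_cost l g d T x t q)"
      using v_eq_p_cost by blast
    show "ereal (v_fun l g d T x t) = value_fun l g d T x t" using value_fun_eq[OF t] by simp
  next
    show "locally_lipschitz_on (UNIV \<times> {0..<T}) (\<lambda>(x, t). v_fun l g d T x t)"
      by (rule v_locally_lipschitz) auto
  qed (rule v_AE_hamilton_jacobi v_T)+
qed

end
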